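(* Let $M$ be an oriented surface in $\mathbb{E}^3_1$ with diagonalizable shape operator. Then $M$ is endowed with a canonical principal direction relative to a light-like constant direction if and only if it is congruent to the surface given by $$x(s,t)=\left(\int_{s_0}^s\frac{1}{2\phi(\xi)^2}\,d\xi\right)(1,0,1)+s\left(\gamma_0(t),\sqrt{-2\varepsilon\gamma_0(t)+1},\gamma_0(t)-\varepsilon\right)+\int_{t_0}^t b(\xi)\left(\sqrt{-2\varepsilon\gamma_0(\xi)+1},-\varepsilon,\sqrt{-2\varepsilon\gamma_0(\xi)+1}\right)d\xi$$ for some smooth functions $b,\gamma_0$, some constants $s_0,t_0$ and $\varepsilon\in\{-1,1\}$, and a non-vanishing function $\phi$ whose derivative does not vanish. In this case, the tangential vector field $(1,0,1)^T=\phi(s)e_1$ is a principal direction of $M$, for a vector field $e_1$ with $\langle e_1,e_1\rangle=\varepsilon$.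
   Context: $\mathbb{E}^3_1$ is $\mathbb{R}^3$ with metric $\langle\cdot,\cdot\rangle=dx_1^2+dx_2^2-dx_3^2$ and Levi-Civita connection $\widetilde\nabla$. Surfaces are non-degenerate (space-like or Lorentzian, i.e. with Riemannian or Lorentzian induced metric). $N$ is the unit normal vector field and the shape operator is $S(X)=-\widetilde\nabla_XN$; $S$ is diagonalizable if it has a diagonal matrix representation with respect to a local orthonormal frame field of the tangent bundle. A constant direction is a fixed vector $k$ of $\mathbb{E}^3_1$; it is light-like if $k\neq0$ and $\langle k,k\rangle=0$. The superscript $T$ denotes the component tangent to $M$. $M$ is endowed with a canonical principal direction (CPD) relative to $k$ if $k^T$ is a principal direction, i.e. $S(k^T)=k_1k^T$ for a smooth function $k_1$. Standing assumption: locally, the principal curvature $k_1$ is a non-vanishing function (constant angle surfaces, for which $k_1=0$, are excluded). Congruent means equal up to an isometry of $\mathbb{E}^3_1$. The functions $b,\gamma_0$ are functions of $t$ and $\phi$ is a function of $s$. *)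

theory Defs
  imports "HOL-Analysis.Analysis"
begin

section \<open>Smooth maps on open sets\<close>

primrec Ck_on :: "nat \<Rightarrow> 'a::real_normed_vector set \<Rightarrow> ('a \<Rightarrow> 'b::real_normed_vector) \<Rightarrow> bool" where
  "Ck_on 0 S f \<longleftrightarrow> continuous_on S f"
| "Ck_on (Suc n) S f \<longleftrightarrow>
     (\<forall>p\<in>S. f differentiable (at p)) \<and> (\<forall>v. Ck_on n S (\<lambda>p. frechet_derivative f (at p) v))"

definition smooth_on :: "'a::real_normed_vector set \<Rightarrow> ('a \<Rightarrow> 'b::real_normed_vector) \<Rightarrow> bool" where
  "smooth_on S f \<longleftrightarrow> (\<forall>n. Ck_on n S f)"


section \<open>The Minkowski space\<close>

definition mink :: "real^3 \<Rightarrow> real^3 \<Rightarrow> real" (\<open>\<langle>_,_\<rangle>\<close>) where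
  "\<langle>u,v\<rangle> = u$1 * v$1 + u$2 * v$2 - u$3 * v$3"

definition light_like :: "real^3 \<Rightarrow> bool" where
  "light_like k \<longleftrightarrow> k \<noteq> 0 \<and> \<langle>k,k\<rangle> = 0"

text \<open>The isometries of the Minkowski space are the maps \<open>y \<mapsto> L y + a\<close> with \<open>L\<close> as follows;
  time- and orientation-reversing maps are included.\<close>

definition lorentz_map :: "(real^3 \<Rightarrow> real^3) \<Rightarrow> bool" where
  "lorentz_map L \<longleftrightarrow> linear L \<and> (\<forall>u v. \<langle>L u, L v\<rangle> = \<langle>u,v\<rangle>)"


section \<open>Immersed surfaces\<close>

text \<open>A surface is an open subset \<open>M\<close> of a (Hausdorff, second countable) space together with a
  map \<open>x\<close> into the Minkowski space (the immersion; it need not be injective). Its smooth structure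
  is the only one that makes \<open>x\<close> an immersion: the local parametrizations are the
  homeomorphisms \<open>\<psi>\<close> from open sets of the plane onto open sets of the surface for which
  \<open>x \<circ> \<psi>\<close> is a smooth immersion.\<close>

definition local_param ::
    "('a::topological_space \<Rightarrow> real^3) \<Rightarrow> (real \<times> real) set \<Rightarrow> (real \<times> real \<Rightarrow> 'a) \<Rightarrow> bool" where
  "local_param x W \<psi> \<longleftrightarrow>
     open W \<and> open (\<psi> ` W) \<and> (\<exists>\<psi>'. homeomorphism W (\<psi> ` W) \<psi> \<psi>') \<and>
     smooth_on W (x \<circ> \<psi>) \<and> (\<forall>u\<in>W. inj (frechet_derivative (x \<circ> \<psi>) (at u)))"

definition immersed_surface :: "'a::topological_space set \<Rightarrow> ('a \<Rightarrow> real^3) \<Rightarrow> bool" where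
  "immersed_surface M x \<longleftrightarrow>
     open M \<and> (\<forall>p\<in>M. \<exists>W \<psi>. local_param x W \<psi> \<and> p \<in> \<psi> ` W)"

definition smooth_along ::
    "'a::topological_space set \<Rightarrow> ('a \<Rightarrow> real^3) \<Rightarrow> ('a \<Rightarrow> 'b::real_normed_vector) \<Rightarrow> bool" where
  "smooth_along V x F \<longleftrightarrow>
     (\<forall>W \<psi>. local_param x W \<psi> \<and> \<psi> ` W \<subseteq> V \<longrightarrow> smooth_on W (F \<circ> \<psi>))"

definition tangent_space :: "('a::topological_space \<Rightarrow> real^3) \<Rightarrow> 'a \<Rightarrow> (real^3) set" where
  "tangent_space x p =
     {X. \<exists>W \<psi> u v. local_param x W \<psi> \<and> u \<in> W \<and> \<psi> u = p \<and>
           X = frechet_derivative (x \<circ> \<psi>) (at u) v}"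

text \<open>The Levi-Civita connection of the Minkowski space is the flat one, so that the covariant
  derivative of a vector field \<open>F\<close> along \<open>x\<close> in the direction of a tangent vector \<open>X\<close> is the
  ordinary directional derivative.\<close>

definition cov_deriv ::
    "('a::topological_space \<Rightarrow> real^3) \<Rightarrow> ('a \<Rightarrow> real^3) \<Rightarrow> 'a \<Rightarrow> real^3 \<Rightarrow> real^3" where
  "cov_deriv x F p X =
     (THE Y. \<exists>W \<psi> u v. local_param x W \<psi> \<and> u \<in> W \<and> \<psi> u = p \<and>
               X = frechet_derivative (x \<circ> \<psi>) (at u) v \<and>
               Y = frechet_derivative (F \<circ> \<psi>) (at u) v)"

definition tangential_part :: "('a::topological_space \<Rightarrow> real^3) \<Rightarrow> 'a \<Rightarrow> real^3 \<Rightarrow> real^3" where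
  "tangential_part x p k =
     (THE Y. Y \<in> tangent_space x p \<and> (\<forall>Z\<in>tangent_space x p. \<langle>k - Y, Z\<rangle> = 0))"

definition nondegenerate :: "'a::topological_space set \<Rightarrow> ('a \<Rightarrow> real^3) \<Rightarrow> bool" where
  "nondegenerate M x \<longleftrightarrow>
     (\<forall>p\<in>M. \<forall>X\<in>tangent_space x p. X \<noteq> 0 \<longrightarrow> (\<exists>Y\<in>tangent_space x p. \<langle>X,Y\<rangle> \<noteq> 0))"

definition unit_normal ::
    "'a::topological_space set \<Rightarrow> ('a \<Rightarrow> real^3) \<Rightarrow> ('a \<Rightarrow> real^3) \<Rightarrow> bool" where
  "unit_normal M x N \<longleftrightarrow> smooth_along M x N \<and>
     (\<forall>p\<in>M. \<bar>\<langle>N p, N p\<rangle>\<bar> = 1 \<and> (\<forall>X\<in>tangent_space x p. \<langle>N p, X\<rangle> = 0))"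

definition oriented_surface ::
    "'a::topological_space set \<Rightarrow> ('a \<Rightarrow> real^3) \<Rightarrow> ('a \<Rightarrow> real^3) \<Rightarrow> bool" where
  "oriented_surface M x N \<longleftrightarrow>
     immersed_surface M x \<and> nondegenerate M x \<and> unit_normal M x N"

definition shape_operator ::
    "('a::topological_space \<Rightarrow> real^3) \<Rightarrow> ('a \<Rightarrow> real^3) \<Rightarrow> 'a \<Rightarrow> real^3 \<Rightarrow> real^3" where
  "shape_operator x N p X = - cov_deriv x N p X"

definition orthonormal_frame ::
    "'a::topological_space set \<Rightarrow> ('a \<Rightarrow> real^3) \<Rightarrow> ('a \<Rightarrow> real^3) \<Rightarrow> ('a \<Rightarrow> real^3) \<Rightarrow> bool" where
  "orthonormal_frame V x E1 E2 \<longleftrightarrow> smooth_along V x E1 \<and> smooth_along V x E2 \<and>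
     (\<forall>q\<in>V. E1 q \<in> tangent_space x q \<and> E2 q \<in> tangent_space x q \<and>
        \<bar>\<langle>E1 q, E1 q\<rangle>\<bar> = 1 \<and> \<bar>\<langle>E2 q, E2 q\<rangle>\<bar> = 1 \<and> \<langle>E1 q, E2 q\<rangle> = 0)"

definition diagonalizable_shape_operator ::
    "'a::topological_space set \<Rightarrow> ('a \<Rightarrow> real^3) \<Rightarrow> ('a \<Rightarrow> real^3) \<Rightarrow> bool" where
  "diagonalizable_shape_operator M x N \<longleftrightarrow>
     (\<forall>p\<in>M. \<exists>V E1 E2. open V \<and> p \<in> V \<and> V \<subseteq> M \<and> orthonormal_frame V x E1 E2 \<and>
        (\<forall>q\<in>V. \<exists>l1 l2. shape_operator x N q (E1 q) = l1 *\<^sub>R E1 q \<and>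
                        shape_operator x N q (E2 q) = l2 *\<^sub>R E2 q))"

text \<open>\<open>k1\<close> is the principal curvature belonging to the tangential part of \<open>k\<close>.\<close>

definition canonical_principal_direction ::
    "'a::topological_space set \<Rightarrow> ('a \<Rightarrow> real^3) \<Rightarrow> ('a \<Rightarrow> real^3) \<Rightarrow> real^3 \<Rightarrow> ('a \<Rightarrow> real) \<Rightarrow> bool"
  where
  "canonical_principal_direction V x N k k1 \<longleftrightarrow> smooth_along V x k1 \<and>
     (\<forall>p\<in>V. shape_operator x N p (tangential_part x p k) = k1 p *\<^sub>R tangential_part x p k)"


section \<open>The family of surfaces\<close>

text \<open>The interval Lebesgue integral is oriented, so \<open>s < s0\<close> and \<open>t < t0\<close> are covered.\<close>

definition family_map ::
    "real \<Rightarrow> (real \<Rightarrow> real) \<Rightarrow> (real \<Rightarrow> real) \<Rightarrow> (real \<Rightarrow> real) \<Rightarrow> real \<Rightarrow> real \<Rightarrow> real \<times> real \<Rightarrow> real^3"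
  where
  "family_map \<epsilon> \<phi> \<gamma>0 b s0 t0 = (\<lambda>(s, t).
      (LBINT \<xi>=s0..s. 1 / (2 * (\<phi> \<xi>)\<^sup>2)) *\<^sub>R vector [1, 0, 1]
    + s *\<^sub>R vector [\<gamma>0 t, sqrt (- 2 * \<epsilon> * \<gamma>0 t + 1), \<gamma>0 t - \<epsilon>]
    + (LBINT \<xi>=t0..t. b \<xi> *\<^sub>R
         (vector [sqrt (- 2 * \<epsilon> * \<gamma>0 \<xi> + 1), - \<epsilon>, sqrt (- 2 * \<epsilon> * \<gamma>0 \<xi> + 1)] :: real^3)))"

text \<open>\<open>I\<close> and \<open>J\<close> are the intervals on which the functions of \<open>s\<close> and of \<open>t\<close> are defined. The
  last condition only says that the square roots are real.\<close>

definition family_data ::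
    "real \<Rightarrow> (real \<Rightarrow> real) \<Rightarrow> (real \<Rightarrow> real) \<Rightarrow> (real \<Rightarrow> real) \<Rightarrow> real \<Rightarrow> real \<Rightarrow>
     real set \<Rightarrow> real set \<Rightarrow> bool" where
  "family_data \<epsilon> \<phi> \<gamma>0 b s0 t0 I J \<longleftrightarrow>
     \<epsilon> \<in> {- 1, 1} \<and>
     open I \<and> is_interval I \<and> s0 \<in> I \<and> open J \<and> is_interval J \<and> t0 \<in> J \<and>
     smooth_on I \<phi> \<and> (\<forall>s\<in>I. \<phi> s \<noteq> 0 \<and> deriv \<phi> s \<noteq> 0) \<and>
     smooth_on J \<gamma>0 \<and> smooth_on J b \<and> (\<forall>t\<in>J. - 2 * \<epsilon> * \<gamma>0 t + 1 \<ge> 0)"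

text \<open>\<open>V\<close> is carried onto the surface parametrized by \<open>X\<close> on \<open>W\<close> by an isometry. Since
  \<open>x \<circ> \<psi>\<close> is an immersion, \<open>X\<close> is an immersion on \<open>W\<close> as well.\<close>

definition congruent_via ::
    "(real^3 \<Rightarrow> real^3) \<Rightarrow> real^3 \<Rightarrow> (real \<times> real \<Rightarrow> 'a) \<Rightarrow>
     'a::topological_space set \<Rightarrow> ('a \<Rightarrow> real^3) \<Rightarrow>
     (real \<times> real) set \<Rightarrow> (real \<times> real \<Rightarrow> real^3) \<Rightarrow> bool" where
  "congruent_via L a \<psi> V x W X \<longleftrightarrow>
     lorentz_map L \<and> local_param x W \<psi> \<and> \<psi> ` W = V \<and> (\<forall>u\<in>W. x (\<psi> u) = L (X u) + a)"

end

theory Submission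
  imports Defs
begin

text \<open>Off the points where \<open>k\<close> is tangent to \<open>M\<close>, put \<open>\<epsilon> = - \<langle>N,N\<rangle>\<close>, \<open>f = \<langle>k,N\<rangle>\<close>, \<open>s = \<epsilon> \<langle>k,x\<rangle>\<close> and
  \<open>G = k / (2 f\<^sup>2) + \<epsilon> N / f\<close>, so that \<open>\<langle>k,G\<rangle> = \<epsilon>\<close>, \<open>\<langle>G,G\<rangle> = 0\<close> and \<open>k\<^sup>T = f\<^sup>2 (k / (2 f\<^sup>2) + G)\<close>. If
  \<open>S(k\<^sup>T) = k1 k\<^sup>T\<close>, then \<open>G\<close> is constant along \<open>k\<^sup>T\<close>, and by the symmetry of \<open>S\<close> the gradient of \<open>f\<close> is
  parallel to that of \<open>s\<close>. Coordinates \<open>(s, t)\<close> with \<open>t\<close> constant along \<open>k\<^sup>T\<close> exist without integrating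
  \<open>k\<^sup>T\<close>: if \<open>e\<close> spans the orthogonal complement of \<open>k\<close> and \<open>G\<close> at \<open>p\<close>, then
  \<open>t = \<langle>e, x - (s - s(p)) G\<rangle>\<close> will do. Integrating \<open>x\<^sub>s = k / (2 \<phi>(s)\<^sup>2) + G(t)\<close> gives the family,
  in which \<open>k / (2 \<phi>) - \<phi> G\<close> is normal and \<open>\<phi>'\<close> is, up to sign, the principal curvature. A point where
  \<open>k\<close> is tangent has an umbilic neighbourhood, on which \<open>k\<close> can be replaced by a transversal
  light-like vector.\<close>

section \<open>Smooth maps\<close>

text \<open>Where \<open>\<langle>k,N\<rangle>\<close> is non-zero, \<open>k\<close> and
  \<open>N\<close> span a plane of signature (1,1) with null directions \<open>k\<close> and
  \<open>G\<close>, and \<open>k\<^sup>T\<close> lies in it. Dividing \<open>k\<^sup>T\<close> by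
  \<open>f\<^sup>2\<close> makes both the derivative of \<open>s\<close> along it and its
  coefficient of \<open>G\<close> equal to 1; only the coefficient of \<open>k\<close> is left to
  vary with \<open>s\<close>, which is the shape of the family. Pairing the eigenvalue equation with
  \<open>k\<close> shows that \<open>f\<close> changes at the rate \<open>- \<epsilon> * k1\<close>
  along the rescaled field, so a non-vanishing \<open>k1\<close> becomes a non-vanishing derivative
  of \<open>\<phi>\<close>. The square root in the family causes two difficulties. The first
  coordinate of the null vector determines the second only up to sign, so the isometry is chosen to
  make it positive near the given point. And a square root need not be differentiable at zeros of
  its argument, so for a given surface of the family smoothness is drawn from the immersion and not
  from the formula. Chart domains need not be connected; signs are therefore treated as functions
  with zero derivative.\<close>

lemma Ck_on_continuous: "Ck_on n S f \<Longrightarrow> continuous_on S f"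
  by (cases n) (auto intro!: continuous_at_imp_continuous_on differentiable_imp_continuous_within)

lemma Ck_on_SucD: "Ck_on (Suc n) S f \<Longrightarrow> Ck_on n S f"
proof (induction n arbitrary: f)
  case 0
  then show ?case
    using Ck_on_continuous[of "Suc 0" S f] by simp
qed auto

lemma Ck_on_subset: "Ck_on n S f \<Longrightarrow> T \<subseteq> S \<Longrightarrow> Ck_on n T f"
  by (induction n arbitrary: f) (auto intro: continuous_on_subset)

lemma Ck_on_differentiable: "Ck_on (Suc n) S f \<Longrightarrow> p \<in> S \<Longrightarrow> f differentiable at p"
  by simp

lemma Ck_on_cong:
  assumes "open S" "\<And>p. p \<in> S \<Longrightarrow> f p = g p" "Ck_on n S f"
  shows "Ck_on n S g"
  using assms(2,3)
proof (induction n arbitrary: f g)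
  case 0
  then show ?case
    using continuous_on_cong by force
next
  case (Suc n)
  have d: "g differentiable at p" if "p \<in> S" for p
    using Suc.prems that assms(1) unfolding differentiable_def
    by (metis (no_types, lifting) Ck_on_differentiable differentiable_def has_derivative_transform_within_open)
  have e: "frechet_derivative f (at p) = frechet_derivative g (at p)" if "p \<in> S" for p
    using Suc.prems that assms(1) by (intro frechet_derivative_transform_within_open) auto
  show ?case
    unfolding Ck_on.simps
  proof (intro conjI ballI allI d)
    show "Ck_on n S (\<lambda>p. frechet_derivative g (at p) v)" for v
      by (rule Suc.IH[of "\<lambda>p. frechet_derivative f (at p) v"]) (use Suc.prems e in auto)
  qed
qed

lemma Ck_on_open_cover:
  assumes "\<And>p. p \<in> S \<Longrightarrow> \<exists>T. open T \<and> p \<in> T \<and> Ck_on n T f"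
  shows "Ck_on n S f"
  using assms
proof (induction n arbitrary: f)
  case 0
  then show ?case
    by (metis Ck_on.simps(1) continuous_at_imp_continuous_on continuous_on_eq_continuous_at)
next
  case (Suc n)
  then show ?case
    unfolding Ck_on.simps
    by (intro conjI ballI allI Suc.IH) (use Ck_on.simps(2)[of n _ f] in metis)+
qed

text \<open>Lets the inductions below use the explicit formulas of the product and chain rules;
  \<open>frechet_derivative\<close> agrees with them by uniqueness.\<close>

lemma Ck_on_has_derivative:
  assumes "open S"
    and "\<And>p. p \<in> S \<Longrightarrow> (f has_derivative f' p) (at p)"
    and "\<And>v. Ck_on n S (\<lambda>p. f' p v)"
  shows "Ck_on (Suc n) S f"
proof -
  have "frechet_derivative f (at p) = f' p" if "p \<in> S" for p
    using assms(2)[OF that] frechet_derivative_at by metis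
  with assms show ?thesis
    by (auto simp: differentiable_def intro!: Ck_on_cong[OF assms(1) _ assms(3)])
qed

lemma Ck_on_has_frechet_derivative:
  "Ck_on (Suc n) S f \<Longrightarrow> p \<in> S \<Longrightarrow> (f has_derivative frechet_derivative f (at p)) (at p)"
  using frechet_derivative_works by auto

lemma Ck_on_const: "Ck_on n S (\<lambda>p. c)"
  by (induction n arbitrary: c) (auto simp: frechet_derivative_const)

lemma Ck_on_linear:
  assumes "bounded_linear f"
  shows "Ck_on n S f"
proof (cases n)
  case 0
  then show ?thesis
    using assms by (simp add: linear_continuous_on)
next
  case (Suc m)
  have "(f has_derivative f) (at p)" for p
    using assms by (rule bounded_linear_imp_has_derivative)
  then have "f differentiable at p" "frechet_derivative f (at p) = f" for p
    by (auto simp: differentiable_def frechet_derivative_at[symmetric])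
  then show ?thesis
    by (simp add: Suc Ck_on_const)
qed

lemma Ck_on_add:
  assumes "open S" "Ck_on n S f" "Ck_on n S g"
  shows "Ck_on n S (\<lambda>p. f p + g p)"
  using assms(2,3)
proof (induction n arbitrary: f g)
  case (Suc n)
  show ?case
    using Suc.prems
    by (intro Ck_on_has_derivative[OF assms(1) has_derivative_add[OF Ck_on_has_frechet_derivative
            [OF Suc.prems(1)] Ck_on_has_frechet_derivative[OF Suc.prems(2)]]] Suc.IH) auto
qed (auto intro: continuous_intros)

lemma Ck_on_sum:
  assumes "open S" "\<And>i. i \<in> A \<Longrightarrow> Ck_on n S (f i)"
  shows "Ck_on n S (\<lambda>p. \<Sum>i\<in>A. f i p)"
  using assms(2)
  by (induction A rule: infinite_finite_induct) (auto intro: Ck_on_const Ck_on_add[OF assms(1)])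

lemma Ck_on_bilinear:
  assumes "open S" "bounded_bilinear B" "Ck_on n S f" "Ck_on n S g"
  shows "Ck_on n S (\<lambda>p. B (f p) (g p))"
  using assms(3,4)
proof (induction n arbitrary: f g)
  case 0
  then show ?case
    using bounded_bilinear.continuous_on[OF assms(2)] by simp
next
  case (Suc n)
  show ?case
    using Suc.prems
    by (intro Ck_on_has_derivative[OF assms(1) bounded_bilinear.FDERIV[OF assms(2)
            Ck_on_has_frechet_derivative[OF Suc.prems(1)] Ck_on_has_frechet_derivative[OF Suc.prems(2)]]]
        Ck_on_add[OF assms(1)] Suc.IH)
      (auto intro: Ck_on_SucD[OF Suc.prems(1)] Ck_on_SucD[OF Suc.prems(2)])
qed

lemma Ck_on_bounded_linear_compose:
  assumes "open S" "bounded_linear h" "Ck_on n S f"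
  shows "Ck_on n S (\<lambda>p. h (f p))"
  using assms(3)
proof (induction n arbitrary: f)
  case 0
  then show ?case
    using bounded_linear.continuous_on[OF assms(2)] by simp
next
  case (Suc n)
  show ?case
    using Suc.prems
    by (intro Ck_on_has_derivative[OF assms(1) bounded_linear.has_derivative[OF assms(2)
            Ck_on_has_frechet_derivative[OF Suc.prems]]] Suc.IH) auto
qed

text \<open>In the chain rule the direction fed to the derivative of \<open>f\<close> moves with
  \<open>p\<close>, whereas \<open>Ck_on\<close> controls derivatives in fixed directions only.
  Expanding the inner derivative in the standard basis leaves fixed directions with scalar
  coefficients; hence the Euclidean codomain of \<open>g\<close>.\<close>

lemma Ck_on_compose:
  fixes g :: "'a::real_normed_vector \<Rightarrow> 'b::euclidean_space"
  assumes "open S" "open T" "Ck_on n S g" "Ck_on n T f" "g ` S \<subseteq> T"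
  shows "Ck_on n S (\<lambda>p. f (g p))"
  using assms(3,4)
proof (induction n arbitrary: f)
  case 0
  then show ?case
    using assms(5) continuous_on_compose2 by auto
next
  case (Suc n)
  have d: "((\<lambda>p. f (g p)) has_derivative
      (\<lambda>v. \<Sum>i\<in>Basis. (frechet_derivative g (at p) v \<bullet> i) *\<^sub>R frechet_derivative f (at (g p)) i)) (at p)"
    if "p \<in> S" for p
  proof -
    have g: "(g has_derivative frechet_derivative g (at p)) (at p)"
      using Suc.prems that by (intro Ck_on_has_frechet_derivative)
    have f: "(f has_derivative frechet_derivative f (at (g p))) (at (g p))"
      using Suc.prems that assms(5) by (intro Ck_on_has_frechet_derivative) auto
    interpret f: bounded_linear "frechet_derivative f (at (g p))"
      using f by (rule has_derivative_bounded_linear)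
    have "frechet_derivative f (at (g p)) v
        = (\<Sum>i\<in>Basis. (v \<bullet> i) *\<^sub>R frechet_derivative f (at (g p)) i)" for v
      by (subst euclidean_representation[symmetric, of v]) (simp only: f.sum f.scaleR)
    then show ?thesis
      by (intro has_derivative_eq_rhs[OF has_derivative_compose[OF g f]] ext)
  qed
  have "Ck_on n S (\<lambda>p. (frechet_derivative g (at p) v \<bullet> i) *\<^sub>R frechet_derivative f (at (g p)) i)" for v i
  proof (rule Ck_on_bilinear[OF assms(1) bounded_bilinear_scaleR])
    show "Ck_on n S (\<lambda>p. frechet_derivative g (at p) v \<bullet> i)"
      using Suc.prems(1)
      by (intro Ck_on_bounded_linear_compose[OF assms(1) bounded_linear_inner_left]) simp
    show "Ck_on n S (\<lambda>p. frechet_derivative f (at (g p)) i)"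
      by (rule Suc.IH[OF Ck_on_SucD[OF Suc.prems(1)]]) (use Suc.prems(2) in simp)
  qed
  then show ?case
    by (intro Ck_on_has_derivative[OF assms(1) d] Ck_on_sum[OF assms(1)])
qed

text \<open>The derivative of \<open>inverse\<close> is again built from products of
  \<open>inverse\<close>, so the induction closes on itself.\<close>

lemma Ck_on_inverse: "Ck_on n (- {0}) (inverse :: real \<Rightarrow> real)"
proof (induction n)
  case 0
  then show ?case
    by (auto intro!: continuous_intros)
next
  case (Suc n)
  have "Ck_on n (- {0}) (\<lambda>p::real. - (inverse p * v * inverse p))" for v
    using Ck_on_bilinear[OF _ bounded_bilinear_mult
        Ck_on_bilinear[OF _ bounded_bilinear_mult Suc Ck_on_const] Suc]
    by (intro Ck_on_bounded_linear_compose[OF _ bounded_linear_minus[OF bounded_linear_ident]]) auto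
  then show ?case
    by (intro Ck_on_has_derivative[where f' = "\<lambda>p v. - (inverse p * v * inverse p)"]
        has_derivative_inverse') auto
qed

lemma smooth_on_subset: "smooth_on S f \<Longrightarrow> T \<subseteq> S \<Longrightarrow> smooth_on T f"
  by (auto simp: smooth_on_def intro: Ck_on_subset)

lemma smooth_on_continuous: "smooth_on S f \<Longrightarrow> continuous_on S f"
  by (auto simp: smooth_on_def intro: Ck_on_continuous)

lemma smooth_on_cong: "open S \<Longrightarrow> (\<And>p. p \<in> S \<Longrightarrow> f p = g p) \<Longrightarrow> smooth_on S f \<Longrightarrow> smooth_on S g"
  by (auto simp: smooth_on_def intro: Ck_on_cong)

lemma smooth_on_open_cover:
  "(\<And>p. p \<in> S \<Longrightarrow> \<exists>T. open T \<and> p \<in> T \<and> smooth_on T f) \<Longrightarrow> smooth_on S f"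
  unfolding smooth_on_def by (intro allI Ck_on_open_cover) metis

lemma smooth_on_has_derivative:
  "smooth_on S f \<Longrightarrow> p \<in> S \<Longrightarrow> (f has_derivative frechet_derivative f (at p)) (at p)"
  unfolding smooth_on_def using Ck_on_has_frechet_derivative[of 0 S f p] by simp

lemma smooth_on_frechet_derivative:
  "smooth_on S f \<Longrightarrow> smooth_on S (\<lambda>p. frechet_derivative f (at p) v)"
  unfolding smooth_on_def using Ck_on.simps(2)[of _ S f] by simp

lemma smooth_on_const: "smooth_on S (\<lambda>p. c)"
  by (simp add: smooth_on_def Ck_on_const)

lemma smooth_on_linear: "bounded_linear f \<Longrightarrow> smooth_on S f"
  by (simp add: smooth_on_def Ck_on_linear)

lemma smooth_on_add: "open S \<Longrightarrow> smooth_on S f \<Longrightarrow> smooth_on S g \<Longrightarrow> smooth_on S (\<lambda>p. f p + g p)"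
  by (simp add: smooth_on_def Ck_on_add)

lemma smooth_on_bilinear:
  "bounded_bilinear B \<Longrightarrow> open S \<Longrightarrow> smooth_on S f \<Longrightarrow> smooth_on S g \<Longrightarrow> smooth_on S (\<lambda>p. B (f p) (g p))"
  by (simp add: smooth_on_def Ck_on_bilinear)

lemmas smooth_on_scaleR = smooth_on_bilinear[OF bounded_bilinear_scaleR]
lemmas smooth_on_mult = smooth_on_bilinear[OF bounded_bilinear_mult]

lemma smooth_on_bounded_linear_compose:
  "bounded_linear h \<Longrightarrow> open S \<Longrightarrow> smooth_on S f \<Longrightarrow> smooth_on S (\<lambda>p. h (f p))"
  by (simp add: smooth_on_def Ck_on_bounded_linear_compose)

lemmas smooth_on_uminus = smooth_on_bounded_linear_compose[OF bounded_linear_minus[OF bounded_linear_ident]]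

lemma smooth_on_diff:
  "open S \<Longrightarrow> smooth_on S f \<Longrightarrow> smooth_on S g \<Longrightarrow> smooth_on S (\<lambda>p. f p - g p)"
  using smooth_on_add[of S f "\<lambda>p. - g p"] by (simp add: smooth_on_uminus)

lemma smooth_on_Pair:
  assumes "open S" "smooth_on S f" "smooth_on S g"
  shows "smooth_on S (\<lambda>p. (f p, g p))"
proof -
  have "smooth_on S (\<lambda>p. (f p, 0) + (0, g p))"
    using assms
    by (intro smooth_on_add smooth_on_bounded_linear_compose[of "\<lambda>a. (a, 0)"]
        smooth_on_bounded_linear_compose[of "\<lambda>a. (0, a)"] bounded_linear_Pair
        bounded_linear_ident bounded_linear_zero)
  then show ?thesis
    by simp
qed

lemma smooth_on_compose:
  fixes g :: "'a::real_normed_vector \<Rightarrow> 'b::euclidean_space"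
  shows "open S \<Longrightarrow> open T \<Longrightarrow> smooth_on S g \<Longrightarrow> smooth_on T f \<Longrightarrow> g ` S \<subseteq> T
    \<Longrightarrow> smooth_on S (\<lambda>p. f (g p))"
  unfolding smooth_on_def by (intro allI Ck_on_compose[where f = f and g = g and T = T]) simp_all

lemma smooth_on_inverse:
  fixes f :: "'a::real_normed_vector \<Rightarrow> real"
  assumes "open S" "smooth_on S f" "\<And>p. p \<in> S \<Longrightarrow> f p \<noteq> 0"
  shows "smooth_on S (\<lambda>p. inverse (f p))"
  using assms
  by (intro smooth_on_compose[where T = "- {0}" and f = inverse and g = f])
    (auto simp: smooth_on_def Ck_on_inverse)

lemma smooth_on_divide:
  fixes f g :: "'a::real_normed_vector \<Rightarrow> real"
  assumes "open S" "smooth_on S f" "smooth_on S g" "\<And>p. p \<in> S \<Longrightarrow> g p \<noteq> 0"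
  shows "smooth_on S (\<lambda>p. f p / g p)"
  using smooth_on_mult[OF assms(1,2) smooth_on_inverse[OF assms(1,3,4)]]
  by (simp add: divide_inverse)

lemmas smooth_on_fst = smooth_on_bounded_linear_compose[OF bounded_linear_fst]
lemmas smooth_on_snd = smooth_on_bounded_linear_compose[OF bounded_linear_snd]

text \<open>Both mixed derivatives are the limit of the same second difference quotient.\<close>

lemma second_difference_quotient:
  fixes f :: "'a::real_normed_vector \<Rightarrow> real"
  assumes "open S" "u \<in> S" "Ck_on 2 S f"
  shows "((\<lambda>h. (f (u + h *\<^sub>R v + h *\<^sub>R w) - f (u + h *\<^sub>R v) - f (u + h *\<^sub>R w) + f u) / h\<^sup>2)
     \<longlongrightarrow> frechet_derivative (\<lambda>p. frechet_derivative f (at p) v) (at u) w) (at_right 0)"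
proof -
  define g where "g = (\<lambda>p. frechet_derivative f (at p) v)"
  define k where "k = (\<lambda>p. frechet_derivative g (at p) w)"
  have f: "(f has_derivative frechet_derivative f (at p)) (at p)" if "p \<in> S" for p
    using Ck_on_has_frechet_derivative[of 1 S f] assms(3) that by (simp add: numeral_2_eq_2)
  have g: "(g has_derivative frechet_derivative g (at p)) (at p)" if "p \<in> S" for p
    unfolding g_def using assms(3) that 
    by (intro Ck_on_has_frechet_derivative[of 0 S]) (simp_all add: numeral_2_eq_2)
  have k: "continuous_on S k"
    unfolding k_def g_def using assms(3) by (simp add: numeral_2_eq_2)
  show ?thesis
    unfolding tendsto_iff
  proof (intro allI impI)
    fix e :: real assume "e > 0"
    obtain d where d: "d > 0" "ball u d \<subseteq> S" "\<And>p. p \<in> ball u d \<Longrightarrow> dist (k p) (k u) < e"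
    proof -
      obtain d1 where d1: "d1 > 0" "ball u d1 \<subseteq> S"
        using assms by (meson open_contains_ball)
      obtain d2 where d2: "d2 > 0" "\<And>p. p \<in> S \<Longrightarrow> dist p u < d2 \<Longrightarrow> dist (k p) (k u) < e"
        using k \<open>e > 0\<close> \<open>u \<in> S\<close> unfolding continuous_on_iff by metis
      show ?thesis
        by (rule that[of "min d1 d2"]) (use d1 d2 in \<open>auto simp: dist_commute subset_iff\<close>)
    qed
    \<comment> \<open>For step lengths below this bound the displacement stays shorter than
      \<open>d\<close>; the summand 1 keeps the denominator positive when \<open>v\<close> and
      \<open>w\<close> both vanish.\<close>
    define c where "c = d / (norm v + norm w + 1)"
    have c: "c > 0"
      unfolding c_def using d(1) by (intro divide_pos_pos) (auto intro: add_nonneg_pos)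
    have in_ball: "u + a *\<^sub>R v + b *\<^sub>R w \<in> ball u d"
      if "0 \<le> a" "a < c" "0 \<le> b" "b < c" for a b
    proof -
      have "norm (a *\<^sub>R v + b *\<^sub>R w) \<le> a * norm v + b * norm w"
        using that norm_triangle_ineq[of "a *\<^sub>R v" "b *\<^sub>R w"] by simp
      also have "\<dots> \<le> c * norm v + c * norm w"
        using that by (intro add_mono mult_right_mono) auto
      also have "\<dots> < c * (norm v + norm w + 1)"
        using c by (simp add: algebra_simps)
      also have "\<dots> = d"
        unfolding c_def using norm_ge_zero[of v] norm_ge_zero[of w] 
        by (simp add: add_nonneg_eq_0_iff)
      finally have "norm (a *\<^sub>R v + b *\<^sub>R w) < d" .
      moreover have "dist u (u + a *\<^sub>R v + b *\<^sub>R w) = norm (a *\<^sub>R v + b *\<^sub>R w)"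
        by (metis add.assoc dist_0_norm dist_add_cancel add.right_neutral)
      ultimately show ?thesis
        by simp
    qed
    have "dist ((f (u + h *\<^sub>R v + h *\<^sub>R w) - f (u + h *\<^sub>R v) - f (u + h *\<^sub>R w) + f u) / h\<^sup>2) (k u) < e"
      if h: "0 < h" "h < c" for h
    proof -
      \<comment> \<open>Mean value theorem in direction \<open>v\<close>, for the difference of
        \<open>f\<close> across \<open>h *\<^sub>R w\<close>; a second one, in direction
        \<open>w\<close>, turns the resulting difference of \<open>g\<close> into a value of
        \<open>k\<close>. The terms with factor 0 let one rule \<open>D\<close> serve both
        ends.\<close>
      have "\<exists>\<xi>. 0 < \<xi> \<and> \<xi> < h \<and>
         (f (u + h *\<^sub>R v + h *\<^sub>R w) - f (u + h *\<^sub>R v + 0 *\<^sub>R w)) - (f (u + 0 *\<^sub>R v + h *\<^sub>R w) - f (u + 0 *\<^sub>R v + 0 *\<^sub>R w))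
         = (h - 0) * (g (u + \<xi> *\<^sub>R v + h *\<^sub>R w) - g (u + \<xi> *\<^sub>R v + 0 *\<^sub>R w))"
      proof (rule MVT2[OF h(1)])
        fix \<xi> assume \<xi>: "0 \<le> \<xi>" "\<xi> \<le> h"
        have D: "((\<lambda>\<xi>. f (u + \<xi> *\<^sub>R v + b *\<^sub>R w)) has_real_derivative g (u + \<xi> *\<^sub>R v + b *\<^sub>R w)) (at \<xi>)"
          if "0 \<le> b" "b \<le> h" for b
        proof -
          have "u + \<xi> *\<^sub>R v + b *\<^sub>R w \<in> S"
            using d(2) in_ball[of \<xi> b] \<xi> h that by auto
          from f[OF this] have F: "(f has_derivative frechet_derivative f (at (u + \<xi> *\<^sub>R v + b *\<^sub>R w))) (at (u + \<xi> *\<^sub>R v + b *\<^sub>R w))" .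
          have "((\<lambda>\<xi>. u + \<xi> *\<^sub>R v + b *\<^sub>R w) has_derivative (\<lambda>r. r *\<^sub>R v)) (at \<xi>)"
            by (auto intro!: derivative_eq_intros)
          from has_derivative_compose[OF this F] show ?thesis
            using linear_cmul[OF has_derivative_linear[OF F]]
            by (simp add: has_field_derivative_def g_def mult_commute_abs)
        qed
        show "((\<lambda>\<xi>. f (u + \<xi> *\<^sub>R v + h *\<^sub>R w) - f (u + \<xi> *\<^sub>R v + 0 *\<^sub>R w)) has_real_derivative
            g (u + \<xi> *\<^sub>R v + h *\<^sub>R w) - g (u + \<xi> *\<^sub>R v + 0 *\<^sub>R w)) (at \<xi>)"
          using h by (intro DERIV_diff D) auto
      qed
      then obtain \<xi> where \<xi>: "0 < \<xi>" "\<xi> < h" and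
        1: "f (u + h *\<^sub>R v + h *\<^sub>R w) - f (u + h *\<^sub>R v) - f (u + h *\<^sub>R w) + f u
          = h * (g (u + \<xi> *\<^sub>R v + h *\<^sub>R w) - g (u + \<xi> *\<^sub>R v + 0 *\<^sub>R w))"
        by auto
      have "\<exists>\<eta>. 0 < \<eta> \<and> \<eta> < h \<and> g (u + \<xi> *\<^sub>R v + h *\<^sub>R w) - g (u + \<xi> *\<^sub>R v + 0 *\<^sub>R w)
          = (h - 0) * k (u + \<xi> *\<^sub>R v + \<eta> *\<^sub>R w)"
      proof (rule MVT2[OF h(1)])
        fix \<eta> assume \<eta>: "0 \<le> \<eta>" "\<eta> \<le> h"
        have "u + \<xi> *\<^sub>R v + \<eta> *\<^sub>R w \<in> S"
          using d(2) in_ball[of \<xi> \<eta>] \<xi> h \<eta> by auto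
        from g[OF this] have G: "(g has_derivative frechet_derivative g (at (u + \<xi> *\<^sub>R v + \<eta> *\<^sub>R w))) (at (u + \<xi> *\<^sub>R v + \<eta> *\<^sub>R w))" .
        have "((\<lambda>\<eta>. u + \<xi> *\<^sub>R v + \<eta> *\<^sub>R w) has_derivative (\<lambda>r. r *\<^sub>R w)) (at \<eta>)"
          by (auto intro!: derivative_eq_intros)
        from has_derivative_compose[OF this G]
        show "((\<lambda>\<eta>. g (u + \<xi> *\<^sub>R v + \<eta> *\<^sub>R w)) has_real_derivative k (u + \<xi> *\<^sub>R v + \<eta> *\<^sub>R w)) (at \<eta>)"
          using linear_cmul[OF has_derivative_linear[OF G]]
          by (simp add: has_field_derivative_def k_def mult_commute_abs)
      qed
      then obtain \<eta> where \<eta>: "0 < \<eta>" "\<eta> < h" and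
        2: "g (u + \<xi> *\<^sub>R v + h *\<^sub>R w) - g (u + \<xi> *\<^sub>R v + 0 *\<^sub>R w) = h * k (u + \<xi> *\<^sub>R v + \<eta> *\<^sub>R w)"
        by auto
      have "(f (u + h *\<^sub>R v + h *\<^sub>R w) - f (u + h *\<^sub>R v) - f (u + h *\<^sub>R w) + f u) / h\<^sup>2
          = k (u + \<xi> *\<^sub>R v + \<eta> *\<^sub>R w)"
        unfolding 1 2 using h by (simp add: power2_eq_square)
      then show ?thesis
        using d(3)[OF in_ball[of \<xi> \<eta>]] \<xi> \<eta> h by auto
    qed
    then show "\<forall>\<^sub>F h in at_right 0. dist ((f (u + h *\<^sub>R v + h *\<^sub>R w) - f (u + h *\<^sub>R v) - f (u + h *\<^sub>R w) + f u) / h\<^sup>2)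
        (frechet_derivative (\<lambda>p. frechet_derivative f (at p) v) (at u) w) < e"
      unfolding eventually_at_right_field using c by (auto simp: k_def g_def)
  qed
qed

text \<open>The mean value theorem concerns real functions, so the vector-valued statement is
  obtained coordinate by coordinate. The difference quotient is symmetric in \<open>v\<close> and
  \<open>w\<close>, and limits are unique.\<close>

lemma symmetric_second_derivative:
  fixes f :: "'a::real_normed_vector \<Rightarrow> 'b::euclidean_space"
  assumes "open S" "u \<in> S" "smooth_on S f"
  shows "frechet_derivative (\<lambda>p. frechet_derivative f (at p) v) (at u) w
       = frechet_derivative (\<lambda>p. frechet_derivative f (at p) w) (at u) v"
proof (rule euclidean_eqI)
  fix i :: 'b
  define g where "g = (\<lambda>p. f p \<bullet> i)"
  have g: "smooth_on S g"
    unfolding g_def using assms by (intro smooth_on_bounded_linear_compose[OF bounded_linear_inner_left])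
  have g1: "frechet_derivative g (at p) a = frechet_derivative f (at p) a \<bullet> i" if "p \<in> S" for p a
  proof -
    have "(g has_derivative (\<lambda>a. frechet_derivative f (at p) a \<bullet> i)) (at p)"
      unfolding g_def
      by (intro has_derivative_inner_left smooth_on_has_derivative[OF assms(3) that])
    then show ?thesis
      by (simp add: frechet_derivative_at[symmetric])
  qed
  have g2: "frechet_derivative (\<lambda>p. frechet_derivative g (at p) a) (at u) b
      = frechet_derivative (\<lambda>p. frechet_derivative f (at p) a) (at u) b \<bullet> i" for a b
  proof -
    have "((\<lambda>p. frechet_derivative f (at p) a \<bullet> i) has_derivative
       (\<lambda>b. frechet_derivative (\<lambda>p. frechet_derivative f (at p) a) (at u) b \<bullet> i)) (at u)"
      by (intro has_derivative_inner_left smooth_on_has_derivative[OF _ assms(2)]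
          smooth_on_frechet_derivative assms)
    from has_derivative_transform_within_open[OF this assms(1,2)] g1
    have "((\<lambda>p. frechet_derivative g (at p) a) has_derivative
       (\<lambda>b. frechet_derivative (\<lambda>p. frechet_derivative f (at p) a) (at u) b \<bullet> i)) (at u)"
      by simp
    then show ?thesis
      by (simp add: frechet_derivative_at[symmetric])
  qed
  have "Ck_on 2 S g"
    using g by (simp add: smooth_on_def)
  from second_difference_quotient[OF assms(1,2) this, of v w]
    second_difference_quotient[OF assms(1,2) this, of w v]
  have "frechet_derivative (\<lambda>p. frechet_derivative g (at p) v) (at u) w
      = frechet_derivative (\<lambda>p. frechet_derivative g (at p) w) (at u) v"
    by (intro tendsto_unique[OF trivial_limit_at_right_real]) (simp_all add: algebra_simps)
  then show "frechet_derivative (\<lambda>p. frechet_derivative f (at p) v) (at u) w \<bullet> i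
       = frechet_derivative (\<lambda>p. frechet_derivative f (at p) w) (at u) v \<bullet> i"
    by (simp add: g2)
qed

section \<open>Smooth local inverses in the plane\<close>

lemma inv_linear_plane:
  fixes A :: "real \<times> real \<Rightarrow> real \<times> real"
  assumes "linear A" "inj A"
  defines "d \<equiv> fst (A (1, 0)) * snd (A (0, 1)) - snd (A (1, 0)) * fst (A (0, 1))"
  shows "d \<noteq> 0"
    and "inv A v = ((fst v * snd (A (0, 1)) - snd v * fst (A (0, 1))) / d,
                    (fst (A (1, 0)) * snd v - snd (A (1, 0)) * fst v) / d)"
proof -
  obtain p1 p2 q1 q2 where pq: "A (1, 0) = (p1, p2)" "A (0, 1) = (q1, q2)"
    by (meson surj_pair)
  have A: "A (a, b) = (a * p1 + b * q1, a * p2 + b * q2)" for a b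
    using linear_add[OF assms(1), of "(a, 0)" "(0, b)"] linear_cmul[OF assms(1), of a "(1, 0)"]
      linear_cmul[OF assms(1), of b "(0, 1)"] by (simp add: pq)
  have A0: "A w = 0 \<Longrightarrow> w = 0" for w
    using assms(1,2) linear_injective_0 by blast
  have d_eq: "d = p1 * q2 - p2 * q1"
    by (simp add: d_def pq)
  show d: "d \<noteq> 0"
  proof
    assume "d = 0"
    \<comment> \<open>Up to sign these are the columns of the adjugate matrix: \<open>A\<close>
      sends them to \<open>(d, 0)\<close> and \<open>(0, - d)\<close>. Injectivity then makes every
      entry of \<open>A\<close> vanish.\<close>
    then have "A (q2, - p2) = 0" "A (q1, - p1) = 0"
      by (auto simp: A d_eq zero_prod_def algebra_simps)
    then have "(q2, - p2) = 0" "(q1, - p1) = 0"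
      by (blast dest: A0)+
    then have "A (1, 0) = 0"
      by (simp add: zero_prod_def pq)
    then show False
      using A0[of "(1, 0)"] by (simp add: zero_prod_def)
  qed
  have "A ((fst v * q2 - snd v * q1) / d, (p1 * snd v - p2 * fst v) / d) = v"
    using d unfolding A by (simp add: prod_eq_iff divide_simps, simp add: d_eq algebra_simps)
  then show "inv A v = ((fst v * snd (A (0, 1)) - snd v * fst (A (0, 1))) / d,
                    (fst (A (1, 0)) * snd v - snd (A (1, 0)) * fst v) / d)"
    by (simp add: pq assms(2) inv_f_eq)
qed

text \<open>The inverse function theorem gives \<open>g\<close> with derivative the inverse of that
  of \<open>f\<close> at \<open>g y\<close>. Regularity then bootstraps: if \<open>g\<close> has n
  continuous derivatives, so has this expression, and \<open>g\<close> gains one order.\<close>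

lemma smooth_local_inverse:
  fixes f :: "real \<times> real \<Rightarrow> real \<times> real"
  assumes "open U" "u0 \<in> U" "smooth_on U f" "inj (frechet_derivative f (at u0))"
  obtains U' V g where "open U'" "U' \<subseteq> U" "u0 \<in> U'" "open V" "homeomorphism U' V f g"
    "smooth_on V g"
proof -
  let ?f' = "\<lambda>p. frechet_derivative f (at p)"
  have d: "(f has_derivative ?f' p) (at p)" if "p \<in> U" for p
    by (rule smooth_on_has_derivative[OF assms(3) that])
  have bl: "bounded_linear (?f' p)" if "p \<in> U" for p
    using d[OF that] by (rule has_derivative_bounded_linear)
  obtain h where h: "linear h" "h \<circ> ?f' u0 = id"
    using linear_injective_left_inverse[OF bounded_linear.linear[OF bl[OF assms(2)]] assms(4)] by blast
  have hb: "bounded_linear h"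
    using h(1) by (simp add: linear_conv_bounded_linear)
  \<comment> \<open>Continuity in the operator norm, as the inverse function theorem requires; in
    finite dimension it can be checked on single vectors.\<close>
  have "continuous_on U (\<lambda>p. Blinfun (?f' p))"
  proof (intro continuous_on_blinfun_componentwise)
    show "continuous_on U (\<lambda>p. blinfun_apply (Blinfun (?f' p)) i)" for i
      using smooth_on_continuous[OF smooth_on_frechet_derivative[OF assms(3), of i]]
      by (rule continuous_on_eq) (simp add: bounded_linear_Blinfun_apply bl)
  qed
  moreover have "Blinfun h o\<^sub>L Blinfun (?f' u0) = id_blinfun"
    using h(2) by (intro blinfun_eqI)
      (simp add: bounded_linear_Blinfun_apply bl assms(2) hb pointfree_idE)
  moreover have "(f has_derivative blinfun_apply (Blinfun (?f' p))) (at p)" if "p \<in> U" for p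
    using d[OF that] by (simp add: bounded_linear_Blinfun_apply bl that)
  ultimately obtain U' V g g' where *: "open U'" "U' \<subseteq> U" "u0 \<in> U'" "open V"
    "homeomorphism U' V f g" "\<And>y. y \<in> V \<Longrightarrow> (g has_derivative (g' y)) (at y)"
    "\<And>y. y \<in> V \<Longrightarrow> g' y = inv (blinfun_apply (Blinfun (?f' (g y))))"
    "\<And>y. y \<in> V \<Longrightarrow> bij (blinfun_apply (Blinfun (?f' (g y))))"
    using inverse_function_theorem[OF assms(1), of f "\<lambda>p. Blinfun (?f' p)" u0 "Blinfun h"] assms(2)
    by metis
  have gV: "g ` V = U'"
    using *(5) by (simp add: homeomorphism_def)
  have "g y \<in> U" if "y \<in> V" for y
    using that gV *(2) by blast
  then have ap: "blinfun_apply (Blinfun (?f' (g y))) = ?f' (g y)" if "y \<in> V" for y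
    using that by (simp add: bounded_linear_Blinfun_apply bl)
  have inj: "inj (?f' p)" if "p \<in> U'" for p
    using that gV *(8) ap by (metis imageE bij_is_inj)
  have g': "g' y = inv (?f' (g y))" if "y \<in> V" for y
    using *(7)[OF that] ap[OF that] by simp
  have lin: "linear (?f' p)" if "p \<in> U'" for p
    using bl *(2) that bounded_linear.linear by blast
  have f': "smooth_on U' (\<lambda>p. ?f' p v)" for v
    using smooth_on_frechet_derivative assms(3) *(2) smooth_on_subset by blast
  \<comment> \<open>Cramer's rule makes the inverse a rational expression in the entries of the
    derivative, with the non-vanishing determinant as denominator.\<close>
  have inv: "smooth_on U' (\<lambda>p. inv (?f' p) v)" for v
  proof (rule smooth_on_cong[OF *(1)])
    let ?d = "\<lambda>p. fst (?f' p (1, 0)) * snd (?f' p (0, 1)) - snd (?f' p (1, 0)) * fst (?f' p (0, 1))"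
    show "((fst v * snd (?f' p (0, 1)) - snd v * fst (?f' p (0, 1))) / ?d p,
            (fst (?f' p (1, 0)) * snd v - snd (?f' p (1, 0)) * fst v) / ?d p) = inv (?f' p) v"
      if "p \<in> U'" for p
      using inv_linear_plane(2)[OF lin inj, OF that that, of v] by simp
    have nz: "?d p \<noteq> 0" if "p \<in> U'" for p
      using inv_linear_plane(1)[OF lin inj, OF that that] .
    have f: "smooth_on U' (\<lambda>p. fst (?f' p w))" "smooth_on U' (\<lambda>p. snd (?f' p w))" for w
      by (intro smooth_on_fst smooth_on_snd f' *(1))+
    show "smooth_on U' (\<lambda>p. ((fst v * snd (?f' p (0, 1)) - snd v * fst (?f' p (0, 1))) / ?d p,
            (fst (?f' p (1, 0)) * snd v - snd (?f' p (1, 0)) * fst v) / ?d p))"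
      by (intro smooth_on_Pair smooth_on_divide smooth_on_diff smooth_on_mult smooth_on_const f nz *(1))
  qed
  have "Ck_on n V g" for n
  proof (induction n)
    case 0
    then show ?case
      using *(5) by (simp add: homeomorphism_def)
  next
    case (Suc n)
    show ?case
    proof (rule Ck_on_has_derivative[OF *(4)])
      show "(g has_derivative inv (?f' (g y))) (at y)" if "y \<in> V" for y
        using *(6)[OF that] g'[OF that] by simp
      show "Ck_on n V (\<lambda>y. inv (?f' (g y)) v)" for v
        using Ck_on_compose[OF *(4,1) Suc, of "\<lambda>p. inv (?f' p) v"] inv[of v] gV
        by (simp add: smooth_on_def)
    qed
  qed
  then show thesis
    using that * by (simp add: smooth_on_def)
qed

lemma has_derivative_constant_on_open:
  assumes "(f has_derivative f') (at u)" "open S" "u \<in> S" "\<And>p. p \<in> S \<Longrightarrow> f p = c"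
  shows "f' a = 0"
proof -
  have "((\<lambda>p. c) has_derivative f') (at u)"
    using has_derivative_transform_within_open[OF assms(1-3)] assms(4) by metis
  then show ?thesis
    using has_derivative_unique[OF has_derivative_const] by metis
qed

text \<open>The square of \<open>q\<close> is the constant 1, so \<open>2 * q u * q' a = 0\<close>
  with \<open>q u\<close> non-zero. This expresses that a differentiable sign is locally constant,
  without any connectedness.\<close>

lemma has_derivative_of_sign:
  fixes q :: "'a::real_normed_vector \<Rightarrow> real"
  assumes "(q has_derivative q') (at u)" "open S" "u \<in> S" "\<And>p. p \<in> S \<Longrightarrow> \<bar>q p\<bar> = 1"
  shows "q' a = 0"
proof -
  have "((\<lambda>p. q p * q p) has_derivative (\<lambda>a. q u * q' a + q' a * q u)) (at u)"
    by (intro has_derivative_mult assms)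
  moreover have "q p * q p = 1" if "p \<in> S" for p
    using assms(4)[OF that] by (metis abs_mult_self_eq mult_1)
  ultimately have "q u * q' a + q' a * q u = 0"
    using has_derivative_constant_on_open assms(2,3) by (metis (mono_tags, lifting))
  then show ?thesis
    using assms(4)[OF assms(3)] by auto
qed

section \<open>Minkowski algebra\<close>

interpretation mink: bounded_bilinear mink
  unfolding bilinear_conv_bounded_bilinear[symmetric] bilinear_def
  by (auto intro!: linearI simp: mink_def algebra_simps)

lemma mink_commute: "\<langle>u,v\<rangle> = \<langle>v,u\<rangle>"
  by (simp add: mink_def mult.commute)

lemma mink_nondegenerate:
  assumes "\<And>v. \<langle>u,v\<rangle> = 0"
  shows "u = 0"
  using assms[of "vector [1, 0, 0]"] assms[of "vector [0, 1, 0]"] assms[of "vector [0, 0, 1]"]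
  by (simp add: mink_def vec_eq_iff forall_3)

lemma lorentz_map_inj:
  assumes "lorentz_map L"
  shows "inj L"
proof -
  have "v = 0" if "L v = 0" for v
    using assms that mink_nondegenerate[of v] unfolding lorentz_map_def by (metis mink.zero_left)
  then show ?thesis
    using assms by (auto simp: linear_injective_0 lorentz_map_def)
qed

text \<open>A non-null \<open>n\<close> is not orthogonal to itself and so lies outside the plane
  \<open>range D\<close>. Hence \<open>F\<close> is an injective linear map between
  three-dimensional spaces.\<close>

lemma plane_complement:
  fixes D :: "real \<times> real \<Rightarrow> real^3"
  assumes "linear D" "inj D" "\<And>a. \<langle>n, D a\<rangle> = 0" "\<langle>n,n\<rangle> \<noteq> 0"
  obtains a c where "v = D a + c *\<^sub>R n"
proof -
  define F where "F = (\<lambda>w. D (fst w) + snd w *\<^sub>R n)"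
  have lin: "linear F"
    unfolding F_def
    by (intro linearI) (simp_all add: linear_add[OF assms(1)] linear_cmul[OF assms(1)] algebra_simps)
  have "w = 0" if "F w = 0" for w
  proof -
    obtain a c where w: "w = (a, c)"
      by fastforce
    have "\<langle>n, F w\<rangle> = c * \<langle>n,n\<rangle>"
      using assms(3) by (simp add: F_def w mink.add_right mink.scaleR_right)
    then have "c = 0"
      using that assms(4) by (simp add: mink.zero_right)
    then have "D a = 0"
      using that by (simp add: F_def w)
    then show ?thesis
      using assms(1,2) \<open>c = 0\<close> linear_injective_0 w by (metis zero_prod_def)
  qed
  then have "inj F"
    using lin by (simp add: linear_injective_0)
  then have "dim (range F) = DIM((real \<times> real) \<times> real)"
    using dim_image_eq[OF lin, of UNIV] by (simp add: inj_on_subset)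
  then have "span (range F) = UNIV"
    by (simp flip: dim_eq_full)
  moreover have "span (range F) = range F"
    using lin by (simp add: linear_subspace_image)
  ultimately obtain w where "v = F w"
    by blast
  then show thesis
    using that by (cases w) (simp add: F_def)
qed

lemma orthogonal_normal_imp_tangent:
  fixes D :: "real \<times> real \<Rightarrow> real^3"
  assumes "linear D" "inj D" "\<And>a. \<langle>n, D a\<rangle> = 0" "\<langle>n,n\<rangle> \<noteq> 0" "\<langle>n,v\<rangle> = 0"
  obtains a where "v = D a"
proof -
  obtain a c where v: "v = D a + c *\<^sub>R n"
    using plane_complement[OF assms(1-4)] .
  then have "c * \<langle>n,n\<rangle> = 0"
    using assms(3,5) by (simp add: mink.add_right mink.scaleR_right)
  then show thesis
    using that v assms(4) by simp
qed

lemma orthogonal_basis_imp_0: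
  fixes D :: "real \<times> real \<Rightarrow> real^3"
  assumes "linear D" "inj D" "\<And>a. \<langle>n, D a\<rangle> = 0" "\<langle>n,n\<rangle> \<noteq> 0" "\<langle>n,v\<rangle> = 0" "\<And>a. \<langle>v, D a\<rangle> = 0"
  shows "v = 0"
proof (rule mink_nondegenerate)
  fix w
  obtain a c where "w = D a + c *\<^sub>R n"
    using plane_complement[OF assms(1-4)] .
  then show "\<langle>v,w\<rangle> = 0"
    using assms(5,6) by (simp add: mink.add_right mink.scaleR_right mink_commute)
qed

section \<open>Local parametrizations\<close>

lemma local_paramD:
  assumes "local_param x W \<psi>"
  shows "open W" "open (\<psi> ` W)" "smooth_on W (x \<circ> \<psi>)" "continuous_on W \<psi>" "inj_on \<psi> W"
    "\<And>u. u \<in> W \<Longrightarrow> inj (frechet_derivative (x \<circ> \<psi>) (at u))"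
  using assms unfolding local_param_def homeomorphism_def by (auto intro: inj_on_inverseI)

lemma local_param_subset:
  assumes "local_param x W \<psi>" "open W'" "W' \<subseteq> W"
  shows "local_param x W' \<psi>"
proof -
  obtain \<psi>' where h: "homeomorphism W (\<psi> ` W) \<psi> \<psi>'"
    using assms(1) by (auto simp: local_param_def)
  have "openin (top_of_set (\<psi> ` W)) (\<psi> ` W')"
    using homeomorphism_imp_open_map[OF h, of W'] assms(2,3) by (auto intro: open_openin_trans simp: open_subset)
  then have "open (\<psi> ` W')"
    using openin_open_trans local_paramD(2)[OF assms(1)] by blast
  moreover have "homeomorphism W' (\<psi> ` W') \<psi> \<psi>'"
    using h assms(3) by (rule homeomorphism_of_subsets) auto
  ultimately show ?thesis
    using assms unfolding local_param_def by (meson smooth_on_subset subsetD)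
qed

text \<open>The surface carries only a topology, so smoothness of \<open>\<tau>\<close> has to be
  extracted from \<open>x\<close>. A left inverse \<open>P\<close> of the derivative of
  \<open>x \<circ> \<psi>2\<close> at \<open>u2\<close> makes
  \<open>P \<circ> x \<circ> \<psi>2\<close> locally invertible with smooth inverse
  \<open>g\<close>; then \<open>g \<circ> P \<circ> x \<circ> \<psi>1\<close> is smooth and recovers
  the second coordinates.\<close>

lemma local_param_transition:
  fixes \<psi>1 \<psi>2 :: "real \<times> real \<Rightarrow> 'a::topological_space"
  assumes "local_param x W1 \<psi>1" "local_param x W2 \<psi>2" "u1 \<in> W1" "u2 \<in> W2" "\<psi>1 u1 = \<psi>2 u2"
  obtains U \<tau> where "open U" "u1 \<in> U" "U \<subseteq> W1" "\<tau> ` U \<subseteq> W2" "smooth_on U \<tau>" "\<tau> u1 = u2"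
    "\<And>u. u \<in> U \<Longrightarrow> \<psi>1 u = \<psi>2 (\<tau> u)"
proof -
  note c1 = local_paramD[OF assms(1)] and c2 = local_paramD[OF assms(2)]
  let ?D = "frechet_derivative (x \<circ> \<psi>2) (at u2)"
  have D: "((x \<circ> \<psi>2) has_derivative ?D) (at u2)"
    by (rule smooth_on_has_derivative[OF c2(3) assms(4)])
  obtain P where P: "linear P" "P \<circ> ?D = id"
    using linear_injective_left_inverse[OF has_derivative_linear[OF D] c2(6)[OF assms(4)]] by blast
  have Pb: "bounded_linear P"
    using P(1) by (simp add: linear_conv_bounded_linear)
  define f where "f = (\<lambda>u. P ((x \<circ> \<psi>2) u))"
  have "(f has_derivative (\<lambda>v. P (?D v))) (at u2)"
    unfolding f_def by (intro bounded_linear.has_derivative[OF Pb] D)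
  then have "frechet_derivative f (at u2) = (\<lambda>v. v)"
    using P(2) by (simp add: frechet_derivative_at[symmetric] fun_eq_iff)
  then have "inj (frechet_derivative f (at u2))"
    by (simp add: inj_def)
  moreover have "smooth_on W2 f"
    unfolding f_def by (intro smooth_on_bounded_linear_compose[OF Pb] c2)
  ultimately obtain U' V g where g: "open U'" "U' \<subseteq> W2" "u2 \<in> U'" "open V"
    "homeomorphism U' V f g" "smooth_on V g"
    using smooth_local_inverse c2(1) assms(4) by metis
  define \<tau> where "\<tau> = (\<lambda>u. g (P ((x \<circ> \<psi>1) u)))"
  \<comment> \<open>The condition is imposed on the surface: as \<open>x\<close> need not be
    injective, \<open>P (x (\<psi>1 u)) \<in> V\<close> alone would not give
    \<open>\<psi>1 u = \<psi>2 (\<tau> u)\<close>.\<close>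
  define U where "U = W1 \<inter> \<psi>1 -` (\<psi>2 ` U')"
  have fg: "g (f w) = w" "f w \<in> V" if "w \<in> U'" for w
    using g(5) that by (auto simp: homeomorphism_def)
  have \<tau>: "\<tau> u = w" "P ((x \<circ> \<psi>1) u) \<in> V" if "\<psi>1 u = \<psi>2 w" "w \<in> U'" for u w
    using fg[OF that(2)] that(1) by (simp_all add: \<tau>_def f_def)
  show thesis
  proof (rule that)
    have "open (\<psi>2 ` U')"
      using local_param_subset[OF assms(2) g(1,2)] by (rule local_paramD)
    then show "open U"
      unfolding U_def by (intro continuous_open_preimage c1)
    show "u1 \<in> U" "U \<subseteq> W1"
      using assms g(3) by (auto simp: U_def)
    show "\<tau> ` U \<subseteq> W2"
      using \<tau>(1) g(2) unfolding U_def by auto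
    show "\<tau> u1 = u2"
      by (rule \<tau>(1)[OF assms(5) g(3)])
    show "\<psi>1 u = \<psi>2 (\<tau> u)" if u: "u \<in> U" for u
    proof -
      obtain w where "w \<in> U'" "\<psi>1 u = \<psi>2 w"
        using u unfolding U_def by blast
      then show ?thesis
        using \<tau>(1) by simp
    qed
    have "smooth_on U (\<lambda>u. P ((x \<circ> \<psi>1) u))"
      by (intro smooth_on_bounded_linear_compose[OF Pb] smooth_on_subset[OF c1(3)] \<open>open U\<close> \<open>U \<subseteq> W1\<close>)
    then show "smooth_on U \<tau>"
      unfolding \<tau>_def
      by (rule smooth_on_compose[OF \<open>open U\<close> g(4) _ g(6)]) (use \<tau>(2) in \<open>auto simp: U_def\<close>)
  qed
qed

text \<open>The same \<open>T\<close>, which comes from the derivative of the transition map, serves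
  every \<open>F\<close>. Applied to \<open>x\<close> and to a field together, it shows that the
  derivative of the field depends only on the tangent vector.\<close>

lemma local_param_change_derivative:
  fixes \<psi>1 \<psi>2 :: "real \<times> real \<Rightarrow> 'a::topological_space"
  assumes "local_param x W1 \<psi>1" "local_param x W2 \<psi>2" "u1 \<in> W1" "u2 \<in> W2" "\<psi>1 u1 = \<psi>2 u2"
  obtains T where "\<And>F :: 'a \<Rightarrow> real^3. F \<circ> \<psi>2 differentiable at u2 \<Longrightarrow>
    frechet_derivative (F \<circ> \<psi>1) (at u1) v = frechet_derivative (F \<circ> \<psi>2) (at u2) (T v)"
proof -
  obtain U \<tau> where U: "open U" "u1 \<in> U" "U \<subseteq> W1" "\<tau> ` U \<subseteq> W2" "smooth_on U \<tau>" "\<tau> u1 = u2"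
    "\<And>u. u \<in> U \<Longrightarrow> \<psi>1 u = \<psi>2 (\<tau> u)"
    by (rule local_param_transition[OF assms]) blast
  have "frechet_derivative (F \<circ> \<psi>1) (at u1) v
      = frechet_derivative (F \<circ> \<psi>2) (at u2) (frechet_derivative \<tau> (at u1) v)"
    if "F \<circ> \<psi>2 differentiable at u2" for F :: "'a \<Rightarrow> real^3"
  proof -
    have "((F \<circ> \<psi>2) has_derivative frechet_derivative (F \<circ> \<psi>2) (at u2)) (at (\<tau> u1))"
      using that unfolding U(6) by (rule frechet_derivative_works[THEN iffD1])
    from has_derivative_compose[OF smooth_on_has_derivative[OF U(5,2)] this]
    have "((\<lambda>u. (F \<circ> \<psi>2) (\<tau> u)) has_derivative
        (\<lambda>v. frechet_derivative (F \<circ> \<psi>2) (at u2) (frechet_derivative \<tau> (at u1) v))) (at u1)" .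
    from has_derivative_transform_within_open[OF this U(1,2), of "F \<circ> \<psi>1"]
    show ?thesis
      using U(7) by (simp add: frechet_derivative_at[symmetric])
  qed
  then show thesis
    using that by blast
qed

lemma tangent_space_local_param:
  assumes "local_param x W \<psi>" "u \<in> W"
  shows "tangent_space x (\<psi> u) = range (frechet_derivative (x \<circ> \<psi>) (at u))"
proof (intro equalityI subsetI)
  fix X assume "X \<in> tangent_space x (\<psi> u)"
  then obtain W1 \<psi>1 u1 v where 1: "local_param x W1 \<psi>1" "u1 \<in> W1" "\<psi>1 u1 = \<psi> u"
    "X = frechet_derivative (x \<circ> \<psi>1) (at u1) v"
    unfolding tangent_space_def by blast
  obtain T where T: "\<And>F :: 'a \<Rightarrow> real^3. F \<circ> \<psi> differentiable at u \<Longrightarrow>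
    frechet_derivative (F \<circ> \<psi>1) (at u1) v = frechet_derivative (F \<circ> \<psi>) (at u) (T v)"
    by (rule local_param_change_derivative[OF 1(1) assms(1) 1(2) assms(2) 1(3), where v = v]) blast
  have "x \<circ> \<psi> differentiable at u"
    using smooth_on_has_derivative[OF local_paramD(3)[OF assms(1)] assms(2)]
    by (auto simp: differentiable_def)
  then show "X \<in> range (frechet_derivative (x \<circ> \<psi>) (at u))"
    using T 1(4) by blast
next
  fix X assume "X \<in> range (frechet_derivative (x \<circ> \<psi>) (at u))"
  then show "X \<in> tangent_space x (\<psi> u)"
    using assms unfolding tangent_space_def by blast
qed

lemma cov_deriv_local_param:
  assumes "local_param x W \<psi>" "u \<in> W" "F \<circ> \<psi> differentiable at u"
  shows "cov_deriv x F (\<psi> u) (frechet_derivative (x \<circ> \<psi>) (at u) v)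
       = frechet_derivative (F \<circ> \<psi>) (at u) v"
  unfolding cov_deriv_def
proof (rule the_equality)
  show "\<exists>W1 \<psi>1 u1 v1. local_param x W1 \<psi>1 \<and> u1 \<in> W1 \<and> \<psi>1 u1 = \<psi> u \<and>
      frechet_derivative (x \<circ> \<psi>) (at u) v = frechet_derivative (x \<circ> \<psi>1) (at u1) v1 \<and>
      frechet_derivative (F \<circ> \<psi>) (at u) v = frechet_derivative (F \<circ> \<psi>1) (at u1) v1"
    using assms by blast
next
  fix Y
  assume "\<exists>W1 \<psi>1 u1 v1. local_param x W1 \<psi>1 \<and> u1 \<in> W1 \<and> \<psi>1 u1 = \<psi> u \<and>
      frechet_derivative (x \<circ> \<psi>) (at u) v = frechet_derivative (x \<circ> \<psi>1) (at u1) v1 \<and>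
      Y = frechet_derivative (F \<circ> \<psi>1) (at u1) v1"
  then obtain W1 \<psi>1 u1 v1 where 1: "local_param x W1 \<psi>1" "u1 \<in> W1" "\<psi>1 u1 = \<psi> u"
    "frechet_derivative (x \<circ> \<psi>) (at u) v = frechet_derivative (x \<circ> \<psi>1) (at u1) v1"
    "Y = frechet_derivative (F \<circ> \<psi>1) (at u1) v1"
    by blast
  obtain T where T: "\<And>F :: 'a \<Rightarrow> real^3. F \<circ> \<psi> differentiable at u \<Longrightarrow>
    frechet_derivative (F \<circ> \<psi>1) (at u1) v1 = frechet_derivative (F \<circ> \<psi>) (at u) (T v1)"
    by (rule local_param_change_derivative[OF 1(1) assms(1) 1(2) assms(2) 1(3), where v = v1]) blast
  have "x \<circ> \<psi> differentiable at u"
    using smooth_on_has_derivative[OF local_paramD(3)[OF assms(1)] assms(2)]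
    by (auto simp: differentiable_def)
  \<comment> \<open>For \<open>x\<close> itself the change of chart preserves the tangent vector,
    and an immersion has injective derivative; so the definite description has only one
    solution.\<close>
  then have "T v1 = v"
    using T[of x] 1(4) local_paramD(6)[OF assms(1,2)] by (simp add: inj_eq)
  then show "Y = frechet_derivative (F \<circ> \<psi>) (at u) v"
    using T[OF assms(3)] 1(5) by simp
qed

text \<open>One chart decides: any other chart into its image differs from it locally by a smooth
  transition map.\<close>

lemma smooth_along_local_param:
  assumes "local_param x W \<psi>" "smooth_on W (F \<circ> \<psi>)"
  shows "smooth_along (\<psi> ` W) x F"
  unfolding smooth_along_def
proof (intro allI impI, elim conjE)
  fix W1 \<psi>1 assume 1: "local_param x W1 \<psi>1" "\<psi>1 ` W1 \<subseteq> \<psi> ` W"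
  show "smooth_on W1 (F \<circ> \<psi>1)"
  proof (rule smooth_on_open_cover)
    fix u1 assume "u1 \<in> W1"
    then obtain u where u: "u \<in> W" "\<psi>1 u1 = \<psi> u"
      using 1(2) by auto
    obtain U \<tau> where U: "open U" "u1 \<in> U" "U \<subseteq> W1" "\<tau> ` U \<subseteq> W" "smooth_on U \<tau>" "\<tau> u1 = u"
      "\<And>u. u \<in> U \<Longrightarrow> \<psi>1 u = \<psi> (\<tau> u)"
      by (rule local_param_transition[OF 1(1) assms(1) \<open>u1 \<in> W1\<close> u]) blast
    have "smooth_on U (\<lambda>u. (F \<circ> \<psi>) (\<tau> u))"
      by (rule smooth_on_compose[OF U(1) local_paramD(1)[OF assms(1)] U(5) assms(2) U(4)])
    then have "smooth_on U (F \<circ> \<psi>1)"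
      by (rule smooth_on_cong[OF U(1), rotated]) (simp add: U(7))
    then show "\<exists>T. open T \<and> u1 \<in> T \<and> smooth_on T (F \<circ> \<psi>1)"
      using U by blast
  qed
qed

lemma local_param_within:
  assumes "immersed_surface M x" "open V" "V \<subseteq> M" "p \<in> V"
  obtains W \<psi> u where "local_param x W \<psi>" "u \<in> W" "\<psi> u = p" "\<psi> ` W \<subseteq> V"
proof -
  obtain W \<psi> u where *: "local_param x W \<psi>" "u \<in> W" "\<psi> u = p"
    using assms(1,3,4) unfolding immersed_surface_def by (metis imageE subsetD)
  have "open (W \<inter> \<psi> -` V)"
    by (intro continuous_open_preimage local_paramD[OF *(1)] assms)
  then show thesis
    using that[OF local_param_subset[OF *(1)], of "W \<inter> \<psi> -` V" u] * assms by auto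
qed

section \<open>Normal, tangential part and shape operator in one chart\<close>

locale oriented_chart =
  fixes M :: "'a::topological_space set" and x N :: "'a \<Rightarrow> real^3"
    and W :: "(real \<times> real) set" and \<psi> :: "real \<times> real \<Rightarrow> 'a"
  assumes oriented: "oriented_surface M x N"
    and param: "local_param x W \<psi>"
    and image_subset: "\<psi> ` W \<subseteq> M"
begin

abbreviation X where "X \<equiv> x \<circ> \<psi>"
abbreviation n where "n \<equiv> N \<circ> \<psi>"
abbreviation dX where "dX u \<equiv> frechet_derivative X (at u)"
abbreviation dn where "dn u \<equiv> frechet_derivative n (at u)"

lemmas open_domain = local_paramD(1)[OF param]
lemmas smooth_X = local_paramD(3)[OF param]
lemmas inj_dX = local_paramD(6)[OF param]

lemma smooth_n: "smooth_on W n"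
  using oriented param image_subset
  by (auto simp: oriented_surface_def unit_normal_def smooth_along_def)

lemma X_has_derivative: "u \<in> W \<Longrightarrow> (X has_derivative dX u) (at u)"
  by (rule smooth_on_has_derivative[OF smooth_X])

lemma n_has_derivative: "u \<in> W \<Longrightarrow> (n has_derivative dn u) (at u)"
  by (rule smooth_on_has_derivative[OF smooth_n])

lemma linear_dX: "u \<in> W \<Longrightarrow> linear (dX u)"
  using X_has_derivative by (rule has_derivative_linear)

lemma linear_dn: "u \<in> W \<Longrightarrow> linear (dn u)"
  using n_has_derivative by (rule has_derivative_linear)

lemma tangent_space_eq: "u \<in> W \<Longrightarrow> tangent_space x (\<psi> u) = range (dX u)"
  by (rule tangent_space_local_param[OF param])

lemma unit_n: "u \<in> W \<Longrightarrow> \<bar>\<langle>n u, n u\<rangle>\<bar> = 1"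
  using oriented image_subset by (auto simp: oriented_surface_def unit_normal_def)

lemma n_nonnull: "u \<in> W \<Longrightarrow> \<langle>n u, n u\<rangle> \<noteq> 0"
  using unit_n by fastforce

lemma n_orthogonal:
  assumes "u \<in> W"
  shows "\<langle>n u, dX u a\<rangle> = 0"
proof -
  have "\<psi> u \<in> M"
    using assms image_subset by blast
  then have "\<forall>Z\<in>tangent_space x (\<psi> u). \<langle>N (\<psi> u), Z\<rangle> = 0"
    using oriented by (simp add: oriented_surface_def unit_normal_def)
  then show ?thesis
    using tangent_space_eq[OF assms] by (metis comp_apply rangeI)
qed

lemma n_orthogonal_dn:
  assumes "u \<in> W"
  shows "\<langle>n u, dn u a\<rangle> = 0"
proof -
  have "((\<lambda>u. \<langle>n u, n u\<rangle>) has_derivative (\<lambda>a. \<langle>n u, dn u a\<rangle> + \<langle>dn u a, n u\<rangle>)) (at u)"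
    by (intro mink.FDERIV n_has_derivative assms)
  then have "\<langle>n u, dn u a\<rangle> + \<langle>dn u a, n u\<rangle> = 0"
    by (rule has_derivative_of_sign[OF _ open_domain assms unit_n])
  then show ?thesis
    by (simp add: mink_commute[of "dn u a"])
qed

lemma tangent_obtain:
  assumes "u \<in> W" "\<langle>n u, v\<rangle> = 0"
  obtains a where "v = dX u a"
  using orthogonal_normal_imp_tangent[OF linear_dX inj_dX n_orthogonal n_nonnull] assms by metis

lemma orthogonal_imp_0:
  assumes "u \<in> W" "\<langle>n u, v\<rangle> = 0" "\<And>a. \<langle>v, dX u a\<rangle> = 0"
  shows "v = 0"
  by (rule orthogonal_basis_imp_0[OF linear_dX inj_dX n_orthogonal n_nonnull])
    (use assms in auto)

text \<open>Uniqueness for the definite description: the difference of two candidates is tangent and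
  orthogonal to the tangent plane, hence 0 because the normal is not null.\<close>

lemma tangential_part_eqI:
  assumes "u \<in> W" "\<langle>n u, Y\<rangle> = 0" "\<And>a. \<langle>k - Y, dX u a\<rangle> = 0"
  shows "tangential_part x (\<psi> u) k = Y"
  unfolding tangential_part_def tangent_space_eq[OF assms(1)]
proof (rule the_equality)
  show "Y \<in> range (dX u) \<and> (\<forall>Z\<in>range (dX u). \<langle>k - Y,Z\<rangle> = 0)"
    using tangent_obtain[OF assms(1,2)] assms(3) by blast
next
  fix Z assume Z: "Z \<in> range (dX u) \<and> (\<forall>a\<in>range (dX u). \<langle>k - Z,a\<rangle> = 0)"
  have "Z - Y = 0"
  proof (rule orthogonal_imp_0[OF assms(1)])
    show "\<langle>n u, Z - Y\<rangle> = 0"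
      using Z n_orthogonal[OF assms(1)] assms(2) by (auto simp: mink.diff_right)
    show "\<langle>Z - Y, dX u a\<rangle> = 0" for a
    proof -
      have "\<langle>k - Z, dX u a\<rangle> = 0"
        using Z by blast
      then show ?thesis
        using assms(3)[of a] by (simp add: mink.diff_left)
    qed
  qed
  then show "Z = Y"
    by simp
qed

lemma tangential_part_eq:
  assumes "u \<in> W"
  shows "tangential_part x (\<psi> u) k = k - (\<langle>k, n u\<rangle> / \<langle>n u, n u\<rangle>) *\<^sub>R n u"
  using n_nonnull[OF assms] n_orthogonal[OF assms]
  by (intro tangential_part_eqI[OF assms])
    (simp_all add: mink.diff_right mink.scaleR_right mink.scaleR_left mink_commute)

lemma shape_operator_eq:
  assumes "u \<in> W"
  shows "shape_operator x N (\<psi> u) (dX u a) = - dn u a"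
  unfolding shape_operator_def
  using cov_deriv_local_param[OF param assms, of N a] n_has_derivative[OF assms]
  by (auto simp: differentiable_def)

text \<open>Differentiating \<open>\<langle>n u, dX u b\<rangle> = 0\<close> in direction
  \<open>a\<close> expresses the product through the normal component of the second derivative of
  \<open>X\<close>, which is symmetric in \<open>a\<close> and \<open>b\<close>.\<close>

lemma shape_operator_symmetric:
  assumes "u \<in> W"
  shows "\<langle>dn u a, dX u b\<rangle> = \<langle>dn u b, dX u a\<rangle>"
proof -
  let ?dd = "\<lambda>b. frechet_derivative (\<lambda>p. dX p b) (at u)"
  have "\<langle>n u, ?dd b a\<rangle> + \<langle>dn u a, dX u b\<rangle> = 0" for a b
  proof -
    have "((\<lambda>u. \<langle>n u, dX u b\<rangle>) has_derivative (\<lambda>a. \<langle>n u, ?dd b a\<rangle> + \<langle>dn u a, dX u b\<rangle>)) (at u)"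
      by (intro mink.FDERIV n_has_derivative assms
          smooth_on_has_derivative[OF smooth_on_frechet_derivative[OF smooth_X]])
    then show ?thesis
      by (rule has_derivative_constant_on_open[OF _ open_domain assms n_orthogonal])
  qed
  from this[of a b] this[of b a] show ?thesis
    using symmetric_second_derivative[OF open_domain assms smooth_X, of a b] by simp
qed

end

lemma has_vector_derivative_interval_integral:
  fixes f :: "real \<Rightarrow> 'b::euclidean_space"
  assumes "open I" "is_interval I" "c \<in> I" "s \<in> I" "continuous_on I f"
  shows "((\<lambda>s. LBINT \<xi>=c..s. f \<xi>) has_vector_derivative f s) (at s)"
proof -
  have "min c s \<in> I" "max c s \<in> I"
    using assms by (auto simp: min_def max_def)
  then obtain e1 e2 where e: "e1 > 0" "e2 > 0" "cball (min c s) e1 \<subseteq> I" "cball (max c s) e2 \<subseteq> I"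
    using assms(1) by (meson open_contains_cball)
  define a b where "a = min c s - e1" and "b = max c s + e2"
  have ab: "a \<in> I" "b \<in> I" "a < s" "s < b" "a \<le> c" "c \<le> b"
    using e by (auto simp: a_def b_def subset_iff dist_real_def)
  have sub: "{a..b} \<subseteq> I"
    using ab(1,2) assms(2) mem_is_interval_1_I[of I a b] by auto
  have "((\<lambda>s. LBINT \<xi>=c..s. f \<xi>) has_vector_derivative f s) (at s within {a..b})"
    using ab continuous_on_subset[OF assms(5) sub] by (intro interval_integral_FTC2) auto
  then show ?thesis
    using ab(3,4) by (simp add: at_within_Icc_at)
qed

section \<open>Surfaces of the family\<close>

abbreviation (input) k0 :: "real^3" where "k0 \<equiv> vector [1, 0, 1]"

text \<open>For \<epsilon> of absolute value 1 and a non-negative argument of the root, these are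
  exactly the null vectors with product \<epsilon> with \<open>k0\<close> and non-negative second
  coordinate, parametrized by the first coordinate.\<close>

definition null_curve :: "real \<Rightarrow> (real \<Rightarrow> real) \<Rightarrow> real \<Rightarrow> real^3" where
  "null_curve \<epsilon> \<gamma>0 t = vector [\<gamma>0 t, sqrt (- 2 * \<epsilon> * \<gamma>0 t + 1), \<gamma>0 t - \<epsilon>]"

text \<open>Under the same conditions, a unit space-like vector spanning the orthogonal complement
  of \<open>k0\<close> and \<open>null_curve \<epsilon> \<gamma>0 t\<close>.\<close>

definition space_curve :: "real \<Rightarrow> (real \<Rightarrow> real) \<Rightarrow> real \<Rightarrow> real^3" where
  "space_curve \<epsilon> \<gamma>0 t = vector [sqrt (- 2 * \<epsilon> * \<gamma>0 t + 1), - \<epsilon>, sqrt (- 2 * \<epsilon> * \<gamma>0 t + 1)]"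

lemma null_curve_products:
  assumes "\<epsilon> \<in> {- 1, 1}" "- 2 * \<epsilon> * \<gamma>0 t + 1 \<ge> 0"
  shows "\<langle>null_curve \<epsilon> \<gamma>0 t, null_curve \<epsilon> \<gamma>0 t\<rangle> = 0" "\<langle>k0, null_curve \<epsilon> \<gamma>0 t\<rangle> = \<epsilon>"
    "\<langle>space_curve \<epsilon> \<gamma>0 t, null_curve \<epsilon> \<gamma>0 t\<rangle> = 0" "\<langle>space_curve \<epsilon> \<gamma>0 t, k0\<rangle> = 0"
  using assms
  by (auto simp: null_curve_def space_curve_def mink_def power2_eq_square[symmetric] algebra_simps)
    (auto simp: power2_eq_square algebra_simps)

lemma k0_null: "\<langle>k0,k0\<rangle> = 0"
  by (simp add: mink_def)

locale family_chart = oriented_chart M x N W \<psi>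
  for M :: "'a::topological_space set" and x N :: "'a \<Rightarrow> real^3"
    and W :: "(real \<times> real) set" and \<psi> :: "real \<times> real \<Rightarrow> 'a" +
  fixes \<epsilon> :: real and \<phi> \<gamma>0 b :: "real \<Rightarrow> real" and s0 t0 :: real and I J :: "real set"
    and L :: "real^3 \<Rightarrow> real^3" and a :: "real^3"
  assumes data: "family_data \<epsilon> \<phi> \<gamma>0 b s0 t0 I J"
    and domain_subset: "W \<subseteq> I \<times> J"
    and lorentz: "lorentz_map L"
    and X_eq: "\<And>u. u \<in> W \<Longrightarrow> x (\<psi> u) = L (family_map \<epsilon> \<phi> \<gamma>0 b s0 t0 u) + a"
begin

definition Y where "Y = family_map \<epsilon> \<phi> \<gamma>0 b s0 t0"
definition A where "A s = (LBINT \<xi>=s0..s. 1 / (2 * (\<phi> \<xi>)\<^sup>2))"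
definition B where "B t = (LBINT \<xi>=t0..t. b \<xi> *\<^sub>R space_curve \<epsilon> \<gamma>0 \<xi>)"
abbreviation dY where "dY u \<equiv> frechet_derivative Y (at u)"
abbreviation G where "G \<equiv> null_curve \<epsilon> \<gamma>0"
abbreviation H where "H \<equiv> space_curve \<epsilon> \<gamma>0"

lemma Y_eq: "Y u = A (fst u) *\<^sub>R k0 + fst u *\<^sub>R G (snd u) + B (snd u)"
  by (simp add: Y_def family_map_def A_def B_def null_curve_def space_curve_def split_beta)

lemma eps: "\<epsilon> \<in> {- 1, 1}" "\<epsilon> * \<epsilon> = 1"
  using data by (auto simp: family_data_def)

lemma in_data:
  assumes "u \<in> W"
  shows "fst u \<in> I" "snd u \<in> J" "\<phi> (fst u) \<noteq> 0" "deriv \<phi> (fst u) \<noteq> 0" "- 2 * \<epsilon> * \<gamma>0 (snd u) + 1 \<ge> 0"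
proof -
  show *: "fst u \<in> I" "snd u \<in> J"
    using assms domain_subset by auto
  show "\<phi> (fst u) \<noteq> 0" "deriv \<phi> (fst u) \<noteq> 0" "- 2 * \<epsilon> * \<gamma>0 (snd u) + 1 \<ge> 0"
    using data * by (auto simp: family_data_def)
qed

lemma products:
  assumes "u \<in> W"
  shows "\<langle>G (snd u), G (snd u)\<rangle> = 0" "\<langle>k0, G (snd u)\<rangle> = \<epsilon>" "\<langle>H (snd u), G (snd u)\<rangle> = 0" "\<langle>H (snd u), k0\<rangle> = 0"
  using null_curve_products[OF eps(1), of \<gamma>0 "snd u"] in_data(5)[OF assms] by blast+

lemma bounded_linear_L: "bounded_linear L"
  using lorentz by (simp add: lorentz_map_def linear_conv_bounded_linear)

lemma mink_L: "\<langle>L v, L w\<rangle> = \<langle>v,w\<rangle>"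
  using lorentz by (simp add: lorentz_map_def)

text \<open>Smoothness of \<open>Y\<close> is inherited from \<open>x \<circ> \<psi>\<close> by
  undoing \<open>L\<close> and the translation. The formula would not give it:
  \<open>family_data\<close> admits points where the argument of the square root vanishes.\<close>

lemma Y_has_derivative: "u \<in> W \<Longrightarrow> (Y has_derivative dY u) (at u)"
  and smooth_Y: "smooth_on W Y"
  and dX_eq: "u \<in> W \<Longrightarrow> dX u v = L (dY u v)"
proof -
  obtain L' where L': "linear L'" "L' \<circ> L = id"
    using linear_injective_left_inverse[OF _ lorentz_map_inj[OF lorentz]] lorentz
    by (auto simp: lorentz_map_def)
  have L'b: "bounded_linear L'"
    using L'(1) by (simp add: linear_conv_bounded_linear)
  have "smooth_on W (\<lambda>u. L' (X u - a))"
    by (intro smooth_on_bounded_linear_compose[OF L'b] smooth_on_diff smooth_X smooth_on_const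
        open_domain)
  then show "smooth_on W Y"
    by (rule smooth_on_cong[OF open_domain, rotated])
      (use L'(2) in \<open>simp add: X_eq Y_def fun_eq_iff\<close>)
  then show d: "(Y has_derivative dY u) (at u)" if "u \<in> W" for u
    by (rule smooth_on_has_derivative[OF _ that])
  have "((\<lambda>u. L (Y u) + a) has_derivative (\<lambda>v. L (dY u v))) (at u)" if "u \<in> W" for u
    using d[OF that] by (auto intro!: derivative_eq_intros bounded_linear.has_derivative[OF bounded_linear_L])
  from has_derivative_transform_within_open[OF this open_domain]
  have "(X has_derivative (\<lambda>v. L (dY u v))) (at u)" if "u \<in> W" for u
    using that X_eq by (auto simp: Y_def)
  then show "dX u v = L (dY u v)" if "u \<in> W" for u v
    using that by (metis frechet_derivative_at)
qed

lemma smooth_\<phi>: "smooth_on W (\<lambda>u. \<phi> (fst u))"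
proof (rule smooth_on_compose[OF open_domain, of I fst])
  show "smooth_on W fst"
    by (intro smooth_on_linear bounded_linear_fst)
qed (use data in_data in \<open>auto simp: family_data_def\<close>)

lemma \<phi>_has_derivative:
  assumes "u \<in> W"
  shows "((\<lambda>u. \<phi> (fst u)) has_derivative (\<lambda>v. fst v * deriv \<phi> (fst u))) (at u)"
proof -
  have "(\<phi> has_derivative frechet_derivative \<phi> (at (fst u))) (at (fst u))"
    using data in_data(1)[OF assms] by (intro smooth_on_has_derivative[of I]) (auto simp: family_data_def)
  then have "(\<phi> has_real_derivative deriv \<phi> (fst u)) (at (fst u))"
    using DERIV_deriv_iff_real_differentiable differentiable_def by blast
  then have "(\<phi> has_derivative (*) (deriv \<phi> (fst u))) (at (fst u))"
    by (simp add: has_field_derivative_def)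
  from has_derivative_compose[OF has_derivative_fst[OF has_derivative_ident] this]
  show ?thesis
    by (simp add: mult.commute)
qed

lemma A_has_derivative:
  assumes "s \<in> I"
  shows "(A has_vector_derivative 1 / (2 * (\<phi> s)\<^sup>2)) (at s)"
proof -
  have "continuous_on I (\<lambda>\<xi>. 1 / (2 * (\<phi> \<xi>)\<^sup>2))"
    using data by (intro continuous_intros smooth_on_continuous) (auto simp: family_data_def)
  then show ?thesis
    unfolding A_def[abs_def] using data assms
    by (intro has_vector_derivative_interval_integral[of I]) (auto simp: family_data_def)
qed

lemma B_has_derivative:
  assumes "t \<in> J"
  shows "(B has_vector_derivative b t *\<^sub>R H t) (at t)"
proof -
  have c: "continuous_on J \<gamma>0" "continuous_on J b"
    using data by (auto simp: family_data_def intro: smooth_on_continuous)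
  have "H t = sqrt (- 2 * \<epsilon> * \<gamma>0 t + 1) *\<^sub>R k0 + (- \<epsilon>) *\<^sub>R axis 2 1" for t
    by (simp add: space_curve_def vec_eq_iff forall_3 axis_def)
  then have "continuous_on J (\<lambda>t. b t *\<^sub>R H t)"
    using c by (auto intro!: continuous_intros)
  then show ?thesis
    unfolding B_def[abs_def] using data assms
    by (intro has_vector_derivative_interval_integral[of J]) (auto simp: family_data_def)
qed

text \<open>On a line of constant \<open>t\<close> the vectors \<open>G\<close> and \<open>B\<close>
  are fixed, so this derivative is available before anything is known about the differentiability of
  \<open>G\<close>.\<close>

lemma dY_1:
  assumes "u \<in> W"
  shows "dY u (1, 0) = (1 / (2 * (\<phi> (fst u))\<^sup>2)) *\<^sub>R k0 + G (snd u)"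
proof -
  obtain s t where u: "u = (s, t)"
    by fastforce
  have "((\<lambda>s. (s, t)) has_derivative (\<lambda>h. (h, 0))) (at s)"
    by (auto intro!: derivative_eq_intros)
  moreover have "(Y has_derivative dY u) (at (s, t))"
    using Y_has_derivative[OF assms] u by simp
  ultimately have "((\<lambda>s. Y (s, t)) has_derivative (\<lambda>h. dY u (h, 0))) (at s)"
    by (rule has_derivative_compose)
  moreover have "((\<lambda>s. Y (s, t)) has_derivative (\<lambda>h. (h *\<^sub>R (1 / (2 * (\<phi> s)\<^sup>2))) *\<^sub>R k0 + h *\<^sub>R G t)) (at s)"
    unfolding Y_eq using A_has_derivative[of s] in_data(1)[OF assms]
    by (auto intro!: derivative_eq_intros simp: u has_vector_derivative_def)
  ultimately have "(\<lambda>h. dY u (h, 0)) = (\<lambda>h. (h *\<^sub>R (1 / (2 * (\<phi> s)\<^sup>2))) *\<^sub>R k0 + h *\<^sub>R G t)"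
    by (rule has_derivative_unique)
  from fun_cong[OF this, of 1] show ?thesis
    by (simp add: u)
qed

text \<open>Solving \<open>dY_1\<close> for \<open>G\<close> writes it as a derivative of the smooth
  map \<open>Y\<close> minus a smooth multiple of \<open>k0\<close>, which bypasses the square
  root.\<close>

lemma smooth_G: "smooth_on W (\<lambda>u. G (snd u))"
proof -
  have "smooth_on W (\<lambda>u. dY u (1, 0) - (1 / (2 * (\<phi> (fst u) * \<phi> (fst u)))) *\<^sub>R k0)"
    using in_data(3)
    by (intro smooth_on_diff smooth_on_scaleR smooth_on_divide smooth_on_mult smooth_on_const
        smooth_\<phi> smooth_on_frechet_derivative smooth_Y open_domain) auto
  then show ?thesis
    by (rule smooth_on_cong[OF open_domain, rotated]) (simp add: dY_1 power2_eq_square)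
qed

abbreviation dG where "dG u \<equiv> frechet_derivative (\<lambda>u. G (snd u)) (at u)"

lemma G_has_derivative: "u \<in> W \<Longrightarrow> ((\<lambda>u. G (snd u)) has_derivative dG u) (at u)"
  by (rule smooth_on_has_derivative[OF smooth_G])

lemma dG_products:
  assumes "u \<in> W"
  shows "\<langle>k0, dG u v\<rangle> = 0" "\<langle>G (snd u), dG u v\<rangle> = 0"
proof -
  have "((\<lambda>u. \<langle>k0, G (snd u)\<rangle>) has_derivative (\<lambda>v. \<langle>k0, dG u v\<rangle> + \<langle>0, G (snd u)\<rangle>)) (at u)"
    by (intro mink.FDERIV has_derivative_const G_has_derivative assms)
  then have "\<langle>k0, dG u v\<rangle> + \<langle>0, G (snd u)\<rangle> = 0"
    by (rule has_derivative_constant_on_open[OF _ open_domain assms products(2)])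
  then show "\<langle>k0, dG u v\<rangle> = 0"
    by (simp add: mink.zero_left)
  have "((\<lambda>u. \<langle>G (snd u), G (snd u)\<rangle>) has_derivative
      (\<lambda>v. \<langle>G (snd u), dG u v\<rangle> + \<langle>dG u v, G (snd u)\<rangle>)) (at u)"
    by (intro mink.FDERIV G_has_derivative assms)
  then have "\<langle>G (snd u), dG u v\<rangle> + \<langle>dG u v, G (snd u)\<rangle> = 0"
    by (rule has_derivative_constant_on_open[OF _ open_domain assms products(1)])
  then show "\<langle>G (snd u), dG u v\<rangle> = 0"
    by (simp add: mink_commute[of "dG u v"])
qed

lemma dG_1:
  assumes "u \<in> W"
  shows "dG u (1, 0) = 0"
proof -
  obtain s t where u: "u = (s, t)"
    by fastforce
  have "((\<lambda>s. (s, t)) has_derivative (\<lambda>h. (h, 0))) (at s)"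
    by (auto intro!: derivative_eq_intros)
  moreover have "((\<lambda>u. G (snd u)) has_derivative dG u) (at (s, t))"
    using G_has_derivative[OF assms] u by simp
  ultimately have "((\<lambda>s. G (snd (s, t))) has_derivative (\<lambda>h. dG u (h, 0))) (at s)"
    by (rule has_derivative_compose)
  then have "(\<lambda>h. dG u (h, 0)) = (\<lambda>h. 0)"
    using has_derivative_unique[OF _ has_derivative_const] by simp
  then show ?thesis
    by metis
qed

lemma dY_eq:
  assumes "u \<in> W"
  shows "dY u v = (fst v / (2 * (\<phi> (fst u))\<^sup>2)) *\<^sub>R k0 + fst v *\<^sub>R G (snd u) + fst u *\<^sub>R dG u v
    + (snd v * b (snd u)) *\<^sub>R H (snd u)"
proof -
  have A': "((\<lambda>u. A (fst u)) has_derivative (\<lambda>v. fst v *\<^sub>R (1 / (2 * (\<phi> (fst u))\<^sup>2)))) (at u)"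
    using has_derivative_compose[OF has_derivative_fst[OF has_derivative_ident]]
      A_has_derivative[OF in_data(1)[OF assms]] by (simp add: has_vector_derivative_def)
  have B': "((\<lambda>u. B (snd u)) has_derivative (\<lambda>v. snd v *\<^sub>R (b (snd u) *\<^sub>R H (snd u)))) (at u)"
    using has_derivative_compose[OF has_derivative_snd[OF has_derivative_ident]]
      B_has_derivative[OF in_data(2)[OF assms]] by (simp add: has_vector_derivative_def)
  have "(Y has_derivative (\<lambda>v. (fst v *\<^sub>R (1 / (2 * (\<phi> (fst u))\<^sup>2))) *\<^sub>R k0
     + (fst u *\<^sub>R dG u v + fst v *\<^sub>R G (snd u)) + snd v *\<^sub>R (b (snd u) *\<^sub>R H (snd u)))) (at u)"
    unfolding Y_eq[abs_def]
    by (intro has_derivative_add has_derivative_scaleR_left A' B'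
        has_derivative_scaleR has_derivative_fst has_derivative_ident G_has_derivative assms)
  then show ?thesis
    by (simp add: frechet_derivative_at[symmetric] algebra_simps)
qed

text \<open>In the expansion \<open>dY_eq\<close>, all products with \<open>k0\<close> or
  \<open>G\<close> vanish except \<open>\<langle>k0, G\<rangle> = \<epsilon>\<close>. In particular
  the coordinate lines meet orthogonally.\<close>

lemma dY_1_products:
  assumes "u \<in> W"
  shows "\<langle>k0, dY u v\<rangle> = fst v * \<epsilon>" "\<langle>G (snd u), dY u v\<rangle> = fst v * \<epsilon> / (2 * (\<phi> (fst u))\<^sup>2)"
    "\<langle>dY u (1, 0), dY u v\<rangle> = fst v * \<epsilon> / (\<phi> (fst u))\<^sup>2"
proof -
  show 1: "\<langle>k0, dY u v\<rangle> = fst v * \<epsilon>"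
    using products[OF assms] k0_null dG_products[OF assms]
    by (simp add: dY_eq[OF assms] mink.add_right mink.scaleR_right mink_commute)
  show 2: "\<langle>G (snd u), dY u v\<rangle> = fst v * \<epsilon> / (2 * (\<phi> (fst u))\<^sup>2)"
    using products[OF assms] k0_null dG_products[OF assms]
    by (simp add: dY_eq[OF assms] mink.add_right mink.scaleR_right mink_commute)
  show "\<langle>dY u (1, 0), dY u v\<rangle> = fst v * \<epsilon> / (\<phi> (fst u))\<^sup>2"
    unfolding dY_1[OF assms] by (simp add: mink.add_left mink.scaleR_left 1 2)
qed

end

section \<open>The normal and the principal direction of a surface of the family\<close>

context family_chart
begin

definition normal where "normal u = (1 / (2 * \<phi> (fst u))) *\<^sub>R k0 - \<phi> (fst u) *\<^sub>R G (snd u)"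
text \<open>\<open>N\<close> may point either way, and differently on different components of
  \<open>W\<close>; this sign compares it with the explicit normal.\<close>

definition \<sigma> where "\<sigma> u = \<langle>n u, L (normal u)\<rangle>"

lemma smooth_normal: "smooth_on W normal"
  unfolding normal_def[abs_def] using in_data(3)
  by (intro smooth_on_diff smooth_on_scaleR smooth_on_divide smooth_on_mult smooth_on_const
      smooth_\<phi> smooth_G open_domain) auto

lemma smooth_\<sigma>: "smooth_on W \<sigma>"
  unfolding \<sigma>_def[abs_def]
  by (intro smooth_on_bilinear[OF mink.bounded_bilinear_axioms] smooth_n
      smooth_on_bounded_linear_compose[OF bounded_linear_L] smooth_normal open_domain)

lemma normal_products:
  assumes "u \<in> W"
  shows "\<langle>normal u, normal u\<rangle> = - \<epsilon>" "\<langle>normal u, dY u v\<rangle> = 0"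
proof -
  note p = products[OF assms] k0_null in_data(3)[OF assms]
  show "\<langle>normal u, normal u\<rangle> = - \<epsilon>"
    using p by (simp add: normal_def mink.diff_left mink.diff_right mink.scaleR_left mink.scaleR_right
        mink_commute)
  show "\<langle>normal u, dY u v\<rangle> = 0"
    using p by (simp add: normal_def mink.diff_left mink.scaleR_left dY_1_products[OF assms]
        power2_eq_square)
qed

text \<open>\<open>L (normal u)\<close> and \<open>n u\<close> are both orthogonal to the tangent
  plane, so the first is \<open>c\<close> times the second. Both have norms of absolute value 1,
  which gives \<open>c\<^sup>2 = 1\<close> and at the same time
  \<open>\<langle>n u, n u\<rangle> = - \<epsilon>\<close>.\<close>

lemma n_eq:
  assumes "u \<in> W"
  shows "n u = (- \<epsilon> * \<sigma> u) *\<^sub>R L (normal u)" "\<bar>\<sigma> u\<bar> = 1"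
proof -
  define c where "c = \<sigma> u / \<langle>n u, n u\<rangle>"
  have "L (normal u) - c *\<^sub>R n u = 0"
  proof (rule orthogonal_imp_0[OF assms])
    show "\<langle>n u, L (normal u) - c *\<^sub>R n u\<rangle> = 0"
      using n_nonnull[OF assms] by (simp add: mink.diff_right mink.scaleR_right c_def \<sigma>_def)
    show "\<langle>L (normal u) - c *\<^sub>R n u, dX u v\<rangle> = 0" for v
      using n_orthogonal[OF assms, of v]
      by (simp add: mink.diff_left mink.scaleR_left dX_eq[OF assms] mink_L normal_products[OF assms])
  qed
  then have Ln: "L (normal u) = c *\<^sub>R n u"
    by simp
  have "c\<^sup>2 * \<langle>n u, n u\<rangle> = - \<epsilon>"
    using normal_products(1)[OF assms] mink_L[of "normal u" "normal u"]
    by (simp add: Ln mink.scaleR_left mink.scaleR_right power2_eq_square)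
  then have "\<bar>c\<^sup>2 * \<langle>n u, n u\<rangle>\<bar> = 1"
    using eps(1) by auto
  then have "c\<^sup>2 = 1"
    using unit_n[OF assms] by (simp add: abs_mult)
  then have nn: "\<langle>n u, n u\<rangle> = - \<epsilon>"
    using \<open>c\<^sup>2 * \<langle>n u, n u\<rangle> = - \<epsilon>\<close> by simp
  have \<sigma>: "\<sigma> u = - \<epsilon> * c"
    using nn eps by (simp add: \<sigma>_def Ln mink.scaleR_right)
  then have "- \<epsilon> * \<sigma> u = c"
    using eps(2) by simp
  then show "n u = (- \<epsilon> * \<sigma> u) *\<^sub>R L (normal u)"
    using \<open>c\<^sup>2 = 1\<close> by (simp add: Ln power2_eq_square)
  show "\<bar>\<sigma> u\<bar> = 1"
    using \<sigma> \<open>c\<^sup>2 = 1\<close> eps(1) by (auto simp: abs_square_eq_1[symmetric] power_mult_distrib)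
qed

text \<open>\<open>G\<close> is constant in \<open>s\<close>, and differentiating the coefficients
  \<open>1 / (2 * \<phi>)\<close> and \<open>- \<phi>\<close> produces \<open>- deriv \<phi>\<close>
  times the coefficients \<open>1 / (2 * \<phi>\<^sup>2)\<close> and 1 of
  \<open>dY_1\<close>.\<close>

lemma normal_derivative:
  assumes "u \<in> W"
  shows "frechet_derivative normal (at u) (1, 0) = - deriv \<phi> (fst u) *\<^sub>R dY u (1, 0)"
proof -
  define d where "d = deriv \<phi> (fst u)"
  have "((\<lambda>u. 1 / (2 * \<phi> (fst u))) has_derivative
      (\<lambda>v. - (fst v * d) / (2 * (\<phi> (fst u))\<^sup>2))) (at u)"
    using in_data(3)[OF assms]
    by (auto intro!: derivative_eq_intros \<phi>_has_derivative[OF assms]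
        simp: field_simps power2_eq_square fun_eq_iff d_def)
  then have "(normal has_derivative (\<lambda>v. (- (fst v * d) / (2 * (\<phi> (fst u))\<^sup>2)) *\<^sub>R k0
     - (\<phi> (fst u) *\<^sub>R dG u v + (fst v * d) *\<^sub>R G (snd u)))) (at u)"
    unfolding normal_def[abs_def]
    by (intro has_derivative_diff has_derivative_scaleR_left has_derivative_scaleR
        \<phi>_has_derivative[OF assms, folded d_def] G_has_derivative assms)
  then show ?thesis
    by (simp add: frechet_derivative_at[symmetric] dY_1[OF assms] dG_1[OF assms]
        d_def[symmetric] algebra_simps)
qed

text \<open>The eigenvalue of the shape operator on the \<open>s\<close>-lines;
  \<open>- \<epsilon> * \<sigma> u\<close> is the sign with which \<open>n_eq\<close> expresses the
  normal.\<close>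

definition curvature where "curvature u = - \<epsilon> * \<sigma> u * deriv \<phi> (fst u)"

lemma shape_operator_dX_1:
  assumes "u \<in> W"
  shows "dn u (1, 0) = - curvature u *\<^sub>R dX u (1, 0)"
proof -
  have \<sigma>: "(\<sigma> has_derivative frechet_derivative \<sigma> (at u)) (at u)"
    by (rule smooth_on_has_derivative[OF smooth_\<sigma> assms])
  \<comment> \<open>The sign has zero derivative, so only the explicit normal contributes to
    \<open>dn\<close>.\<close>
  then have \<sigma>0: "frechet_derivative \<sigma> (at u) v = 0" for v
    by (rule has_derivative_of_sign[OF _ open_domain assms n_eq(2)])
  have N: "(normal has_derivative frechet_derivative normal (at u)) (at u)"
    by (rule smooth_on_has_derivative[OF smooth_normal assms])
  have "((\<lambda>u. (- \<epsilon> * \<sigma> u) *\<^sub>R L (normal u)) has_derivative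
      (\<lambda>v. (- \<epsilon> * \<sigma> u) *\<^sub>R L (frechet_derivative normal (at u) v)
         + (- \<epsilon> * frechet_derivative \<sigma> (at u) v) *\<^sub>R L (normal u))) (at u)"
    by (intro has_derivative_scaleR has_derivative_mult_right \<sigma>
        bounded_linear.has_derivative[OF bounded_linear_L] N)
  then have "(n has_derivative (\<lambda>v. (- \<epsilon> * \<sigma> u) *\<^sub>R L (frechet_derivative normal (at u) v)
         + (- \<epsilon> * frechet_derivative \<sigma> (at u) v) *\<^sub>R L (normal u))) (at u)"
    by (rule has_derivative_transform_within_open[OF _ open_domain assms]) (rule n_eq(1)[symmetric])
  then have "dn u = (\<lambda>v. (- \<epsilon> * \<sigma> u) *\<^sub>R L (frechet_derivative normal (at u) v)
         + (- \<epsilon> * frechet_derivative \<sigma> (at u) v) *\<^sub>R L (normal u))"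
    by (rule frechet_derivative_at[symmetric])
  then have "dn u (1, 0) = (- \<epsilon> * \<sigma> u) *\<^sub>R L (- deriv \<phi> (fst u) *\<^sub>R dY u (1, 0))"
    by (simp add: \<sigma>0 normal_derivative[OF assms])
  then show ?thesis
    by (simp add: dX_eq[OF assms] curvature_def linear_cmul[OF bounded_linear.linear[OF bounded_linear_L]]
        linear_neg[OF bounded_linear.linear[OF bounded_linear_L]] algebra_simps)
qed

text \<open>By \<open>dY_1_products\<close> both sides have the same products with tangent vectors:
  the factor \<open>\<phi>\<^sup>2\<close> cancels the squared length
  \<open>\<epsilon> / \<phi>\<^sup>2\<close> of the coordinate field.\<close>

lemma tangential_part_k0:
  assumes "u \<in> W"
  shows "tangential_part x (\<psi> u) (L k0) = (\<phi> (fst u))\<^sup>2 *\<^sub>R dX u (1, 0)"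
  using n_orthogonal[OF assms] in_data(3)[OF assms]
  by (intro tangential_part_eqI[OF assms])
    (simp_all add: mink.diff_left mink.scaleR_left mink.scaleR_right dX_eq[OF assms] mink_L
      dY_1_products[OF assms])

lemma smooth_curvature: "smooth_on W curvature"
proof -
  have "smooth_on W (\<lambda>u. - \<epsilon> * \<sigma> u * frechet_derivative (\<lambda>u. \<phi> (fst u)) (at u) (1, 0))"
    by (intro smooth_on_mult smooth_on_const smooth_\<sigma> smooth_on_frechet_derivative smooth_\<phi> open_domain)
  then show ?thesis
    by (rule smooth_on_cong[OF open_domain, rotated])
      (simp add: curvature_def frechet_derivative_at[OF \<phi>_has_derivative, symmetric])
qed

lemma smooth_along_inv_into:
  fixes F :: "real \<times> real \<Rightarrow> 'b::real_normed_vector"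
  assumes "smooth_on W F"
  shows "smooth_along (\<psi> ` W) x (\<lambda>q. F (inv_into W \<psi> q))"
  by (intro smooth_along_local_param[OF param] smooth_on_cong[OF open_domain _ assms])
    (simp add: inv_into_f_f[OF local_paramD(5)[OF param]])

theorem family_canonical_principal_direction:
  "light_like (L k0)"
  "\<exists>k1. canonical_principal_direction (\<psi> ` W) x N (L k0) k1 \<and> (\<forall>q\<in>\<psi> ` W. k1 q \<noteq> 0)"
  "\<exists>e1. smooth_along (\<psi> ` W) x e1 \<and>
     (\<forall>q\<in>\<psi> ` W. e1 q \<in> tangent_space x q \<and> \<langle>e1 q, e1 q\<rangle> = \<epsilon>) \<and>
     (\<forall>(s, t)\<in>W. tangential_part x (\<psi> (s, t)) (L k0) = \<phi> s *\<^sub>R e1 (\<psi> (s, t)))"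
proof -
  note inv = inv_into_f_f[OF local_paramD(5)[OF param]]
  have "k0 \<noteq> 0"
    by (simp add: vec_eq_iff forall_3)
  then have "L k0 \<noteq> 0"
    using lorentz_map_inj[OF lorentz] linear_0[OF bounded_linear.linear[OF bounded_linear_L]]
    by (metis injD)
  then show "light_like (L k0)"
    by (simp add: light_like_def mink_L k0_null)
  show "\<exists>k1. canonical_principal_direction (\<psi> ` W) x N (L k0) k1 \<and> (\<forall>q\<in>\<psi> ` W. k1 q \<noteq> 0)"
  proof (intro exI conjI)
    show "canonical_principal_direction (\<psi> ` W) x N (L k0) (\<lambda>q. curvature (inv_into W \<psi> q))"
      unfolding canonical_principal_direction_def
    proof (intro conjI smooth_along_inv_into smooth_curvature ballI)
      fix q assume "q \<in> \<psi> ` W"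
      then obtain u where u: "u \<in> W" "q = \<psi> u"
        by blast
      have T: "tangential_part x (\<psi> u) (L k0) = dX u ((\<phi> (fst u))\<^sup>2 *\<^sub>R (1, 0))"
        unfolding tangential_part_k0[OF u(1)] linear_cmul[OF linear_dX[OF u(1)]] ..
      have "dn u ((\<phi> (fst u))\<^sup>2 *\<^sub>R (1, 0)) = - curvature u *\<^sub>R dX u ((\<phi> (fst u))\<^sup>2 *\<^sub>R (1, 0))"
        unfolding linear_cmul[OF linear_dX[OF u(1)]] linear_cmul[OF linear_dn[OF u(1)]]
          shape_operator_dX_1[OF u(1)] by simp
      then show "shape_operator x N q (tangential_part x q (L k0)) =
          curvature (inv_into W \<psi> q) *\<^sub>R tangential_part x q (L k0)"
        unfolding u(2) T shape_operator_eq[OF u(1)] inv[OF u(1)] by (metis minus_minus scaleR_minus_left)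
    qed
    show "\<forall>q\<in>\<psi> ` W. curvature (inv_into W \<psi> q) \<noteq> 0"
    proof
      fix q assume "q \<in> \<psi> ` W"
      then obtain u where u: "u \<in> W" "q = \<psi> u"
        by blast
      have "\<sigma> u \<noteq> 0" "\<epsilon> \<noteq> 0"
        using n_eq(2)[OF u(1)] eps by auto
      then show "curvature (inv_into W \<psi> q) \<noteq> 0"
        using in_data(4)[OF u(1)] by (simp add: u inv curvature_def)
    qed
  qed
  show "\<exists>e1. smooth_along (\<psi> ` W) x e1 \<and>
     (\<forall>q\<in>\<psi> ` W. e1 q \<in> tangent_space x q \<and> \<langle>e1 q, e1 q\<rangle> = \<epsilon>) \<and>
     (\<forall>(s, t)\<in>W. tangential_part x (\<psi> (s, t)) (L k0) = \<phi> s *\<^sub>R e1 (\<psi> (s, t)))"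
  proof (intro exI conjI)
    \<comment> \<open>One of the two factors \<open>\<phi>\<close> in
      \<open>tangential_part_k0\<close> is absorbed into the coordinate field, which normalizes its
      squared length to \<epsilon>.\<close>
    let ?E = "\<lambda>u. \<phi> (fst u) *\<^sub>R dX u (1, 0)"
    show "smooth_along (\<psi> ` W) x (\<lambda>q. ?E (inv_into W \<psi> q))"
      by (intro smooth_along_inv_into smooth_on_scaleR smooth_\<phi> smooth_on_frechet_derivative
          smooth_X open_domain)
    have "?E u \<in> tangent_space x (\<psi> u) \<and> \<langle>?E u, ?E u\<rangle> = \<epsilon>" if "u \<in> W" for u
    proof
      have "?E u = dX u (\<phi> (fst u) *\<^sub>R (1, 0))"
        unfolding linear_cmul[OF linear_dX[OF that]] ..
      then show "?E u \<in> tangent_space x (\<psi> u)"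
        unfolding tangent_space_eq[OF that] by blast
      show "\<langle>?E u, ?E u\<rangle> = \<epsilon>"
        using in_data(3)[OF that]
        by (simp add: mink.scaleR_left mink.scaleR_right dX_eq[OF that] mink_L
            dY_1_products[OF that] power2_eq_square)
    qed
    then show "\<forall>q\<in>\<psi> ` W. ?E (inv_into W \<psi> q) \<in> tangent_space x q \<and>
        \<langle>?E (inv_into W \<psi> q), ?E (inv_into W \<psi> q)\<rangle> = \<epsilon>"
      using inv by (metis (no_types, lifting) imageE)
    show "\<forall>(s, t)\<in>W. tangential_part x (\<psi> (s, t)) (L k0) = \<phi> s *\<^sub>R ?E (inv_into W \<psi> (\<psi> (s, t)))"
      using tangential_part_k0 inv by (force simp: power2_eq_square)
  qed
qed

end

section \<open>Lorentz maps and null frames\<close>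

lemma lorentz_map_inverse:
  assumes "lorentz_map L"
  obtains M where "lorentz_map M" "\<And>v. M (L v) = v" "\<And>v. L (M v) = v"
proof -
  obtain M where M: "linear M" "\<And>v. M (L v) = v" "\<And>v. L (M v) = v"
    using linear_injective_isomorphism[OF _ lorentz_map_inj[OF assms]] assms
    by (auto simp: lorentz_map_def)
  have "\<langle>M u, M v\<rangle> = \<langle>u, v\<rangle>" for u v
    using assms M(3) unfolding lorentz_map_def by metis
  then show thesis
    using that M by (auto simp: lorentz_map_def)
qed

text \<open>The Euclidean cross product with its third coordinate negated, so that its
  \<open>mink\<close> product with a vector \<open>w\<close> is the determinant of \<open>u\<close>,
  \<open>v\<close>, \<open>w\<close>.\<close>

definition lorentz_cross :: "real^3 \<Rightarrow> real^3 \<Rightarrow> real^3" where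
  "lorentz_cross u v = vector [u$2 * v$3 - u$3 * v$2, u$3 * v$1 - u$1 * v$3, u$2 * v$1 - u$1 * v$2]"

lemma lorentz_cross_products:
  "\<langle>lorentz_cross u v, u\<rangle> = 0" "\<langle>lorentz_cross u v, v\<rangle> = 0"
  "\<langle>lorentz_cross u v, lorentz_cross u v\<rangle> = \<langle>u,v\<rangle>\<^sup>2 - \<langle>u,u\<rangle> * \<langle>v,v\<rangle>"
  by (simp_all add: lorentz_cross_def mink_def algebra_simps power2_eq_square)

text \<open>The vectors \<open>k0\<close>, \<open>(0, 1, - \<epsilon>)\<close>,
  \<open>(1, - \<epsilon>, 1)\<close> are \<open>k0\<close> and the values of
  \<open>null_curve\<close> and \<open>space_curve\<close> for \<open>\<gamma>0 = 0\<close>. They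
  have the same Gram matrix as \<open>k\<close>, \<open>g\<close> and the cross product
  \<open>e\<close>, so the linear map matching them is an isometry.\<close>

lemma null_frame:
  assumes "\<epsilon> \<in> {- 1, 1}" "\<langle>k,k\<rangle> = 0" "\<langle>g,g\<rangle> = 0" "\<langle>k,g\<rangle> = \<epsilon>"
  obtains L where "lorentz_map L" "L k0 = k" "L (vector [0, 1, - \<epsilon>]) = g"
proof -
  define e where "e = lorentz_cross k g"
  have e: "\<langle>e,k\<rangle> = 0" "\<langle>e,g\<rangle> = 0" "\<langle>e,e\<rangle> = 1"
    unfolding e_def lorentz_cross_products using assms by auto
  \<comment> \<open>Coefficients of \<open>v\<close> in the first frame: passing to the dual basis
    exchanges the two null vectors, up to the factor \<epsilon>, and fixes the third.\<close>
  define L where "L v = (\<epsilon> * \<langle>v, vector [0, 1, - \<epsilon>]\<rangle>) *\<^sub>R k + (\<epsilon> * \<langle>v, k0\<rangle>) *\<^sub>R g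
      + \<langle>v, vector [1, - \<epsilon>, 1]\<rangle> *\<^sub>R e" for v
  have "linear L"
    by (rule linearI) (simp_all add: L_def mink.add_left mink.scaleR_left algebra_simps)
  moreover have "\<langle>L u, L v\<rangle> = \<langle>u,v\<rangle>" for u v
  proof -
    have "\<langle>L u, L v\<rangle> = \<epsilon> * (\<langle>u, vector [0, 1, - \<epsilon>]\<rangle> * \<langle>v, k0\<rangle> + \<langle>u, k0\<rangle> * \<langle>v, vector [0, 1, - \<epsilon>]\<rangle>)
        + \<langle>u, vector [1, - \<epsilon>, 1]\<rangle> * \<langle>v, vector [1, - \<epsilon>, 1]\<rangle>"
      unfolding L_def
      using assms e by (auto simp: mink.add_left mink.add_right mink.scaleR_left mink.scaleR_right
          mink_commute[of k e] mink_commute[of g e] mink_commute[of g k])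
    also have "\<dots> = \<langle>u,v\<rangle>"
      using assms(1) by (auto simp: mink_def algebra_simps)
    finally show ?thesis .
  qed
  moreover have "L k0 = k" "L (vector [0, 1, - \<epsilon>]) = g"
    using assms(1) by (auto simp: L_def mink_def)
  ultimately show thesis
    using that[of L] by (simp add: lorentz_map_def)
qed

lemma constant_along_fst:
  fixes F :: "real \<times> real \<Rightarrow> 'b::real_normed_vector"
  assumes "convex I" "s \<in> I" "s' \<in> I"
    and "\<And>s. s \<in> I \<Longrightarrow> (F has_derivative F' (s, t)) (at (s, t))"
    and "\<And>s. s \<in> I \<Longrightarrow> F' (s, t) (1, 0) = 0"
  shows "F (s, t) = F (s', t)"
proof -
  have "((\<lambda>s. F (s, t)) has_derivative (\<lambda>h. 0)) (at s within I)" if "s \<in> I" for s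
  proof -
    have "((\<lambda>s. (s, t)) has_derivative (\<lambda>h. (h, 0))) (at s)"
      by (auto intro!: derivative_eq_intros)
    from has_derivative_compose[OF this assms(4)[OF that]]
    have "((\<lambda>s. F (s, t)) has_derivative (\<lambda>h. F' (s, t) (h, 0))) (at s)" .
    moreover have "F' (s, t) (h, 0) = 0" for h
      using linear_cmul[OF has_derivative_linear[OF assms(4)[OF that]], of h "(1, 0)"]
      by (simp add: assms(5)[OF that])
    ultimately show ?thesis
      by (simp add: has_derivative_at_withinI)
  qed
  then show ?thesis
    using has_derivative_zero_constant[OF assms(1)] assms(2,3) by metis
qed

lemma constant_along_snd:
  fixes F :: "real \<times> real \<Rightarrow> 'b::real_normed_vector"
  assumes "convex J" "t \<in> J" "t' \<in> J"
    and "\<And>t. t \<in> J \<Longrightarrow> (F has_derivative F' (s, t)) (at (s, t))"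
    and "\<And>t. t \<in> J \<Longrightarrow> F' (s, t) (0, 1) = 0"
  shows "F (s, t) = F (s, t')"
proof -
  have "((\<lambda>t. F (s, t)) has_derivative (\<lambda>h. 0)) (at t within J)" if "t \<in> J" for t
  proof -
    have "((\<lambda>t. (s, t)) has_derivative (\<lambda>h. (0, h))) (at t)"
      by (auto intro!: derivative_eq_intros)
    from has_derivative_compose[OF this assms(4)[OF that]]
    have "((\<lambda>t. F (s, t)) has_derivative (\<lambda>h. F' (s, t) (0, h))) (at t)" .
    moreover have "F' (s, t) (0, h) = 0" for h
      using linear_cmul[OF has_derivative_linear[OF assms(4)[OF that]], of h "(0, 1)"]
      by (simp add: assms(5)[OF that])
    ultimately show ?thesis
      by (simp add: has_derivative_at_withinI)
  qed
  then show ?thesis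
    using has_derivative_zero_constant[OF assms(1)] assms(2,3) by metis
qed

section \<open>Coordinates adapted to a canonical principal direction\<close>

locale cpd_chart = oriented_chart M x N W \<psi>
  for M :: "'a::topological_space set" and x N :: "'a \<Rightarrow> real^3"
    and W :: "(real \<times> real) set" and \<psi> :: "real \<times> real \<Rightarrow> 'a" +
  fixes k :: "real^3" and \<epsilon> :: real and k1 :: "'a \<Rightarrow> real"
  assumes k_null: "\<langle>k,k\<rangle> = 0"
    and eps: "\<epsilon> \<in> {- 1, 1}"
    and normal_product: "\<And>q. q \<in> \<psi> ` W \<Longrightarrow> \<langle>N q, N q\<rangle> = - \<epsilon>"
    and k_normal: "\<And>q. q \<in> \<psi> ` W \<Longrightarrow> \<langle>k, N q\<rangle> \<noteq> 0"
    and principal: "\<And>q. q \<in> \<psi> ` W \<Longrightarrow>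
      shape_operator x N q (tangential_part x q k) = k1 q *\<^sub>R tangential_part x q k"
    and k1_nonzero: "\<And>q. q \<in> \<psi> ` W \<Longrightarrow> k1 q \<noteq> 0"
begin

definition f where "f u = \<langle>k, n u\<rangle>"
definition K where "K u = k + (\<epsilon> * f u) *\<^sub>R n u"
definition G where "G u = (1 / (2 * (f u)\<^sup>2)) *\<^sub>R k + (\<epsilon> / f u) *\<^sub>R n u"

lemma eps2: "\<epsilon> * \<epsilon> = 1" "\<epsilon>\<^sup>2 = 1" "\<epsilon> \<noteq> 0"
  using eps by auto

lemma f_nonzero: "u \<in> W \<Longrightarrow> f u \<noteq> 0"
  using k_normal by (auto simp: f_def)

lemma nn: "u \<in> W \<Longrightarrow> \<langle>n u, n u\<rangle> = - \<epsilon>"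
  using normal_product by auto

lemma tangential_part_k: "u \<in> W \<Longrightarrow> tangential_part x (\<psi> u) k = K u"
  using eps by (auto simp: tangential_part_eq K_def f_def nn simp del: o_apply)

lemma smooth_f: "smooth_on W f"
  unfolding f_def[abs_def]
  by (intro smooth_on_bilinear[OF mink.bounded_bilinear_axioms] smooth_n smooth_on_const open_domain)

lemma smooth_G: "smooth_on W G"
  unfolding G_def[abs_def] power2_eq_square using f_nonzero
  by (intro smooth_on_add smooth_on_scaleR smooth_on_divide smooth_on_mult smooth_on_const smooth_f
      smooth_n open_domain) auto

abbreviation df where "df u \<equiv> frechet_derivative f (at u)"
abbreviation dG where "dG u \<equiv> frechet_derivative G (at u)"

lemma f_has_derivative: "u \<in> W \<Longrightarrow> (f has_derivative df u) (at u)"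
  by (rule smooth_on_has_derivative[OF smooth_f])

lemma G_has_derivative: "u \<in> W \<Longrightarrow> (G has_derivative dG u) (at u)"
  by (rule smooth_on_has_derivative[OF smooth_G])

lemma df_eq: "u \<in> W \<Longrightarrow> df u v = \<langle>k, dn u v\<rangle>"
  using frechet_derivative_at[OF mink.FDERIV[OF has_derivative_const n_has_derivative], of u k]
  by (simp add: f_def[abs_def] mink.zero_left) metis

lemma dG_eq:
  assumes "u \<in> W"
  shows "dG u v = (- df u v / (f u)^3) *\<^sub>R k + (\<epsilon> / f u) *\<^sub>R dn u v - (\<epsilon> * df u v / (f u)\<^sup>2) *\<^sub>R n u"
proof -
  have 1: "((\<lambda>u. 1 / (2 * (f u)\<^sup>2)) has_derivative (\<lambda>v. - df u v / (f u)^3)) (at u)"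
    using f_nonzero[OF assms]
    by (auto intro!: derivative_eq_intros f_has_derivative[OF assms]
        simp: field_simps power2_eq_square power3_eq_cube fun_eq_iff)
  have 2: "((\<lambda>u. \<epsilon> / f u) has_derivative (\<lambda>v. - (\<epsilon> * df u v / (f u)\<^sup>2))) (at u)"
    using f_nonzero[OF assms]
    by (auto intro!: derivative_eq_intros f_has_derivative[OF assms]
        simp: field_simps power2_eq_square fun_eq_iff)
  have "(G has_derivative (\<lambda>v. (- df u v / (f u)^3) *\<^sub>R k
     + ((\<epsilon> / f u) *\<^sub>R dn u v + (- (\<epsilon> * df u v / (f u)\<^sup>2)) *\<^sub>R n u))) (at u)"
    unfolding G_def[abs_def]
    by (intro has_derivative_add has_derivative_scaleR_left has_derivative_scaleR 1 2
        n_has_derivative assms)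
  then show ?thesis
    by (simp add: frechet_derivative_at[symmetric])
qed

lemma K_products:
  assumes "u \<in> W"
  shows "\<langle>k, K u\<rangle> = \<epsilon> * (f u)\<^sup>2" "\<langle>n u, K u\<rangle> = 0"
  using nn[OF assms] eps
  by (auto simp: K_def mink.add_right mink.scaleR_right k_null f_def power2_eq_square
      mink_commute)

lemma G_products:
  assumes "u \<in> W"
  shows "\<langle>k, G u\<rangle> = \<epsilon>" "\<langle>G u, G u\<rangle> = 0"
proof -
  have f: "\<langle>k, n u\<rangle> = f u" "\<langle>n u, k\<rangle> = f u"
    by (simp_all add: f_def mink_commute)
  show "\<langle>k, G u\<rangle> = \<epsilon>"
    using f_nonzero[OF assms] f by (simp add: G_def mink.add_right mink.scaleR_right k_null del: o_apply)
  show "\<langle>G u, G u\<rangle> = 0"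
    using f_nonzero[OF assms] f nn[OF assms] eps
    by (auto simp: G_def mink.add_right mink.add_left mink.scaleR_right mink.scaleR_left k_null
        power2_eq_square simp del: o_apply)
qed

lemma K_eq_G: "u \<in> W \<Longrightarrow> (1 / (f u)\<^sup>2) *\<^sub>R K u = (1 / (2 * (f u)\<^sup>2)) *\<^sub>R k + G u"
  using f_nonzero[of u]
  by (simp add: K_def G_def algebra_simps power2_eq_square flip: scaleR_left.add)

text \<open>The rates of change of \<open>n\<close> and \<open>f\<close> along \<open>K u\<close>
  are both proportional to \<open>k1\<close>. Inserted in \<open>dG_eq\<close> they leave a multiple
  of \<open>k + (\<epsilon> * f u) *\<^sub>R n u - K u\<close>, which is 0.\<close>

lemma principal_direction:
  assumes "u \<in> W" "dX u a = K u"
  shows "dn u a = - k1 (\<psi> u) *\<^sub>R K u" "df u a = - k1 (\<psi> u) * \<epsilon> * (f u)\<^sup>2" "dG u a = 0"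
proof -
  have "shape_operator x N (\<psi> u) (dX u a) = k1 (\<psi> u) *\<^sub>R dX u a"
    using principal[of "\<psi> u"] assms by (simp add: tangential_part_k)
  then show 1: "dn u a = - k1 (\<psi> u) *\<^sub>R K u"
    using shape_operator_eq[OF assms(1), of a] assms(2) by (metis minus_minus scaleR_minus_left)
  show 2: "df u a = - k1 (\<psi> u) * \<epsilon> * (f u)\<^sup>2"
    by (simp add: df_eq[OF assms(1)] 1 mink.scaleR_right K_products[OF assms(1)] mink.minus_right)
  define c where "c = k1 (\<psi> u)"
  have "dG u a = (c * \<epsilon> / f u) *\<^sub>R k - (c * \<epsilon> / f u) *\<^sub>R K u + (\<epsilon> * \<epsilon> * c) *\<^sub>R n u"
    using f_nonzero[OF assms(1)]
    by (simp add: dG_eq[OF assms(1)] 1 2 power2_eq_square power3_eq_cube algebra_simps flip: c_def)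
  also have "\<dots> = 0"
    using f_nonzero[OF assms(1)] eps2 by (simp add: K_def algebra_simps)
  finally show "dG u a = 0" .
qed

text \<open>A tangent vector orthogonal to \<open>k\<close> is orthogonal to the eigenvector
  \<open>K u\<close>. By symmetry its image under the shape operator is so too, and, being tangent,
  has the same product with \<open>k\<close> as with \<open>K u\<close>.\<close>

lemma df_orthogonal:
  assumes "u \<in> W" "\<langle>k, dX u b\<rangle> = 0"
  shows "df u b = 0"
proof -
  obtain a where a: "K u = dX u a"
    using tangent_obtain[OF assms(1) K_products(2)[OF assms(1)]] .
  have "\<langle>K u, dX u b\<rangle> = 0"
    using n_orthogonal[OF assms(1), of b] by (simp add: K_def mink.add_left mink.scaleR_left assms(2))
  then have "\<langle>dn u a, dX u b\<rangle> = 0"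
    by (simp add: principal_direction(1)[OF assms(1) a[symmetric]] mink.scaleR_left mink.minus_left)
  then have "\<langle>K u, dn u b\<rangle> = 0"
    unfolding shape_operator_symmetric[OF assms(1), of a b] a by (simp add: mink_commute)
  then have "\<langle>k, dn u b\<rangle> = 0"
    using n_orthogonal_dn[OF assms(1), of b] by (simp add: K_def mink.add_left mink.scaleR_left)
  then show ?thesis
    by (simp add: df_eq[OF assms(1)])
qed

end

text \<open>The new domain is a product of intervals, so that a function constant along one family
  of coordinate lines depends on the other coordinate only.\<close>

lemma local_param_reparametrize:
  assumes "local_param x W \<psi>" "smooth_on W \<Phi>" "u0 \<in> W" "inj (frechet_derivative \<Phi> (at u0))"
  obtains I J g where "open I" "is_interval I" "open J" "is_interval J" "\<Phi> u0 \<in> I \<times> J"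
    "g ` (I \<times> J) \<subseteq> W" "g (\<Phi> u0) = u0" "\<And>y. y \<in> I \<times> J \<Longrightarrow> \<Phi> (g y) = y"
    "local_param x (I \<times> J) (\<psi> \<circ> g)"
proof -
  obtain U V g where g: "open U" "U \<subseteq> W" "u0 \<in> U" "open V" "homeomorphism U V \<Phi> g" "smooth_on V g"
    using smooth_local_inverse[OF local_paramD(1)[OF assms(1)] assms(3,2,4)] by metis
  have "\<Phi> u0 \<in> V"
    using g(3,5) by (auto simp: homeomorphism_def)
  then obtain A B where AB: "open A" "open B" "\<Phi> u0 \<in> A \<times> B" "A \<times> B \<subseteq> V"
    using open_prod_elim[OF g(4)] by metis
  obtain d e where de: "d > 0" "e > 0" "ball (fst (\<Phi> u0)) d \<subseteq> A" "ball (snd (\<Phi> u0)) e \<subseteq> B"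
    using AB(1-3) by (metis mem_Times_iff open_contains_ball)
  define I where "I = ball (fst (\<Phi> u0)) d"
  define J where "J = ball (snd (\<Phi> u0)) e"
  have IJ: "open I" "is_interval I" "open J" "is_interval J" "\<Phi> u0 \<in> I \<times> J" "I \<times> J \<subseteq> V"
    using de AB(4) by (auto simp: I_def J_def mem_Times_iff is_interval_ball_real)
  have h: "homeomorphism V U g \<Phi>"
    using g(5) by (rule homeomorphism_symD)
  then have gim: "g ` (I \<times> J) \<subseteq> U"
    using IJ(6) by (auto simp: homeomorphism_def)
  have \<Phi>g: "\<Phi> (g y) = y" if "y \<in> V" for y
    using h that by (auto simp: homeomorphism_def)
  have h': "homeomorphism (I \<times> J) (g ` (I \<times> J)) g \<Phi>"
    using h IJ(6) gim by (rule homeomorphism_of_subsets) auto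
  have "openin (top_of_set U) (g ` (I \<times> J))"
    using IJ by (intro homeomorphism_imp_open_map[OF h]) (auto intro!: open_openin_trans open_Times g(4))
  then have og: "open (g ` (I \<times> J))"
    using g(1) openin_open_trans by blast
  have lp: "local_param x (g ` (I \<times> J)) \<psi>"
    using gim g(2) by (intro local_param_subset[OF assms(1) og]) auto
  have "local_param x (I \<times> J) (\<psi> \<circ> g)"
    unfolding local_param_def
  proof (intro conjI ballI)
    show "open (I \<times> J)"
      by (intro open_Times IJ)
    show "open ((\<psi> \<circ> g) ` (I \<times> J))"
      using local_paramD(2)[OF lp] by (simp add: image_comp)
    obtain \<psi>' where "homeomorphism (g ` (I \<times> J)) (\<psi> ` g ` (I \<times> J)) \<psi> \<psi>'"
      using lp by (auto simp: local_param_def)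
    from homeomorphism_compose[OF h' this]
    show "\<exists>\<psi>'. homeomorphism (I \<times> J) ((\<psi> \<circ> g) ` (I \<times> J)) (\<psi> \<circ> g) \<psi>'"
      by (auto simp: image_comp)
    have sg: "smooth_on (I \<times> J) g"
      by (rule smooth_on_subset[OF g(6) IJ(6)])
    have "smooth_on (I \<times> J) (\<lambda>y. (x \<circ> \<psi>) (g y))"
      using gim g(2)
      by (intro smooth_on_compose[where f = "x \<circ> \<psi>" and g = g, OF open_Times[OF IJ(1,3)]
            local_paramD(1)[OF assms(1)] sg local_paramD(3)[OF assms(1)]]) auto
    then show "smooth_on (I \<times> J) (x \<circ> (\<psi> \<circ> g))"
      by (simp add: comp_def)
    fix y assume y: "y \<in> I \<times> J"
    have gy: "g y \<in> W"
      using gim g(2) y by auto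
    have dg: "(g has_derivative frechet_derivative g (at y)) (at y)"
      by (rule smooth_on_has_derivative[OF sg y])
    have "((\<lambda>y. (x \<circ> \<psi>) (g y)) has_derivative
        (\<lambda>v. frechet_derivative (x \<circ> \<psi>) (at (g y)) (frechet_derivative g (at y) v))) (at y)"
      by (rule has_derivative_compose[OF dg smooth_on_has_derivative[OF local_paramD(3)[OF assms(1)] gy]])
    then have dX: "frechet_derivative (x \<circ> (\<psi> \<circ> g)) (at y)
        = (\<lambda>v. frechet_derivative (x \<circ> \<psi>) (at (g y)) (frechet_derivative g (at y) v))"
      unfolding comp_def by (rule frechet_derivative_at[symmetric])
    \<comment> \<open>Differentiating \<open>\<Phi> (g y) = y\<close> gives the derivative of
      \<open>g\<close> a left inverse, hence injectivity.\<close>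
    have "((\<lambda>y. \<Phi> (g y)) has_derivative
        (\<lambda>v. frechet_derivative \<Phi> (at (g y)) (frechet_derivative g (at y) v))) (at y)"
      by (rule has_derivative_compose[OF dg smooth_on_has_derivative[OF assms(2) gy]])
    then have "((\<lambda>y. y) has_derivative
        (\<lambda>v. frechet_derivative \<Phi> (at (g y)) (frechet_derivative g (at y) v))) (at y)"
      by (rule has_derivative_transform_within_open[OF _ g(4)]) (use y IJ(6) \<Phi>g in auto)
    then have "frechet_derivative \<Phi> (at (g y)) (frechet_derivative g (at y) v) = v" for v
      using has_derivative_unique[OF has_derivative_ident] by metis
    then have "inj (frechet_derivative g (at y))"
      by (metis injI)
    then show "inj (frechet_derivative (x \<circ> (\<psi> \<circ> g)) (at y))"
      unfolding dX using inj_compose[OF local_paramD(6)[OF assms(1) gy]] by (simp add: comp_def)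
  qed
  then show thesis
    using that[of I J g] IJ gim g(2) \<Phi>g h' g(3,5) by (auto simp: homeomorphism_def subset_iff)
qed

text \<open>\<open>Linv\<close> carries the surface to the standard position of the family. There
  \<open>G\<close> is null with product \<epsilon> with \<open>k0\<close>, which leaves the sign of
  its second coordinate open; the last assumption selects the positive root.\<close>

locale adapted_chart = cpd_chart M x N "I \<times> J" \<psi> k \<epsilon> k1
  for M :: "'a::topological_space set" and x N :: "'a \<Rightarrow> real^3"
    and I J :: "real set" and \<psi> :: "real \<times> real \<Rightarrow> 'a" and k :: "real^3" and \<epsilon> :: real
    and k1 :: "'a \<Rightarrow> real" +
  fixes e :: "real^3" and c :: real and L Linv :: "real^3 \<Rightarrow> real^3"
  assumes intervals: "open I" "is_interval I" "open J" "is_interval J"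
    and fst_eq: "\<And>u. u \<in> I \<times> J \<Longrightarrow> fst u = \<epsilon> * \<langle>k, x (\<psi> u)\<rangle>"
    and snd_eq: "\<And>u. u \<in> I \<times> J \<Longrightarrow> snd u = \<langle>e, x (\<psi> u) - (fst u - c) *\<^sub>R G u\<rangle>"
    and e_k: "\<langle>e,k\<rangle> = 0"
    and L: "lorentz_map L" "L k0 = k" and Linv: "lorentz_map Linv" "\<And>v. L (Linv v) = v" "\<And>v. Linv (L v) = v"
    and positive: "\<And>u. u \<in> I \<times> J \<Longrightarrow> 0 < Linv (G u) $ 2"
begin

lemma dX_products:
  assumes "u \<in> I \<times> J"
  shows "\<epsilon> * \<langle>k, dX u v\<rangle> = fst v"
    "\<langle>e, dX u v - (fst u - c) *\<^sub>R dG u v - fst v *\<^sub>R G u\<rangle> = snd v"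
proof -
  have "((\<lambda>u. \<epsilon> * \<langle>k, X u\<rangle>) has_derivative (\<lambda>v. \<epsilon> * (\<langle>k, dX u v\<rangle> + \<langle>0, X u\<rangle>))) (at u)"
    by (intro has_derivative_mult_right mink.FDERIV has_derivative_const X_has_derivative assms)
  then have "(fst has_derivative (\<lambda>v. \<epsilon> * (\<langle>k, dX u v\<rangle> + \<langle>0, X u\<rangle>))) (at u)"
    by (rule has_derivative_transform_within_open[OF _ open_domain assms]) (simp add: fst_eq)
  from has_derivative_unique[OF this has_derivative_fst[OF has_derivative_ident]]
  show "\<epsilon> * \<langle>k, dX u v\<rangle> = fst v"
    by (metis add.right_neutral mink.zero_left)
  have "((\<lambda>u. \<langle>e, X u - (fst u - c) *\<^sub>R G u\<rangle>) has_derivative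
     (\<lambda>v. \<langle>e, dX u v - ((fst u - c) *\<^sub>R dG u v + (fst v - 0) *\<^sub>R G u)\<rangle> + \<langle>0, X u - (fst u - c) *\<^sub>R G u\<rangle>)) (at u)"
    by (intro mink.FDERIV has_derivative_const has_derivative_diff has_derivative_scaleR
        has_derivative_fst has_derivative_ident X_has_derivative G_has_derivative assms)
  then have "(snd has_derivative
     (\<lambda>v. \<langle>e, dX u v - ((fst u - c) *\<^sub>R dG u v + (fst v - 0) *\<^sub>R G u)\<rangle> + \<langle>0, X u - (fst u - c) *\<^sub>R G u\<rangle>)) (at u)"
    by (rule has_derivative_transform_within_open[OF _ open_domain assms]) (simp add: snd_eq[symmetric])
  from fun_cong[OF has_derivative_unique[OF this has_derivative_snd[OF has_derivative_ident]], of v]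
  show "\<langle>e, dX u v - (fst u - c) *\<^sub>R dG u v - fst v *\<^sub>R G u\<rangle> = snd v"
    by (simp add: mink.zero_left diff_diff_add)
qed

text \<open>Let \<open>a\<close> be the coordinates of \<open>K u\<close>. The product with
  \<open>k\<close> gives \<open>fst a = (f u)\<^sup>2\<close>. In the derivative of the second
  coordinate the term with \<open>dG\<close> vanishes, and
  \<open>K u - (f u)\<^sup>2 *\<^sub>R G u\<close> is half of \<open>k\<close>, which is orthogonal
  to \<open>e\<close>; so \<open>snd a = 0\<close>. Dividing by \<open>(f u)\<^sup>2\<close>
  transfers \<open>principal_direction\<close> to the first coordinate field.\<close>

lemma coordinate_fields:
  assumes "u \<in> I \<times> J"
  shows "dX u (1, 0) = (1 / (2 * (f u)\<^sup>2)) *\<^sub>R k + G u" "dG u (1, 0) = 0"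
    "df u (1, 0) = - k1 (\<psi> u) * \<epsilon>" "df u (0, 1) = 0" "\<langle>k, dX u (0, 1)\<rangle> = 0"
proof -
  note f0 = f_nonzero[OF assms]
  obtain a where a: "dX u a = K u"
    using tangent_obtain[OF assms K_products(2)[OF assms]] by metis
  note pd = principal_direction[OF assms a]
  have "fst a = (f u)\<^sup>2"
    using dX_products(1)[OF assms, of a] eps by (auto simp: a K_products[OF assms])
  moreover have "K u - (f u)\<^sup>2 *\<^sub>R G u = (1 / 2) *\<^sub>R k"
    using f0 by (simp add: K_def G_def vec_eq_iff field_simps power2_eq_square)
  ultimately have "snd a = 0"
    using dX_products(2)[OF assms, of a] by (simp add: a pd(3) mink.scaleR_right e_k)
  with \<open>fst a = (f u)\<^sup>2\<close> have a_eq: "a = (f u)\<^sup>2 *\<^sub>R (1, 0)"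
    by (simp add: prod_eq_iff)
  have cancel: "F (1, 0) = (1 / (f u)\<^sup>2) *\<^sub>R F a" if "linear F" for F :: "real \<times> real \<Rightarrow> 'b::real_vector"
    using linear_cmul[OF that, of "(f u)\<^sup>2" "(1, 0)"] f0 by (simp add: a_eq)
  show "dX u (1, 0) = (1 / (2 * (f u)\<^sup>2)) *\<^sub>R k + G u"
    by (simp add: cancel[OF linear_dX[OF assms]] a K_eq_G[OF assms])
  show "dG u (1, 0) = 0"
    by (simp add: cancel[OF has_derivative_linear[OF G_has_derivative[OF assms]]] pd)
  show "df u (1, 0) = - k1 (\<psi> u) * \<epsilon>"
    using f0 by (simp add: cancel[OF has_derivative_linear[OF f_has_derivative[OF assms]]] pd)
  show k: "\<langle>k, dX u (0, 1)\<rangle> = 0"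
    using dX_products(1)[OF assms, of "(0, 1)"] eps2 by simp
  show "df u (0, 1) = 0"
    by (rule df_orthogonal[OF assms k])
qed

text \<open>Since \<open>f\<close> is independent of \<open>t\<close> and \<open>G\<close> of
  \<open>s\<close>, their slices give \<open>\<phi>\<close> and \<open>\<gamma>\<close>. Integrating
  the \<open>s\<close>-derivative of \<open>x\<close> leaves a curve in \<open>t\<close> whose
  velocity is orthogonal to \<open>k\<close> and \<open>\<gamma>\<close>, hence a multiple of the
  image of \<open>space_curve\<close>.\<close>

theorem adapted_chart_family:
  assumes "s0 \<in> I" "t0 \<in> J"
  shows "\<exists>\<phi> \<gamma>0 b a. family_data \<epsilon> \<phi> \<gamma>0 b s0 t0 I J \<and>
     (\<forall>u\<in>I \<times> J. x (\<psi> u) = L (family_map \<epsilon> \<phi> \<gamma>0 b s0 t0 u) + a)"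
proof -
  have conv: "convex I" "convex J"
    using intervals is_interval_convex by auto
  have bLinv: "bounded_linear Linv"
    using Linv(1) by (simp add: lorentz_map_def linear_conv_bounded_linear)
  have linL: "linear L"
    using L(1) by (simp add: lorentz_map_def)
  have Linv_k: "Linv k = k0"
    using Linv(3)[of k0] L(2) by simp
  have mink_Linv: "\<langle>Linv v, Linv w\<rangle> = \<langle>v,w\<rangle>" for v w
    using Linv(1) by (simp add: lorentz_map_def)
  define \<phi> where "\<phi> s = f (s, t0)" for s
  define \<gamma> where "\<gamma> t = G (s0, t)" for t
  define \<gamma>0 where "\<gamma>0 t = Linv (\<gamma> t) $ 1" for t
  have f_eq: "f (s, t) = \<phi> s" if "s \<in> I" "t \<in> J" for s t
    unfolding \<phi>_def using that assms
    by (intro constant_along_snd[OF conv(2), where F' = df] f_has_derivative coordinate_fields) auto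
  have G_eq: "G (s, t) = \<gamma> t" if "s \<in> I" "t \<in> J" for s t
    unfolding \<gamma>_def using that assms
    by (intro constant_along_fst[OF conv(1), where F' = dG] G_has_derivative coordinate_fields) auto
  have smooth_slice_s: "smooth_on I (\<lambda>s. F (s, t0))" if "smooth_on (I \<times> J) F"
    for F :: "real \<times> real \<Rightarrow> 'c::real_normed_vector"
    using assms
    by (intro smooth_on_compose[where g = "\<lambda>s. (s, t0)", OF intervals(1) open_domain _ that]
        smooth_on_Pair smooth_on_const smooth_on_linear bounded_linear_ident intervals) auto
  have smooth_slice_t: "smooth_on J (\<lambda>t. F (s0, t))" if "smooth_on (I \<times> J) F"
    for F :: "real \<times> real \<Rightarrow> 'c::real_normed_vector"
    using assms
    by (intro smooth_on_compose[where g = "\<lambda>t. (s0, t)", OF intervals(3) open_domain _ that]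
        smooth_on_Pair smooth_on_const smooth_on_linear bounded_linear_ident intervals) auto
  have smooth_\<phi>: "smooth_on I \<phi>"
    unfolding \<phi>_def[abs_def] by (rule smooth_slice_s[OF smooth_f])
  have smooth_\<gamma>: "smooth_on J \<gamma>"
    unfolding \<gamma>_def[abs_def] by (rule smooth_slice_t[OF smooth_G])
  have \<phi>0: "\<phi> s \<noteq> 0" if "s \<in> I" for s
    using f_nonzero[of "(s, t0)"] that assms by (simp add: \<phi>_def)
  have deriv_\<phi>: "deriv \<phi> s \<noteq> 0" if "s \<in> I" for s
  proof -
    have st: "(s, t0) \<in> I \<times> J"
      using that assms by simp
    have "((\<lambda>s. (s, t0)) has_derivative (\<lambda>h. (h, 0))) (at s)"
      by (auto intro!: derivative_eq_intros)
    from has_derivative_compose[OF this f_has_derivative[OF st]]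
    have "(\<phi> has_derivative (\<lambda>h. df (s, t0) (h, 0))) (at s)"
      unfolding \<phi>_def[abs_def] .
    moreover have "df (s, t0) (h, 0) = (- k1 (\<psi> (s, t0)) * \<epsilon>) * h" for h
      using linear_cmul[OF has_derivative_linear[OF f_has_derivative[OF st]], of h "(1, 0)"]
      by (simp add: coordinate_fields(3)[OF st])
    ultimately have "(\<phi> has_real_derivative - k1 (\<psi> (s, t0)) * \<epsilon>) (at s)"
      unfolding has_field_derivative_def by (simp only:)
    then show ?thesis
      using k1_nonzero[of "\<psi> (s, t0)"] st eps2 by (auto dest!: DERIV_imp_deriv)
  qed
  have \<gamma>_products: "\<langle>k, \<gamma> t\<rangle> = \<epsilon>" "\<langle>\<gamma> t, \<gamma> t\<rangle> = 0" if "t \<in> J" for t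
    unfolding \<gamma>_def using that assms by (auto intro!: G_products)
  have Linv_\<gamma>: "Linv (\<gamma> t) = null_curve \<epsilon> \<gamma>0 t" "- 2 * \<epsilon> * \<gamma>0 t + 1 \<ge> 0" if "t \<in> J" for t
  proof -
    define v where "v = Linv (\<gamma> t)"
    have "\<langle>k0, v\<rangle> = \<epsilon>" "\<langle>v, v\<rangle> = 0"
      using \<gamma>_products[OF that] unfolding v_def Linv_k[symmetric] mink_Linv by auto
    then have v3: "v $ 3 = v $ 1 - \<epsilon>" and sq: "(v $ 2)\<^sup>2 = - 2 * \<epsilon> * v $ 1 + 1"
      using eps by (auto simp: mink_def power2_eq_square algebra_simps)
    show "- 2 * \<epsilon> * \<gamma>0 t + 1 \<ge> 0"
      unfolding \<gamma>0_def v_def[symmetric] sq[symmetric] by simp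
    \<comment> \<open>Of the two roots allowed by \<open>sq\<close>, this picks the one that
      \<open>sqrt\<close> returns.\<close>
    have "v $ 2 > 0"
      using positive[of "(s0, t)"] that assms by (simp add: v_def \<gamma>_def)
    then have "sqrt (- 2 * \<epsilon> * v $ 1 + 1) = v $ 2"
      by (intro real_sqrt_unique sq) simp
    then show "Linv (\<gamma> t) = null_curve \<epsilon> \<gamma>0 t"
      unfolding null_curve_def \<gamma>0_def v_def[symmetric] by (simp add: vec_eq_iff forall_3 v3)
  qed
  define A where "A s = (LBINT \<xi>=s0..s. 1 / (2 * (\<phi> \<xi>)\<^sup>2))" for s
  have A: "(A has_vector_derivative 1 / (2 * (\<phi> s)\<^sup>2)) (at s)" if "s \<in> I" for s
    unfolding A_def[abs_def] using that assms intervals \<phi>0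
    by (intro has_vector_derivative_interval_integral[of I] continuous_intros
        smooth_on_continuous[OF smooth_\<phi>]) auto
  \<comment> \<open>The part of \<open>x\<close> not accounted for by integrating its
    \<open>s\<close>-derivative, hence constant in \<open>s\<close>; on the line
    \<open>s = s0\<close>, where \<open>A\<close> is 0, it equals \<open>D\<close>.\<close>
  define C where "C u = X u - A (fst u) *\<^sub>R k - fst u *\<^sub>R G u" for u
  define D where "D t = X (s0, t) - s0 *\<^sub>R \<gamma> t" for t
  have C_eq: "C (s, t) = D t" if "s \<in> I" "t \<in> J" for s t
  proof -
    have "C (s, t) = C (s0, t)"
    proof (rule constant_along_fst[OF conv(1) that(1) assms(1), where F' = "\<lambda>u v. dX u v
          - (fst v *\<^sub>R (1 / (2 * (\<phi> (fst u))\<^sup>2))) *\<^sub>R k - (fst u *\<^sub>R dG u v + fst v *\<^sub>R G u)"])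
      fix s assume s: "s \<in> I"
      then have st: "(s, t) \<in> I \<times> J"
        using that by simp
      have A': "((\<lambda>u. A (fst u)) has_derivative (\<lambda>v. fst v *\<^sub>R (1 / (2 * (\<phi> (fst (s, t)))\<^sup>2)))) (at (s, t))"
        using has_derivative_compose[OF has_derivative_fst[OF has_derivative_ident], of A _ "(s, t)" UNIV]
          A[OF s]
        by (simp add: has_vector_derivative_def)
      show "(C has_derivative (\<lambda>v. dX (s, t) v - (fst v *\<^sub>R (1 / (2 * (\<phi> (fst (s, t)))\<^sup>2))) *\<^sub>R k
          - (fst (s, t) *\<^sub>R dG (s, t) v + fst v *\<^sub>R G (s, t)))) (at (s, t))"
        unfolding C_def[abs_def]
        by (intro has_derivative_diff has_derivative_scaleR_left has_derivative_scaleR A'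
            has_derivative_fst has_derivative_ident X_has_derivative G_has_derivative st)
      show "dX (s, t) (1, 0) - (fst (1, 0) *\<^sub>R (1 / (2 * (\<phi> (fst (s, t)))\<^sup>2))) *\<^sub>R k
          - (fst (s, t) *\<^sub>R dG (s, t) (1, 0) + fst (1, 0) *\<^sub>R G (s, t)) = 0"
        using coordinate_fields(1,2)[OF st] f_eq[OF s that(2)] by simp
    qed
    also have "\<dots> = D t"
      by (simp add: C_def D_def A_def \<gamma>_def)
    finally show ?thesis .
  qed
  have "smooth_on J (\<lambda>t. X (s0, t))"
    by (rule smooth_slice_t[OF smooth_X])
  moreover have "smooth_on J (\<lambda>t. s0 *\<^sub>R \<gamma> t)"
    by (rule smooth_on_bounded_linear_compose[OF bounded_linear_scaleR_right intervals(3) smooth_\<gamma>])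
  ultimately have smooth_D: "smooth_on J D"
    unfolding D_def[abs_def] by (rule smooth_on_diff[OF intervals(3)])
  define D' where "D' t = frechet_derivative D (at t) 1" for t
  have D': "(D has_vector_derivative D' t) (at t)" if "t \<in> J" for t
  proof -
    have d: "(D has_derivative frechet_derivative D (at t)) (at t)"
      by (rule smooth_on_has_derivative[OF smooth_D that])
    have "frechet_derivative D (at t) h = h *\<^sub>R D' t" for h
      using linear_cmul[OF has_derivative_linear[OF d], of h 1] by (simp add: D'_def)
    then show ?thesis
      unfolding has_vector_derivative_def by (intro has_derivative_eq_rhs[OF d] ext)
  qed
  \<comment> \<open>\<open>D'\<close> is the \<open>t\<close>-velocity of \<open>X\<close> minus
    \<open>s0\<close> times that of \<open>\<gamma>\<close>. The first is orthogonal to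
    \<open>k\<close> because \<open>t\<close>-lines have constant \<open>s\<close>, and to
    \<open>\<gamma>\<close> because \<open>G\<close> is a combination of \<open>k\<close> and
    \<open>n\<close>. For the second, differentiate the constant products of
    \<open>\<gamma>\<close>.\<close>
  have D'_products: "\<langle>k, D' t\<rangle> = 0" "\<langle>\<gamma> t, D' t\<rangle> = 0" if "t \<in> J" for t
  proof -
    have st: "(s0, t) \<in> I \<times> J"
      using that assms by simp
    define \<gamma>' where "\<gamma>' = frechet_derivative \<gamma> (at t) 1"
    have \<gamma>d: "(\<gamma> has_derivative frechet_derivative \<gamma> (at t)) (at t)"
      by (rule smooth_on_has_derivative[OF smooth_\<gamma> that])
    have "((\<lambda>t. (s0, t)) has_derivative (\<lambda>h. (0, h))) (at t)"
      by (auto intro!: derivative_eq_intros)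
    from has_derivative_compose[OF this X_has_derivative[OF st]]
    have "((\<lambda>t. X (s0, t)) has_derivative (\<lambda>h. dX (s0, t) (0, h))) (at t)" .
    then have "(D has_derivative (\<lambda>h. dX (s0, t) (0, h) - s0 *\<^sub>R frechet_derivative \<gamma> (at t) h)) (at t)"
      unfolding D_def[abs_def] by (intro has_derivative_diff has_derivative_scaleR_right \<gamma>d)
    then have D'_eq: "D' t = dX (s0, t) (0, 1) - s0 *\<^sub>R \<gamma>'"
      by (simp add: D'_def \<gamma>'_def frechet_derivative_at[symmetric])
    have "((\<lambda>t. \<langle>k, \<gamma> t\<rangle>) has_derivative (\<lambda>h. \<langle>k, frechet_derivative \<gamma> (at t) h\<rangle> + \<langle>0, \<gamma> t\<rangle>)) (at t)"
      by (intro mink.FDERIV has_derivative_const \<gamma>d)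
    then have "\<langle>k, \<gamma>'\<rangle> + \<langle>0, \<gamma> t\<rangle> = 0"
      unfolding \<gamma>'_def by (rule has_derivative_constant_on_open[OF _ intervals(3) that \<gamma>_products(1)])
    then have k\<gamma>': "\<langle>k, \<gamma>'\<rangle> = 0"
      by (simp add: mink.zero_left)
    have "((\<lambda>t. \<langle>\<gamma> t, \<gamma> t\<rangle>) has_derivative (\<lambda>h. \<langle>\<gamma> t, frechet_derivative \<gamma> (at t) h\<rangle>
        + \<langle>frechet_derivative \<gamma> (at t) h, \<gamma> t\<rangle>)) (at t)"
      by (intro mink.FDERIV \<gamma>d)
    then have "\<langle>\<gamma> t, \<gamma>'\<rangle> + \<langle>\<gamma>', \<gamma> t\<rangle> = 0"
      unfolding \<gamma>'_def by (rule has_derivative_constant_on_open[OF _ intervals(3) that \<gamma>_products(2)])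
    then have \<gamma>\<gamma>': "\<langle>\<gamma> t, \<gamma>'\<rangle> = 0"
      by (simp add: mink_commute[of \<gamma>'])
    show "\<langle>k, D' t\<rangle> = 0"
      using coordinate_fields(5)[OF st] k\<gamma>' by (simp add: D'_eq mink.diff_right mink.scaleR_right)
    have "\<langle>\<gamma> t, dX (s0, t) (0, 1)\<rangle> = 0"
      using coordinate_fields(5)[OF st] n_orthogonal[OF st, of "(0, 1)"]
      by (simp add: \<gamma>_def G_def mink.add_left mink.scaleR_left)
    then show "\<langle>\<gamma> t, D' t\<rangle> = 0"
      using \<gamma>\<gamma>' by (simp add: D'_eq mink.diff_right mink.scaleR_right)
  qed
  \<comment> \<open>Read off from the second coordinate, which is the constant
    \<open>- \<epsilon>\<close> in \<open>space_curve\<close> and so can be divided out.\<close>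
  define b where "b t = - \<epsilon> * Linv (D' t) $ 2" for t
  have smooth_b: "smooth_on J b"
    unfolding b_def[abs_def] D'_def
    by (intro smooth_on_mult smooth_on_const smooth_on_bounded_linear_compose[OF bounded_linear_vec_nth]
        smooth_on_bounded_linear_compose[OF bLinv] smooth_on_frechet_derivative smooth_D intervals)
  have smooth_\<gamma>0: "smooth_on J \<gamma>0"
    unfolding \<gamma>0_def[abs_def]
    by (intro smooth_on_bounded_linear_compose[OF bounded_linear_vec_nth]
        smooth_on_bounded_linear_compose[OF bLinv] smooth_\<gamma> intervals)
  have Linv_D': "Linv (D' t) = b t *\<^sub>R space_curve \<epsilon> \<gamma>0 t" if "t \<in> J" for t
  proof -
    define v where "v = Linv (D' t)"
    define r where "r = sqrt (- 2 * \<epsilon> * \<gamma>0 t + 1)"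
    have "\<langle>k0, v\<rangle> = 0" "\<langle>null_curve \<epsilon> \<gamma>0 t, v\<rangle> = 0"
      unfolding v_def Linv_\<gamma>(1)[OF that, symmetric] Linv_k[symmetric] mink_Linv
      using D'_products[OF that] by auto
    then have "v $ 3 = v $ 1" "\<epsilon> * v $ 1 = - r * v $ 2"
      by (auto simp: mink_def null_curve_def r_def algebra_simps)
    then show ?thesis
      unfolding space_curve_def b_def v_def[symmetric] r_def[symmetric]
      using eps by (auto simp: vec_eq_iff forall_3)
  qed
  \<comment> \<open>The integral over \<open>t\<close> is 0 at \<open>t0\<close>, so the value of
    \<open>D\<close> there is the translation.\<close>
  define a where "a = D t0"
  have D_eq: "Linv (D t) - Linv a = (LBINT \<xi>=t0..t. b \<xi> *\<^sub>R space_curve \<epsilon> \<gamma>0 \<xi>)" if "t \<in> J" for t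
  proof -
    have sub: "{min t0 t..max t0 t} \<subseteq> J"
      using that assms intervals(4) mem_is_interval_1_I[of J "min t0 t" "max t0 t"]
      by (auto simp: min_def max_def split: if_splits)
    have d: "((\<lambda>t. Linv (D t)) has_vector_derivative b \<xi> *\<^sub>R space_curve \<epsilon> \<gamma>0 \<xi>) (at \<xi>)" if "\<xi> \<in> J" for \<xi>
      using bounded_linear.has_vector_derivative[OF bLinv D'[OF that]] Linv_D'[OF that] by simp
    have "continuous_on J (\<lambda>\<xi>. Linv (D' \<xi>))"
      unfolding D'_def
      by (intro smooth_on_continuous smooth_on_bounded_linear_compose[OF bLinv]
          smooth_on_frechet_derivative smooth_D intervals)
    then have "continuous_on J (\<lambda>\<xi>. b \<xi> *\<^sub>R space_curve \<epsilon> \<gamma>0 \<xi>)"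
      by (rule continuous_on_eq) (rule Linv_D')
    then have "(LBINT \<xi>=t0..t. b \<xi> *\<^sub>R space_curve \<epsilon> \<gamma>0 \<xi>) = Linv (D t) - Linv (D t0)"
    proof (intro interval_integral_FTC_finite has_vector_derivative_at_within[OF d])
      show "\<xi> \<in> J" if "min t0 t \<le> \<xi>" "\<xi> \<le> max t0 t" for \<xi>
        using sub that by auto
    qed (rule continuous_on_subset[OF _ sub])
    then show ?thesis
      by (simp add: a_def)
  qed
  have "x (\<psi> (s, t)) = L (family_map \<epsilon> \<phi> \<gamma>0 b s0 t0 (s, t)) + a" if "s \<in> I" "t \<in> J" for s t
  proof -
    have "family_map \<epsilon> \<phi> \<gamma>0 b s0 t0 (s, t) = A s *\<^sub>R k0 + s *\<^sub>R Linv (\<gamma> t) + (Linv (D t) - Linv a)"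
      unfolding D_eq[OF that(2)] Linv_\<gamma>(1)[OF that(2)]
      by (simp add: family_map_def A_def null_curve_def space_curve_def)
    then have "L (family_map \<epsilon> \<phi> \<gamma>0 b s0 t0 (s, t)) = A s *\<^sub>R k + s *\<^sub>R \<gamma> t + (D t - a)"
      by (simp add: linear_add[OF linL] linear_diff[OF linL] linear_cmul[OF linL] L(2) Linv(2))
    then show ?thesis
      using C_eq[OF that] G_eq[OF that] by (simp add: C_def algebra_simps)
  qed
  moreover have "family_data \<epsilon> \<phi> \<gamma>0 b s0 t0 I J"
    using eps intervals assms smooth_\<phi> \<phi>0 deriv_\<phi> smooth_\<gamma>0 smooth_b Linv_\<gamma>(2)
    by (simp add: family_data_def)
  ultimately show ?thesis
    by blast
qed

end

text \<open>\<open>L\<close> is chosen with \<open>Linv (G u0) = (0, 1, - \<epsilon>)\<close>, whose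
  second coordinate is 1, so the sign condition of \<open>adapted_chart\<close> persists near
  \<open>u0\<close>. It remains to see that the prescribed coordinates have an injective derivative
  at \<open>u0\<close>.\<close>

lemma (in cpd_chart) locally_family:
  assumes "u0 \<in> W"
  shows "\<exists>V. open V \<and> \<psi> u0 \<in> V \<and> V \<subseteq> M \<and>
    (\<exists>\<epsilon> \<phi> \<gamma>0 b s0 t0 I J W L a \<psi>.
       family_data \<epsilon> \<phi> \<gamma>0 b s0 t0 I J \<and> W \<subseteq> I \<times> J \<and>
       congruent_via L a \<psi> V x W (family_map \<epsilon> \<phi> \<gamma>0 b s0 t0))"
proof -
  obtain L where L: "lorentz_map L" "L k0 = k" "L (vector [0, 1, - \<epsilon>]) = G u0"
    using null_frame[OF eps k_null G_products(2,1)[OF assms]] by metis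
  obtain Linv where Linv: "lorentz_map Linv" "\<And>v. Linv (L v) = v" "\<And>v. L (Linv v) = v"
    using lorentz_map_inverse[OF L(1)] by metis
  have mink_L: "\<langle>L v, L w\<rangle> = \<langle>v,w\<rangle>" for v w
    using L(1) by (simp add: lorentz_map_def)
  have bLinv: "bounded_linear Linv"
    using Linv(1) by (simp add: lorentz_map_def linear_conv_bounded_linear)
  \<comment> \<open>The third vector of the frame in \<open>null_frame\<close>: it is orthogonal to
    \<open>k\<close> and \<open>G u0\<close> and completes them to a basis.\<close>
  define e where "e = L (vector [1, - \<epsilon>, 1])"
  have e_k: "\<langle>e,k\<rangle> = 0"
    unfolding e_def L(2)[symmetric] mink_L by (simp add: mink_def)
  have basis: "v = 0" if "\<langle>k,v\<rangle> = 0" "\<langle>G u0,v\<rangle> = 0" "\<langle>e,v\<rangle> = 0" for v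
  proof -
    have "\<langle>w, Linv v\<rangle> = \<langle>L w, v\<rangle>" for w
      using mink_L[of w "Linv v"] by (simp add: Linv(3))
    then have "\<langle>k0, Linv v\<rangle> = 0" "\<langle>vector [0, 1, - \<epsilon>], Linv v\<rangle> = 0" "\<langle>vector [1, - \<epsilon>, 1], Linv v\<rangle> = 0"
      using that by (simp_all only: e_def L(2,3))
    then have "Linv v = 0"
      using eps by (auto simp: mink_def vec_eq_iff forall_3)
    then show ?thesis
      using Linv(3)[of v] linear_0[of L] L(1) by (simp add: lorentz_map_def)
  qed
  define W1 where "W1 = W \<inter> (\<lambda>u. Linv (G u) $ 2) -` {0<..}"
  have "continuous_on W (\<lambda>u. Linv (G u) $ 2)"
    by (intro smooth_on_continuous smooth_on_bounded_linear_compose[OF bounded_linear_vec_nth]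
        smooth_on_bounded_linear_compose[OF bLinv] smooth_G open_domain)
  then have oW1: "open W1"
    unfolding W1_def by (intro continuous_open_preimage open_domain) auto
  have u0: "u0 \<in> W1"
    using assms by (simp add: W1_def L(3)[symmetric] Linv(2))
  have W1: "W1 \<subseteq> W"
    by (auto simp: W1_def)
  \<comment> \<open>The value of \<open>s\<close> at the base point. The factor of \<open>G\<close>
    in \<open>\<Phi>\<close> vanishes there, which removes the derivative of \<open>G\<close> from
    that of \<open>\<Phi>\<close> at \<open>u0\<close>.\<close>
  define c where "c = \<epsilon> * \<langle>k, X u0\<rangle>"
  define \<Phi> where "\<Phi> u = (\<epsilon> * \<langle>k, X u\<rangle>, \<langle>e, X u - (\<epsilon> * \<langle>k, X u\<rangle> - c) *\<^sub>R G u\<rangle>)" for u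
  have "smooth_on W1 \<Phi>"
    unfolding \<Phi>_def[abs_def]
    by (intro smooth_on_Pair smooth_on_mult smooth_on_diff smooth_on_scaleR smooth_on_const
        smooth_on_bilinear[OF mink.bounded_bilinear_axioms] smooth_on_subset[OF smooth_X W1]
        smooth_on_subset[OF smooth_G W1] oW1)
  moreover have "inj (frechet_derivative \<Phi> (at u0))"
  proof -
    have k_d: "((\<lambda>u. \<epsilon> * \<langle>k, X u\<rangle>) has_derivative (\<lambda>v. \<epsilon> * (\<langle>k, dX u0 v\<rangle> + \<langle>0, X u0\<rangle>))) (at u0)"
      by (intro has_derivative_mult_right mink.FDERIV has_derivative_const X_has_derivative assms)
    have "(\<Phi> has_derivative (\<lambda>v. (\<epsilon> * (\<langle>k, dX u0 v\<rangle> + \<langle>0, X u0\<rangle>),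
        \<langle>e, dX u0 v - ((\<epsilon> * \<langle>k, X u0\<rangle> - c) *\<^sub>R dG u0 v
            + (\<epsilon> * (\<langle>k, dX u0 v\<rangle> + \<langle>0, X u0\<rangle>) - 0) *\<^sub>R G u0)\<rangle>
          + \<langle>0, X u0 - (\<epsilon> * \<langle>k, X u0\<rangle> - c) *\<^sub>R G u0\<rangle>))) (at u0)"
      unfolding \<Phi>_def[abs_def]
      by (intro has_derivative_Pair mink.FDERIV has_derivative_const has_derivative_diff
          has_derivative_scaleR k_d X_has_derivative G_has_derivative assms)
    then have d: "frechet_derivative \<Phi> (at u0) = (\<lambda>v. (\<epsilon> * \<langle>k, dX u0 v\<rangle>,
        \<langle>e, dX u0 v - (\<epsilon> * \<langle>k, dX u0 v\<rangle>) *\<^sub>R G u0\<rangle>))"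
      by (simp add: frechet_derivative_at[symmetric] mink.zero_left c_def del: o_apply)
    have lin: "linear (frechet_derivative \<Phi> (at u0))"
      using \<open>smooth_on W1 \<Phi>\<close> u0 by (intro has_derivative_linear[OF smooth_on_has_derivative])
    \<comment> \<open>A kernel vector yields a tangent vector orthogonal to \<open>k\<close> and
      \<open>e\<close>. It is also orthogonal to the normal, hence to \<open>G u0\<close>, a
      combination of \<open>k\<close> and \<open>n u0\<close>, and \<open>basis\<close>
      applies.\<close>
    have "v = 0" if "frechet_derivative \<Phi> (at u0) v = 0" for v
    proof -
      have kv: "\<langle>k, dX u0 v\<rangle> = 0" and ev: "\<langle>e, dX u0 v\<rangle> = 0"
        using that eps2 by (auto simp: d zero_prod_def)
      then have "\<langle>G u0, dX u0 v\<rangle> = 0"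
        using n_orthogonal[OF assms, of v] by (simp add: G_def mink.add_left mink.scaleR_left)
      then have "dX u0 v = 0"
        using basis kv ev by blast
      then show ?thesis
        using inj_dX[OF assms] linear_0[OF linear_dX[OF assms]] by (metis injD)
    qed
    then show ?thesis
      using lin linear_injective_0 by blast
  qed
  ultimately obtain I J g where g: "open I" "is_interval I" "open J" "is_interval J" "\<Phi> u0 \<in> I \<times> J"
    "g ` (I \<times> J) \<subseteq> W1" "g (\<Phi> u0) = u0" "\<And>y. y \<in> I \<times> J \<Longrightarrow> \<Phi> (g y) = y"
    "local_param x (I \<times> J) (\<psi> \<circ> g)"
    using local_param_reparametrize[OF local_param_subset[OF param oW1 W1] _ u0] by metis
  have im: "(\<psi> \<circ> g) ` (I \<times> J) \<subseteq> \<psi> ` W"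
    using g(6) W1 by auto
  interpret c: cpd_chart M x N "I \<times> J" "\<psi> \<circ> g" k \<epsilon> k1
  proof
    show "(\<psi> \<circ> g) ` (I \<times> J) \<subseteq> M"
      using im image_subset by blast
  qed (use im oriented g(9) k_null eps normal_product k_normal principal k1_nonzero in blast)+
  \<comment> \<open>\<open>G\<close> is determined by \<open>k\<close> and the value of
    \<open>N\<close> at the point, so it does not depend on the chart.\<close>
  have cG: "c.G y = G (g y)" for y
    by (simp add: c.G_def G_def c.f_def f_def)
  interpret c: adapted_chart M x N I J "\<psi> \<circ> g" k \<epsilon> k1 e c L Linv
  proof
    show "fst y = \<epsilon> * \<langle>k, x ((\<psi> \<circ> g) y)\<rangle>" if "y \<in> I \<times> J" for y
      using arg_cong[OF g(8)[OF that], of fst] by (simp add: \<Phi>_def)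
    then show "snd y = \<langle>e, x ((\<psi> \<circ> g) y) - (fst y - c) *\<^sub>R c.G y\<rangle>" if "y \<in> I \<times> J" for y
      using arg_cong[OF g(8)[OF that], of snd] that by (simp add: \<Phi>_def cG)
    show "0 < Linv (c.G y) $ 2" if "y \<in> I \<times> J" for y
      using g(6) that by (auto simp: W1_def cG)
  qed (use g e_k L Linv in auto)
  obtain \<phi> \<gamma>0 b a where fam: "family_data \<epsilon> \<phi> \<gamma>0 b (fst (\<Phi> u0)) (snd (\<Phi> u0)) I J"
    "\<And>u. u \<in> I \<times> J \<Longrightarrow> x ((\<psi> \<circ> g) u) = L (family_map \<epsilon> \<phi> \<gamma>0 b (fst (\<Phi> u0)) (snd (\<Phi> u0)) u) + a"
    using c.adapted_chart_family[of "fst (\<Phi> u0)" "snd (\<Phi> u0)"] g(5) by (auto simp: mem_Times_iff)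
  have "congruent_via L a (\<psi> \<circ> g) ((\<psi> \<circ> g) ` (I \<times> J)) x (I \<times> J)
      (family_map \<epsilon> \<phi> \<gamma>0 b (fst (\<Phi> u0)) (snd (\<Phi> u0)))"
    using fam(2) L(1) g(9) by (simp add: congruent_via_def)
  moreover have "open ((\<psi> \<circ> g) ` (I \<times> J))"
    using g(9) by (rule local_paramD)
  moreover have "\<psi> u0 \<in> (\<psi> \<circ> g) ` (I \<times> J)"
    using g(5,7) by (metis comp_apply imageI)
  moreover have "(\<psi> \<circ> g) ` (I \<times> J) \<subseteq> M"
    by (rule c.image_subset)
  ultimately show ?thesis
    using fam(1) by (intro exI[of _ "(\<psi> \<circ> g) ` (I \<times> J)"] conjI) (assumption | blast)+
qed

section \<open>Points where the light-like vector is tangent to the surface\<close>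

lemma (in oriented_chart) tangent_frame_expansion:
  assumes "u \<in> W" "e1 \<in> tangent_space x (\<psi> u)" "e2 \<in> tangent_space x (\<psi> u)"
    and "\<langle>e1,e1\<rangle> \<noteq> 0" "\<langle>e2,e2\<rangle> \<noteq> 0" "\<langle>e1,e2\<rangle> = 0" "\<langle>n u, v\<rangle> = 0"
  obtains \<alpha> \<beta> where "v = \<alpha> *\<^sub>R e1 + \<beta> *\<^sub>R e2" "\<langle>v,e1\<rangle> = \<alpha> * \<langle>e1,e1\<rangle>" "\<langle>v,e2\<rangle> = \<beta> * \<langle>e2,e2\<rangle>"
proof -
  define D where "D = (\<lambda>w. fst w *\<^sub>R e1 + snd w *\<^sub>R e2)"
  have products: "\<langle>D w, e1\<rangle> = fst w * \<langle>e1,e1\<rangle>" "\<langle>D w, e2\<rangle> = snd w * \<langle>e2,e2\<rangle>" for w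
    using assms(6) by (simp_all add: D_def mink.add_left mink.scaleR_left mink_commute[of e2 e1])
  have "linear D"
    unfolding D_def by (rule linearI) (simp_all add: algebra_simps)
  moreover have "inj D"
  proof (rule injI)
    fix w w' assume "D w = D w'"
    then show "w = w'"
      using products[of w] products[of w'] assms(4,5) by (simp add: prod_eq_iff)
  qed
  moreover have "\<langle>n u, e1\<rangle> = 0" "\<langle>n u, e2\<rangle> = 0"
    using n_orthogonal[OF assms(1)] assms(2,3) unfolding tangent_space_eq[OF assms(1)] by blast+
  then have "\<langle>n u, D w\<rangle> = 0" for w
    by (simp add: D_def mink.add_right mink.scaleR_right)
  ultimately obtain w where "v = D w"
    using orthogonal_normal_imp_tangent[of D "n u" v] n_nonnull[OF assms(1)] assms(7) by metis
  then show thesis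
    using that[of "fst w" "snd w"] products[of w] by (simp add: D_def)
qed

text \<open>Three linearly independent null vectors cannot all be orthogonal to a non-zero vector,
  because the metric is non-degenerate.\<close>

lemma transversal_null_vector:
  assumes "v \<noteq> 0"
  obtains k where "light_like k" "\<langle>k,v\<rangle> \<noteq> 0"
proof -
  have "\<langle>vector [1, 0, 1],v\<rangle> \<noteq> 0 \<or> \<langle>vector [- 1, 0, 1],v\<rangle> \<noteq> 0 \<or> \<langle>vector [0, 1, 1],v\<rangle> \<noteq> 0"
    using assms by (auto simp: mink_def vec_eq_iff forall_3)
  moreover have "light_like (vector [1, 0, 1])" "light_like (vector [- 1, 0, 1])"
    "light_like (vector [0, 1, 1])"
    by (simp_all add: light_like_def mink_def vec_eq_iff forall_3)
  ultimately show thesis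
    using that by blast
qed

text \<open>Where \<open>k\<close> is tangent to \<open>M\<close>, both components of the null vector \<open>k\<close> in the frame of principal
  directions are non-zero. Both principal curvatures are therefore \<open>k1\<close> nearby, and then every
  constant direction is canonical.\<close>

lemma transversal_principal_direction:
  fixes M :: "'a::topological_space set" and x N :: "'a \<Rightarrow> real^3"
  assumes oriented: "oriented_surface M x N" and diag: "diagonalizable_shape_operator M x N"
    and V: "open V" "p \<in> V" "V \<subseteq> M"
    and k: "light_like k" "canonical_principal_direction V x N k k1" "\<forall>q\<in>V. k1 q \<noteq> 0"
  shows "\<exists>V k. open V \<and> p \<in> V \<and> V \<subseteq> M \<and> light_like k \<and>
    canonical_principal_direction V x N k k1 \<and> (\<forall>q\<in>V. k1 q \<noteq> 0) \<and> \<langle>k, N p\<rangle> \<noteq> 0"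
proof (cases "\<langle>k, N p\<rangle> = 0")
  case False
  then show ?thesis
    using assms by blast
next
  case True
  obtain V' E1 E2 where V': "open V'" "p \<in> V'" "V' \<subseteq> M" "orthonormal_frame V' x E1 E2"
    "\<forall>q\<in>V'. \<exists>l1 l2. shape_operator x N q (E1 q) = l1 *\<^sub>R E1 q \<and> shape_operator x N q (E2 q) = l2 *\<^sub>R E2 q"
    using diag V unfolding diagonalizable_shape_operator_def by (meson subsetD)
  have im: "immersed_surface M x"
    using oriented by (simp add: oriented_surface_def)
  obtain W \<psi> u0 where W: "local_param x W \<psi>" "u0 \<in> W" "\<psi> u0 = p" "\<psi> ` W \<subseteq> V \<inter> V'"
    by (rule local_param_within[OF im open_Int[OF V(1) V'(1)], of p]) (use V V' in auto)
  interpret oriented_chart M x N W \<psi>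
    using oriented W V(3) by unfold_locales auto
  define e1 where "e1 u = E1 (\<psi> u)" for u
  define e2 where "e2 u = E2 (\<psi> u)" for u
  have smooth_e: "smooth_on W e1" "smooth_on W e2"
    using V'(4) W(1,4) unfolding orthonormal_frame_def smooth_along_def e1_def[abs_def] e2_def[abs_def]
    by (auto simp: comp_def)
  have frame: "e1 u \<in> tangent_space x (\<psi> u)" "e2 u \<in> tangent_space x (\<psi> u)"
    "\<langle>e1 u, e1 u\<rangle> \<noteq> 0" "\<langle>e2 u, e2 u\<rangle> \<noteq> 0" "\<langle>e1 u, e2 u\<rangle> = 0" if "u \<in> W" for u
  proof -
    have "\<psi> u \<in> V'"
      using that W(4) by blast
    then have "e1 u \<in> tangent_space x (\<psi> u) \<and> e2 u \<in> tangent_space x (\<psi> u) \<and>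
        \<bar>\<langle>e1 u, e1 u\<rangle>\<bar> = 1 \<and> \<bar>\<langle>e2 u, e2 u\<rangle>\<bar> = 1 \<and> \<langle>e1 u, e2 u\<rangle> = 0"
      using V'(4) unfolding orthonormal_frame_def e1_def e2_def by blast
    then show "e1 u \<in> tangent_space x (\<psi> u)" "e2 u \<in> tangent_space x (\<psi> u)"
      "\<langle>e1 u, e1 u\<rangle> \<noteq> 0" "\<langle>e2 u, e2 u\<rangle> \<noteq> 0" "\<langle>e1 u, e2 u\<rangle> = 0"
      by auto
  qed
  note expansion = tangent_frame_expansion[OF _ frame]
  define W1 where "W1 = W \<inter> (\<lambda>u. \<langle>k, e1 u\<rangle> * \<langle>k, e2 u\<rangle>) -` (- {0})"
  have "continuous_on W (\<lambda>u. \<langle>k, e1 u\<rangle> * \<langle>k, e2 u\<rangle>)"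
    by (intro smooth_on_continuous smooth_on_mult smooth_on_const
        smooth_on_bilinear[OF mink.bounded_bilinear_axioms] smooth_e open_domain)
  then have oW1: "open W1"
    unfolding W1_def by (intro continuous_open_preimage open_domain) auto
  have lp1: "local_param x W1 \<psi>"
    by (rule local_param_subset[OF param oW1]) (simp add: W1_def)
  have "u0 \<in> W1"
  proof -
    have "\<langle>n u0, k\<rangle> = 0"
      using True W(3) by (simp add: mink_commute)
    then obtain \<alpha> \<beta> where ab: "k = \<alpha> *\<^sub>R e1 u0 + \<beta> *\<^sub>R e2 u0" "\<langle>k, e1 u0\<rangle> = \<alpha> * \<langle>e1 u0, e1 u0\<rangle>"
      "\<langle>k, e2 u0\<rangle> = \<beta> * \<langle>e2 u0, e2 u0\<rangle>"
      using expansion[OF W(2) W(2) W(2) W(2) W(2) W(2)] by metis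
    have "\<langle>k,k\<rangle> = \<alpha> * \<langle>k, e1 u0\<rangle> + \<beta> * \<langle>k, e2 u0\<rangle>"
      by (subst (2) ab(1)) (simp add: mink.add_right mink.scaleR_right)
    \<comment> \<open>The frame vectors are not null, so if one coefficient vanished, the other
      would too, against \<open>k \<noteq> 0\<close>.\<close>
    then have "\<alpha> * (\<alpha> * \<langle>e1 u0, e1 u0\<rangle>) + \<beta> * (\<beta> * \<langle>e2 u0, e2 u0\<rangle>) = 0" "\<alpha> \<noteq> 0 \<or> \<beta> \<noteq> 0"
      using k(1) ab unfolding light_like_def by auto
    then have "\<alpha> \<noteq> 0" "\<beta> \<noteq> 0"
      using frame(3,4)[OF W(2)] by auto
    then show ?thesis
      using W(2) frame(3,4)[OF W(2)] ab by (simp add: W1_def)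
  qed
  have umbilic: "shape_operator x N (\<psi> u) v = k1 (\<psi> u) *\<^sub>R v" if u: "u \<in> W1" and v: "\<langle>n u, v\<rangle> = 0" for u v
  proof -
    have uW: "u \<in> W" and nz: "\<langle>k, e1 u\<rangle> \<noteq> 0" "\<langle>k, e2 u\<rangle> \<noteq> 0"
      using u by (auto simp: W1_def)
    have uV: "\<psi> u \<in> V" "\<psi> u \<in> V'"
      using uW W(4) by auto
    obtain a1 a2 where a: "e1 u = dX u a1" "e2 u = dX u a2"
      using frame(1,2)[OF uW] unfolding tangent_space_eq[OF uW] by blast
    have S: "shape_operator x N (\<psi> u) (\<alpha> *\<^sub>R e1 u + \<beta> *\<^sub>R e2 u) = \<alpha> *\<^sub>R shape_operator x N (\<psi> u) (e1 u)
        + \<beta> *\<^sub>R shape_operator x N (\<psi> u) (e2 u)" for \<alpha> \<beta>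
    proof -
      have "\<alpha> *\<^sub>R e1 u + \<beta> *\<^sub>R e2 u = dX u (\<alpha> *\<^sub>R a1 + \<beta> *\<^sub>R a2)"
        unfolding a linear_add[OF linear_dX[OF uW]] linear_cmul[OF linear_dX[OF uW]] ..
      then show ?thesis
        unfolding a by (simp only: shape_operator_eq[OF uW] linear_add[OF linear_dn[OF uW]]
            linear_cmul[OF linear_dn[OF uW]] scaleR_minus_right minus_add_distrib)
    qed
    obtain l1 l2 where l: "shape_operator x N (\<psi> u) (e1 u) = l1 *\<^sub>R e1 u"
      "shape_operator x N (\<psi> u) (e2 u) = l2 *\<^sub>R e2 u"
      using V'(5) uV(2) unfolding e1_def e2_def by blast
    define kT where "kT = tangential_part x (\<psi> u) k"
    have kT: "kT = k - (\<langle>k, n u\<rangle> / \<langle>n u, n u\<rangle>) *\<^sub>R n u"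
      unfolding kT_def by (rule tangential_part_eq[OF uW])
    have ne: "\<langle>n u, e1 u\<rangle> = 0" "\<langle>n u, e2 u\<rangle> = 0"
      unfolding a by (rule n_orthogonal[OF uW])+
    have "\<langle>n u, kT\<rangle> = 0"
      using n_nonnull[OF uW] unfolding kT by (simp add: mink.diff_right mink.scaleR_right mink_commute)
    then obtain \<alpha> \<beta> where ab: "kT = \<alpha> *\<^sub>R e1 u + \<beta> *\<^sub>R e2 u" "\<langle>kT, e1 u\<rangle> = \<alpha> * \<langle>e1 u, e1 u\<rangle>"
      "\<langle>kT, e2 u\<rangle> = \<beta> * \<langle>e2 u, e2 u\<rangle>"
      using expansion[OF uW uW uW uW uW uW] by metis
    have "\<langle>kT, e1 u\<rangle> = \<langle>k, e1 u\<rangle>" "\<langle>kT, e2 u\<rangle> = \<langle>k, e2 u\<rangle>"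
      using ne unfolding kT by (simp_all add: mink.diff_left mink.scaleR_left)
    then have ab0: "\<alpha> \<noteq> 0" "\<beta> \<noteq> 0"
      using nz ab by auto
    have "shape_operator x N (\<psi> u) kT = k1 (\<psi> u) *\<^sub>R kT"
      using k(2) uV(1) unfolding canonical_principal_direction_def kT_def by blast
    then have eq: "\<alpha> *\<^sub>R (l1 *\<^sub>R e1 u) + \<beta> *\<^sub>R (l2 *\<^sub>R e2 u)
        = k1 (\<psi> u) *\<^sub>R (\<alpha> *\<^sub>R e1 u + \<beta> *\<^sub>R e2 u)"
      unfolding ab(1) S l .
    have "\<alpha> * l1 * \<langle>e1 u, e1 u\<rangle> = k1 (\<psi> u) * \<alpha> * \<langle>e1 u, e1 u\<rangle>"
      using arg_cong[OF eq, of "\<lambda>v. \<langle>v, e1 u\<rangle>"] frame(5)[OF uW]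
      by (auto simp: mink.add_left mink.scaleR_left mink_commute[of "e2 u" "e1 u"])
    moreover have "\<beta> * l2 * \<langle>e2 u, e2 u\<rangle> = k1 (\<psi> u) * \<beta> * \<langle>e2 u, e2 u\<rangle>"
      using arg_cong[OF eq, of "\<lambda>v. \<langle>v, e2 u\<rangle>"] frame(5)[OF uW]
      by (auto simp: mink.add_left mink.scaleR_left)
    ultimately have "l1 = k1 (\<psi> u)" "l2 = k1 (\<psi> u)"
      using ab0 frame(3,4)[OF uW] by auto
    moreover obtain \<alpha>' \<beta>' where "v = \<alpha>' *\<^sub>R e1 u + \<beta>' *\<^sub>R e2 u"
      using expansion[OF uW uW uW uW uW uW v] by metis
    ultimately show ?thesis
      by (simp add: S l scaleR_right_distrib mult.commute)
  qed
  have "N p \<noteq> 0"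
    using n_nonnull[OF W(2)] W(3) by (auto simp: mink.zero_left)
  then obtain k' where k': "light_like k'" "\<langle>k', N p\<rangle> \<noteq> 0"
    by (rule transversal_null_vector)
  have sub: "\<psi> ` W1 \<subseteq> V"
    using W(4) by (auto simp: W1_def)
  have "canonical_principal_direction (\<psi> ` W1) x N k' k1"
    unfolding canonical_principal_direction_def
  proof (intro conjI ballI)
    show "smooth_along (\<psi> ` W1) x k1"
      using k(2) sub unfolding canonical_principal_direction_def smooth_along_def by blast
    fix q assume "q \<in> \<psi> ` W1"
    then obtain u where u: "u \<in> W1" "q = \<psi> u"
      by blast
    then have uW: "u \<in> W"
      by (simp add: W1_def)
    show "shape_operator x N q (tangential_part x q k') = k1 q *\<^sub>R tangential_part x q k'"
      unfolding u(2)
      by (rule umbilic[OF u(1)])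
        (use n_nonnull[OF uW] in \<open>simp add: tangential_part_eq[OF uW] mink.diff_right mink.scaleR_right
          mink_commute[of "n u" k'] del: o_apply\<close>)
  qed
  moreover have "open (\<psi> ` W1)" "p \<in> \<psi> ` W1" "\<psi> ` W1 \<subseteq> M"
    using local_paramD(2)[OF lp1] \<open>u0 \<in> W1\<close> W(3) sub V(3) by auto
  ultimately show ?thesis
    using k' k(3) sub by blast
qed

section \<open>The two directions of the equivalence\<close>

lemma canonical_principal_direction_imp_family:
  fixes M :: "'a::topological_space set" and x N :: "'a \<Rightarrow> real^3"
  assumes oriented: "oriented_surface M x N" and diag: "diagonalizable_shape_operator M x N"
    and V: "open V" "p \<in> V" "V \<subseteq> M"
    and k: "light_like k" "canonical_principal_direction V x N k k1" "\<forall>q\<in>V. k1 q \<noteq> 0"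
  shows "\<exists>V. open V \<and> p \<in> V \<and> V \<subseteq> M \<and>
    (\<exists>\<epsilon> \<phi> \<gamma>0 b s0 t0 I J W L a \<psi>.
       family_data \<epsilon> \<phi> \<gamma>0 b s0 t0 I J \<and> W \<subseteq> I \<times> J \<and>
       congruent_via L a \<psi> V x W (family_map \<epsilon> \<phi> \<gamma>0 b s0 t0))"
proof -
  \<comment> \<open>These shadow the \<open>V\<close> and \<open>k\<close> of the assumptions: the
    new vector is not tangent at \<open>p\<close>, while the curvature function \<open>k1\<close> is
    kept.\<close>
  obtain V k where V: "open V" "p \<in> V" "V \<subseteq> M"
    and k: "light_like k" "canonical_principal_direction V x N k k1" "\<forall>q\<in>V. k1 q \<noteq> 0"
      "\<langle>k, N p\<rangle> \<noteq> 0"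
    using transversal_principal_direction[OF assms] by metis
  have im: "immersed_surface M x"
    using oriented by (simp add: oriented_surface_def)
  obtain W \<psi> u0 where W: "local_param x W \<psi>" "u0 \<in> W" "\<psi> u0 = p" "\<psi> ` W \<subseteq> V"
    by (rule local_param_within[OF im V(1,3,2)])
  interpret oriented_chart M x N W \<psi>
    using oriented W V(3) by unfold_locales auto
  \<comment> \<open>The second condition keeps the sign of \<open>\<langle>n u, n u\<rangle>\<close>
    equal to that at \<open>u0\<close>, so that one \<open>\<epsilon>\<close> serves the whole
    chart.\<close>
  define W1 where "W1 = W \<inter> (\<lambda>u. \<langle>k, n u\<rangle>) -` (- {0}) \<inter> (W \<inter> (\<lambda>u. \<langle>n u0, n u0\<rangle> * \<langle>n u, n u\<rangle>) -` {0<..})"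
  have "continuous_on W (\<lambda>u. \<langle>k, n u\<rangle>)" "continuous_on W (\<lambda>u. \<langle>n u0, n u0\<rangle> * \<langle>n u, n u\<rangle>)"
    by (intro smooth_on_continuous smooth_on_mult smooth_on_const smooth_n open_domain
        smooth_on_bilinear[OF mink.bounded_bilinear_axioms])+
  then have oW1: "open W1"
    unfolding W1_def by (intro open_Int continuous_open_preimage open_domain) auto
  have W1: "W1 \<subseteq> W"
    by (auto simp: W1_def)
  have u0: "u0 \<in> W1"
    using W(2,3) k(4) n_nonnull[OF W(2)] by (auto simp: W1_def zero_less_mult_iff linorder_neq_iff)
  define \<epsilon> where "\<epsilon> = - \<langle>n u0, n u0\<rangle>"
  have eps: "\<epsilon> \<in> {- 1, 1}"
    using unit_n[OF W(2)] by (auto simp: \<epsilon>_def abs_if split: if_splits)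
  interpret c: cpd_chart M x N W1 \<psi> k \<epsilon> k1
  proof
    show "local_param x W1 \<psi>"
      by (rule local_param_subset[OF param oW1 W1])
    show "\<psi> ` W1 \<subseteq> M"
      using image_subset W1 by blast
    show "\<langle>k,k\<rangle> = 0"
      using k(1) by (simp add: light_like_def)
    show "\<langle>N q, N q\<rangle> = - \<epsilon>" if q: "q \<in> \<psi> ` W1" for q
    proof -
      obtain u where u: "u \<in> W1" "q = \<psi> u"
        using q by blast
      then have "\<langle>n u0, n u0\<rangle> * \<langle>n u, n u\<rangle> > 0" "\<bar>\<langle>n u, n u\<rangle>\<bar> = 1" "\<bar>\<langle>n u0, n u0\<rangle>\<bar> = 1"
        using unit_n W(2) by (auto simp: W1_def)
      then show ?thesis
        using u(2) by (auto simp: \<epsilon>_def abs_if split: if_splits)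
    qed
    show "\<langle>k, N q\<rangle> \<noteq> 0" if "q \<in> \<psi> ` W1" for q
      using that by (auto simp: W1_def)
    show "shape_operator x N q (tangential_part x q k) = k1 q *\<^sub>R tangential_part x q k" "k1 q \<noteq> 0"
      if "q \<in> \<psi> ` W1" for q
      using that W1 W(4) k(2,3) unfolding canonical_principal_direction_def by blast+
  qed (use oriented eps in auto)
  show ?thesis
    using c.locally_family[OF u0] unfolding W(3) .
qed

lemma congruent_via_imp_family_chart:
  assumes "oriented_surface M x N" "V \<subseteq> M" "family_data \<epsilon> \<phi> \<gamma>0 b s0 t0 I J" "W \<subseteq> I \<times> J"
    and "congruent_via L a \<psi> V x W (family_map \<epsilon> \<phi> \<gamma>0 b s0 t0)"
  shows "family_chart M x N W \<psi> \<epsilon> \<phi> \<gamma>0 b s0 t0 I J L a" "\<psi> ` W = V"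
  using assms by (auto simp: congruent_via_def intro!: family_chart.intro oriented_chart.intro
      family_chart_axioms.intro)

theorem theorem3p11:
  fixes M :: "'a::{t2_space, second_countable_topology} set"
    and x N :: "'a \<Rightarrow> real^3"
  assumes "oriented_surface M x N"
    and "diagonalizable_shape_operator M x N"
  shows "(\<forall>p\<in>M.
     (\<exists>V. open V \<and> p \<in> V \<and> V \<subseteq> M \<and>
        (\<exists>k k1. light_like k \<and> canonical_principal_direction V x N k k1 \<and> (\<forall>q\<in>V. k1 q \<noteq> 0)))
     \<longleftrightarrow>
     (\<exists>V. open V \<and> p \<in> V \<and> V \<subseteq> M \<and>
        (\<exists>\<epsilon> \<phi> \<gamma>0 b s0 t0 I J W L a \<psi>.
           family_data \<epsilon> \<phi> \<gamma>0 b s0 t0 I J \<and> W \<subseteq> I \<times> J \<and>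
           congruent_via L a \<psi> V x W (family_map \<epsilon> \<phi> \<gamma>0 b s0 t0))))
   \<and>
    (\<forall>V \<epsilon> \<phi> \<gamma>0 b s0 t0 I J W L a \<psi>.
     open V \<and> V \<subseteq> M \<and> family_data \<epsilon> \<phi> \<gamma>0 b s0 t0 I J \<and> W \<subseteq> I \<times> J \<and>
      congruent_via L a \<psi> V x W (family_map \<epsilon> \<phi> \<gamma>0 b s0 t0) \<longrightarrow>
     light_like (L (vector [1, 0, 1])) \<and>
     (\<exists>k1. canonical_principal_direction V x N (L (vector [1, 0, 1])) k1 \<and> (\<forall>q\<in>V. k1 q \<noteq> 0)) \<and>
     (\<exists>e1. smooth_along V x e1 \<and>
        (\<forall>q\<in>V. e1 q \<in> tangent_space x q \<and> \<langle>e1 q, e1 q\<rangle> = \<epsilon>) \<and>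
        (\<forall>(s, t)\<in>W. tangential_part x (\<psi> (s, t)) (L (vector [1, 0, 1])) = \<phi> s *\<^sub>R e1 (\<psi> (s, t)))))"
    (is "?equivalence \<and> ?direction")
proof
  \<comment> \<open>Serves twice: it is the second conjunct, and it gives the converse of the
    equivalence with \<open>L k0\<close> as light-like vector.\<close>
  have family: "light_like (L k0) \<and>
     (\<exists>k1. canonical_principal_direction V x N (L k0) k1 \<and> (\<forall>q\<in>V. k1 q \<noteq> 0)) \<and>
     (\<exists>e1. smooth_along V x e1 \<and>
        (\<forall>q\<in>V. e1 q \<in> tangent_space x q \<and> \<langle>e1 q, e1 q\<rangle> = \<epsilon>) \<and>
        (\<forall>(s, t)\<in>W. tangential_part x (\<psi> (s, t)) (L k0) = \<phi> s *\<^sub>R e1 (\<psi> (s, t))))"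
    if "V \<subseteq> M" "family_data \<epsilon> \<phi> \<gamma>0 b s0 t0 I J" "W \<subseteq> I \<times> J"
      "congruent_via L a \<psi> V x W (family_map \<epsilon> \<phi> \<gamma>0 b s0 t0)"
    for V \<epsilon> \<phi> \<gamma>0 b s0 t0 I J W L a \<psi>
    using family_chart.family_canonical_principal_direction
        [OF congruent_via_imp_family_chart(1)[OF assms(1) that]]
    unfolding congruent_via_imp_family_chart(2)[OF assms(1) that] by blast
  then show ?direction
    by blast
  show ?equivalence
  proof (intro ballI iffI)
    fix p assume "\<exists>V. open V \<and> p \<in> V \<and> V \<subseteq> M \<and>
        (\<exists>k k1. light_like k \<and> canonical_principal_direction V x N k k1 \<and> (\<forall>q\<in>V. k1 q \<noteq> 0))"
    then show "\<exists>V. open V \<and> p \<in> V \<and> V \<subseteq> M \<and>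
        (\<exists>\<epsilon> \<phi> \<gamma>0 b s0 t0 I J W L a \<psi>.
           family_data \<epsilon> \<phi> \<gamma>0 b s0 t0 I J \<and> W \<subseteq> I \<times> J \<and>
           congruent_via L a \<psi> V x W (family_map \<epsilon> \<phi> \<gamma>0 b s0 t0))"
      by (elim exE conjE) (rule canonical_principal_direction_imp_family[OF assms])
  next
    fix p assume "\<exists>V. open V \<and> p \<in> V \<and> V \<subseteq> M \<and>
        (\<exists>\<epsilon> \<phi> \<gamma>0 b s0 t0 I J W L a \<psi>.
           family_data \<epsilon> \<phi> \<gamma>0 b s0 t0 I J \<and> W \<subseteq> I \<times> J \<and>
           congruent_via L a \<psi> V x W (family_map \<epsilon> \<phi> \<gamma>0 b s0 t0))"
    then show "\<exists>V. open V \<and> p \<in> V \<and> V \<subseteq> M \<and>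
        (\<exists>k k1. light_like k \<and> canonical_principal_direction V x N k k1 \<and> (\<forall>q\<in>V. k1 q \<noteq> 0))"
      using family by meson
  qed
qed

end
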